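(* Let $(\mathbf K,\mathbf V,\mathbf P)$ be an ordered valued subfield of a real closed valued field $(\mathbf R,\mathbf V_{\mathbf R},\mathbf P_{\mathbf R})$. Let $L=(F_1,\ldots,F_k)$ be a list of parametrized univariate polynomials of degrees $d_1,\ldots,d_k$ in some variable $X$ (i.e. polynomials in $X$ whose coefficients are polynomials over $\mathbf K$ in parameters). Run the algorithm RCVF2, opening two branches in the computation any time one has to know whether a given element is zero or nonzero when computing a remainder, and replacing remainders by pseudoremainders in order to avoid denominators. Consider the family $(c_j)$ of all "constants" in all the families $L'$ that appear at the leaves of the tree (these constants are $\mathbf K$-polynomials in the parameters). Finally, consider that the computed valuations $v(x_{k+1}-x_k)$ and $v(P_j(x_k))$ at any leaf of the tree are given as $\mathbb Q$-semilinear functions of the "variables" $v(c_j)$. Then this global parametrized algorithm is finite and therefore gives a finite number of possibilities for its output: the complete tableau of vsc's for $L$. More precisely, when the signs of the "constants" $c_j$ are known, the complete tableau of signs is known and all the valuations $v(x_{k+1}-x_k)$ and $v(P_j(x_k))$ (where $(P_j)$ is the family $L'$ at the corresponding leaf and $(x_k)$ the ordered list of roots of its elements) are given as explicit $\mathbb Q$-semilinear functions in the "variables" $v(c_j)$.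
   Context: An ordered valued field is a triple $(\mathbf K,\mathbf V,\mathbf P)$ where $\mathbf K$ is an ordered field with set of nonnegative elements $\mathbf P$ and $\mathbf V\subsetneq\mathbf K$ is a valuation ring that is convex (if $x,y\in\mathbf P$ and $x+y\in\mathbf V$ then $x\in\mathbf V$). The valuation is $v$, $v(0)=+\infty$. A real closed valued field is an ordered valued field whose underlying field is real closed. $\mathbf K^{\mathrm{rc}}$ is the real closure of $\mathbf K$, valued by the convex hull of $\mathbf V$. For a finite family $(F_j)_{j\in J}$ of univariate polynomials, the complete tableau of signs consists of: the ordered list $(x_k)_{k=1,\ldots,r}$ of all the roots of all the $F_j$'s in the real closure (as names); the signs in $\{-1,0,1\}$ of all $F_j$'s at all $x_k$'s and on each of the intervals $]-\infty,x_1[$, $]x_k,x_{k+1}[$, $]x_r,+\infty[$. The complete tableau of vsc's (valued sign conditions) consists of this together with all the valuations $v(x_{k+1}-x_k)$ ($1\le k\le r-1$) and $v(F_j(x_k))$ ($j\in J$, $1\le k\le r$). A $\mathbb Q$-semilinear term is a term built from variables in a divisible ordered group by $\mathbb Q$-linear combinations and the operations $\min$ and $\max$; it defines a $\mathbb Q$-semilinear function of these variables. Algorithm RCVF2 (unparametrized). Given a finite list $L$ in $\mathbf K[X]$, form the finite family $L'$ generated by $L$ under $P\mapsto P'$ and $(P,Q)\mapsto\mathrm{Rem}(P,Q)$ for $\deg P\ge\deg Q\ge1$. Number its elements $P_1,P_2,\ldots$ with nondecreasing degrees and compute successively the complete tableau of vsc's of $(P_1,\ldots,P_m)$ for increasing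 $m$. To pass from $m$ to $m+1$, put $P=P_{m+1}$: at a point $a$ of the tableau which is a root of $Q=P_\ell$, $\ell\le m$, the sign and valuation of $P(a)$ are those of $R(a)$ with $R=\mathrm{Rem}(P,Q)$; since $P$ is strictly monotonic on each interval of the tableau, this determines the intervals containing a new root. For a new root $x=a+t_1(b-a)$ on an interval $]a,b[$ between consecutive points, the valuations of $t_1$ and $t_2=1-t_1$ are obtained by solving $v(P(a))=\min_j(v(P^{[j]}(a_j))+j\,v(b-a)+k_jv(t_1))$ (with $a_j\in\{a,b\}$ and integers $1\le k_j\le j$ read off from a generalized Taylor formula, $P^{[j]}=P^{(j)}/j!$), and similarly for $t_2$; the valuations $v(P_j(x))$, $j\le m$, are then given by similar formulas as minima of affine expressions in $v(t_1)$ or $v(t_2)$. On the unbounded intervals the ordinary Taylor formula is used. The "constants" are the elements of $L'$ of degree $\le0$. In the parametrized version the coefficients are polynomials over $\mathbf K$ in parameters; the branching produces a tree, at each leaf of which there is a family $L'$, whose constants are polynomials over $\mathbf K$ in the parameters. *)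

theory Defs
  imports
    "HOL-Library.Poly_Mapping"
    "HOL-Library.FuncSet"
    "HOL-Computational_Algebra.Polynomial"
begin

section \<open>Ordered valued fields\<close>

class real_closed_field = linordered_field +
  assumes nonneg_has_sqrt: "0 \<le> x \<Longrightarrow> \<exists>y. y * y = x"
    and odd_degree_has_root: "odd n \<Longrightarrow> f n \<noteq> 0 \<Longrightarrow> \<exists>x. (\<Sum>k\<le>n. f k * x ^ k) = 0"

definition is_subfield :: "'r::field set \<Rightarrow> bool" where
  "is_subfield K \<longleftrightarrow> 0 \<in> K \<and> 1 \<in> K \<and>
     (\<forall>x\<in>K. \<forall>y\<in>K. x + y \<in> K \<and> x * y \<in> K) \<and> (\<forall>x\<in>K. - x \<in> K \<and> inverse x \<in> K)"

text \<open>The field \<open>K\<close> carries the order induced by the ambient type; \<open>K = UNIV\<close> is allowed.\<close>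

definition ordered_valued_field :: "'r::linordered_field set \<Rightarrow> 'r set \<Rightarrow> 'r set \<Rightarrow> bool" where
  "ordered_valued_field K V P \<longleftrightarrow>
     is_subfield K \<and> P = {x \<in> K. 0 \<le> x} \<and>
     V \<subset> K \<and> 1 \<in> V \<and>
     (\<forall>x\<in>V. \<forall>y\<in>V. x + y \<in> V \<and> x * y \<in> V) \<and> (\<forall>x\<in>V. - x \<in> V) \<and>
     (\<forall>x\<in>K. x \<in> V \<or> inverse x \<in> V) \<and>
     (\<forall>x\<in>P. \<forall>y\<in>P. x + y \<in> V \<longrightarrow> x \<in> V)"

text \<open>The valuation of a valuation ring \<open>V\<close> of the whole field, with \<open>None\<close> for \<open>+\<infinity>\<close>. Since it
  is onto, the type \<open>'g\<close> is the value group, and \<open>v\<close> is determined by \<open>V\<close> up to isomorphism.\<close>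

definition valuation_of_ring :: "('r::field \<Rightarrow> 'g::linordered_ab_group_add option) \<Rightarrow> 'r set \<Rightarrow> bool" where
  "valuation_of_ring v V \<longleftrightarrow>
     (\<forall>x. v x = None \<longleftrightarrow> x = 0) \<and>
     (\<forall>x y a b. v x = Some a \<longrightarrow> v y = Some b \<longrightarrow> v (x * y) = Some (a + b)) \<and>
     (\<forall>x y a b c. v x = Some a \<longrightarrow> v y = Some b \<longrightarrow> v (x + y) = Some c \<longrightarrow> min a b \<le> c) \<and>
     (\<forall>g. \<exists>x. v x = Some g) \<and>
     V = {x. \<forall>a. v x = Some a \<longrightarrow> 0 \<le> a}"


section \<open>\<open>\<rat>\<close>-semilinear terms\<close>

datatype 'x qterm =
    QVar 'x
  | QZero
  | QAdd "'x qterm" "'x qterm"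
  | QScale rat "'x qterm"
  | QMin "'x qterm" "'x qterm"
  | QMax "'x qterm" "'x qterm"

definition int_mult :: "int \<Rightarrow> 'g::ab_group_add \<Rightarrow> 'g" where
  "int_mult n g = (if 0 \<le> n then \<Sum>i<nat n. g else - (\<Sum>i<nat (- n). g))"

text \<open>\<open>rat_mult\<close> is meaningful for a divisible ordered group, where the division is unique.\<close>

definition rat_mult :: "rat \<Rightarrow> 'g::ab_group_add \<Rightarrow> 'g" where
  "rat_mult q g = (THE h. int_mult (snd (quotient_of q)) h = int_mult (fst (quotient_of q)) g)"

primrec qeval :: "('x \<Rightarrow> 'g::linordered_ab_group_add) \<Rightarrow> 'x qterm \<Rightarrow> 'g" where
  "qeval e (QVar x) = e x"
| "qeval e QZero = 0"
| "qeval e (QAdd s t) = qeval e s + qeval e t"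
| "qeval e (QScale q t) = rat_mult q (qeval e t)"
| "qeval e (QMin s t) = min (qeval e s) (qeval e t)"
| "qeval e (QMax s t) = max (qeval e s) (qeval e t)"


section \<open>Complete tableaux\<close>

text \<open>For polynomials \<open>F\<^sub>0, \<dots>, F\<^sub>m\<^sub>-\<^sub>1\<close> with roots \<open>x\<^sub>0 < \<dots> < x\<^sub>r\<^sub>-\<^sub>1\<close>: \<open>point_signs T ! k ! j\<close> is the
  sign of \<open>F\<^sub>j(x\<^sub>k)\<close>; \<open>interval_signs T ! k ! j\<close> for \<open>k \<le> r\<close> is the sign of \<open>F\<^sub>j\<close> between
  \<open>x\<^sub>k\<^sub>-\<^sub>1\<close> (or \<open>-\<infinity>\<close>) and \<open>x\<^sub>k\<close> (or \<open>+\<infinity>\<close>); \<open>gaps T ! k\<close> is \<open>v(x\<^sub>k\<^sub>+\<^sub>1 - x\<^sub>k)\<close>; \<open>vals T ! k ! j\<close> is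
  \<open>v(F\<^sub>j(x\<^sub>k))\<close>. The valuations are elements of the value group with \<open>+\<infinity>\<close> in actual tableaux, and
  semilinear terms with \<open>+\<infinity>\<close> in computed ones; \<open>None\<close> is \<open>+\<infinity>\<close> in both cases.\<close>

datatype 'w tableau =
  Tableau (point_signs: "int list list") (interval_signs: "int list list")
    (gaps: "'w option list") (vals: "'w option list list")

definition isgn :: "'r::linordered_field \<Rightarrow> int" where
  "isgn x = (if x = 0 then 0 else if 0 < x then 1 else - 1)"

definition all_roots :: "'r::linordered_field poly list \<Rightarrow> 'r list" where
  "all_roots Fs = sorted_list_of_set {x. \<exists>F\<in>set Fs. F \<noteq> 0 \<and> poly F x = 0}"

definition nth_interval :: "'r::linorder list \<Rightarrow> nat \<Rightarrow> 'r set" where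
  "nth_interval xs k =
     {y. (0 < k \<longrightarrow> xs ! (k - 1) < y) \<and> (k < length xs \<longrightarrow> y < xs ! k)}"

definition complete_tableau_of_signs :: "'r::linordered_field poly list \<Rightarrow> 'w tableau \<Rightarrow> bool" where
  "complete_tableau_of_signs Fs T \<longleftrightarrow> (let xs = all_roots Fs in
     point_signs T = map (\<lambda>x. map (\<lambda>F. isgn (poly F x)) Fs) xs \<and>
     length (interval_signs T) = Suc (length xs) \<and>
     (\<forall>k\<le>length xs. \<forall>y\<in>nth_interval xs k.
        interval_signs T ! k = map (\<lambda>F. isgn (poly F y)) Fs))"

definition complete_tableau_of_vscs ::
  "('r::linordered_field \<Rightarrow> 'g option) \<Rightarrow> 'r poly list \<Rightarrow> 'g tableau \<Rightarrow> bool" where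
  "complete_tableau_of_vscs v Fs T \<longleftrightarrow> (let xs = all_roots Fs in
     complete_tableau_of_signs Fs T \<and>
     gaps T = map (\<lambda>k. v (xs ! Suc k - xs ! k)) [0..<length xs - 1] \<and>
     vals T = map (\<lambda>x. map (\<lambda>F. v (poly F x)) Fs) xs)"


section \<open>Parametrized polynomials\<close>

text \<open>Polynomials in the parameters, which are indexed by \<open>nat\<close>; each polynomial involves
  finitely many of them.\<close>

type_synonym 'r mpoly = "(nat \<Rightarrow>\<^sub>0 nat) \<Rightarrow>\<^sub>0 'r"

definition mpoly_eval :: "(nat \<Rightarrow> 'r) \<Rightarrow> 'r::comm_ring_1 mpoly \<Rightarrow> 'r" where
  "mpoly_eval p c =
     (\<Sum>m\<in>Poly_Mapping.keys c. Poly_Mapping.lookup c m *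
        (\<Prod>i\<in>Poly_Mapping.keys m. p i ^ Poly_Mapping.lookup m i))"

definition specialize :: "(nat \<Rightarrow> 'r) \<Rightarrow> 'r::comm_ring_1 mpoly poly \<Rightarrow> 'r poly" where
  "specialize p F = map_poly (mpoly_eval p) F"

definition mpoly_over :: "'r set \<Rightarrow> 'r::zero mpoly \<Rightarrow> bool" where
  "mpoly_over K c \<longleftrightarrow> (\<forall>m. Poly_Mapping.lookup c m \<in> K)"

definition param_poly_over :: "'r set \<Rightarrow> 'r::zero mpoly poly \<Rightarrow> bool" where
  "param_poly_over K F \<longleftrightarrow> (\<forall>i. mpoly_over K (coeff F i))"


section \<open>The tree of families\<close>

text \<open>\<open>zeros\<close> and \<open>nonzeros\<close> are the outcomes of the tests made so far, \<open>todo\<close> the polynomials still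
  to be put into the family, \<open>family\<close> the present family.\<close>

datatype ('c, 'f) gen_node =
  Node (zeros: "'c set") (nonzeros: "'c set") (todo: "'f list") (family: "'f list")

type_synonym 'r node = "('r mpoly, 'r mpoly poly) gen_node"

text \<open>A test is not repeated for a coefficient that differs by a nonzero scalar from one
  already tested, nor made for an element of the base field.\<close>

definition scalar_multiple :: "'r::field mpoly \<Rightarrow> 'r mpoly \<Rightarrow> bool" where
  "scalar_multiple c c' \<longleftrightarrow> (\<exists>a. a \<noteq> 0 \<and> c = Poly_Mapping.single 0 a * c')"

definition known_zero :: "'r::field mpoly set \<Rightarrow> 'r mpoly \<Rightarrow> bool" where
  "known_zero Z c \<longleftrightarrow> c = 0 \<or> (\<exists>z\<in>Z. scalar_multiple c z)"

definition known_nonzero :: "'r::field mpoly set \<Rightarrow> 'r mpoly \<Rightarrow> bool" where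
  "known_nonzero N c \<longleftrightarrow> (\<exists>z\<in>insert 1 N. scalar_multiple c z)"

text \<open>Removes the leading terms of positive degree whose coefficients are known to vanish.\<close>

definition strip :: "'r::field mpoly set \<Rightarrow> 'r mpoly poly \<Rightarrow> 'r mpoly poly" where
  "strip Z P =
     poly_cutoff (Suc (Max {i. i \<le> degree P \<and> (i = 0 \<or> \<not> known_zero Z (coeff P i))})) P"

text \<open>Pseudoremainders of \<open>Q\<close> with the members \<open>S\<close> of the family, itself included, in both orders
  (both when the degrees are equal).\<close>

definition new_prems :: "'r::field mpoly poly list \<Rightarrow> 'r mpoly poly \<Rightarrow> 'r mpoly poly list" where
  "new_prems D Q =
     [pseudo_mod Q S. S \<leftarrow> D @ [Q], 1 \<le> degree S \<and> degree S \<le> degree Q] @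
     [pseudo_mod S Q. S \<leftarrow> D, 1 \<le> degree Q \<and> degree Q \<le> degree S]"

inductive rcvf2_step :: "'r::field node \<Rightarrow> 'r node \<Rightarrow> bool" where
  branch_zero:
    "Q = strip Z P \<Longrightarrow> 1 \<le> degree Q \<Longrightarrow> \<not> known_nonzero N (lead_coeff Q) \<Longrightarrow>
     rcvf2_step (Node Z N (P # Ps) D) (Node (insert (lead_coeff Q) Z) N (P # Ps) D)"
| branch_nonzero:
    "Q = strip Z P \<Longrightarrow> 1 \<le> degree Q \<Longrightarrow> \<not> known_nonzero N (lead_coeff Q) \<Longrightarrow>
     rcvf2_step (Node Z N (P # Ps) D) (Node Z (insert (lead_coeff Q) N) (P # Ps) D)"
| old:
    "Q = strip Z P \<Longrightarrow> degree Q = 0 \<or> known_nonzero N (lead_coeff Q) \<Longrightarrow> Q \<in> set D \<Longrightarrow>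
     rcvf2_step (Node Z N (P # Ps) D) (Node Z N Ps D)"
| new:
    "Q = strip Z P \<Longrightarrow> degree Q = 0 \<or> known_nonzero N (lead_coeff Q) \<Longrightarrow> Q \<notin> set D \<Longrightarrow>
     rcvf2_step (Node Z N (P # Ps) D) (Node Z N (Ps @ pderiv Q # new_prems D Q) (D @ [Q]))"

definition rcvf2_root :: "'r::field mpoly poly list \<Rightarrow> 'r node" where
  "rcvf2_root L = Node {} {} L []"

definition rcvf2_nodes :: "'r::field mpoly poly list \<Rightarrow> 'r node set" where
  "rcvf2_nodes L = {s. rcvf2_step\<^sup>*\<^sup>* (rcvf2_root L) s}"

definition rcvf2_leaves :: "'r::field mpoly poly list \<Rightarrow> 'r node set" where
  "rcvf2_leaves L = {s \<in> rcvf2_nodes L. todo s = []}"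

definition node_holds :: "(nat \<Rightarrow> 'r) \<Rightarrow> 'r::field node \<Rightarrow> bool" where
  "node_holds p s \<longleftrightarrow>
     (\<forall>c\<in>zeros s. mpoly_eval p c = 0) \<and> (\<forall>c\<in>nonzeros s. mpoly_eval p c \<noteq> 0)"

text \<open>The family \<open>L'\<close>, numbered with nondecreasing degrees.\<close>

definition leaf_family :: "'r::field node \<Rightarrow> 'r mpoly poly list" where
  "leaf_family s = sort_key degree (family s)"

definition leaf_constants :: "'r::field node \<Rightarrow> 'r mpoly set" where
  "leaf_constants s = {coeff Q 0 | Q. Q \<in> set (leaf_family s) \<and> degree Q = 0}"

definition all_constants :: "'r::field mpoly poly list \<Rightarrow> 'r mpoly set" where
  "all_constants L = (\<Union>s\<in>rcvf2_leaves L. leaf_constants s)"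

definition constant_signs :: "'r::linordered_field mpoly poly list \<Rightarrow> (nat \<Rightarrow> 'r) \<Rightarrow> 'r mpoly \<Rightarrow> int" where
  "constant_signs L p = restrict (\<lambda>c. isgn (mpoly_eval p c)) (all_constants L)"


section \<open>Computation of the tableau\<close>

text \<open>All that the computation uses of a family \<open>P\<^sub>0, P\<^sub>1, \<dots>\<close>: the degrees, the constants
  (for the members of degree \<open>0\<close>), and the numbers of the derivatives and pseudoremainders.\<close>

record 'c skeleton =
  deg_of :: "nat \<Rightarrow> nat"
  const_of :: "nat \<Rightarrow> 'c"
  deriv_of :: "nat \<Rightarrow> nat"
  prem_of :: "nat \<Rightarrow> nat \<Rightarrow> nat"

definition iter_deriv :: "'c skeleton \<Rightarrow> nat \<Rightarrow> nat \<Rightarrow> nat" where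
  "iter_deriv S j i = (deriv_of S ^^ i) j"

text \<open>The constant \<open>d! a\<close>, for \<open>P\<^sub>j\<close> of degree \<open>d\<close> with leading coefficient \<open>a\<close>. Positive
  integers have valuation \<open>0\<close>, so \<open>d! a\<close> and \<open>a\<close> have the same sign and valuation; likewise
  \<open>P\<^sup>(\<^sup>i\<^sup>)\<close> and \<open>P\<^sup>(\<^sup>i\<^sup>) / i!\<close>.\<close>

definition lead_const :: "'c skeleton \<Rightarrow> nat \<Rightarrow> 'c" where
  "lead_const S j = const_of S (iter_deriv S j (deg_of S j))"

definition const_val :: "'c skeleton \<Rightarrow> ('c \<Rightarrow> int) \<Rightarrow> nat \<Rightarrow> 'c qterm option" where
  "const_val S \<sigma> j = (if \<sigma> (const_of S j) = 0 then None else Some (QVar (const_of S j)))"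

text \<open>\<open>p \<sigma> + q \<tau>\<close>, where \<open>None\<close> is absorbing.\<close>

fun qlin :: "rat \<Rightarrow> 'c qterm option \<Rightarrow> rat \<Rightarrow> 'c qterm option \<Rightarrow> 'c qterm option" where
  "qlin p (Some s) q (Some t) = Some (QAdd (QScale p s) (QScale q t))"
| "qlin _ _ _ _ = None"

text \<open>Minimum or maximum of the entries other than \<open>None\<close>.\<close>

definition qreduce :: "('c qterm \<Rightarrow> 'c qterm \<Rightarrow> 'c qterm) \<Rightarrow> 'c qterm option list \<Rightarrow> 'c qterm option" where
  "qreduce f ts = (case List.map_filter (\<lambda>t. t) ts of [] \<Rightarrow> None | u # us \<Rightarrow> Some (fold f us u))"

text \<open>In what follows \<open>T\<close> is the tableau of \<open>P\<^sub>0, \<dots>, P\<^sub>n\<^sub>-\<^sub>1\<close>, and \<open>P\<^sub>n\<close> is the polynomial to be added.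
  At the point \<open>x\<^sub>k\<close>, a root of some nonconstant \<open>P\<^sub>l\<close> with leading coefficient \<open>a\<close>, one has
  \<open>a\<^sup>e P\<^sub>n(x\<^sub>k) = R(x\<^sub>k)\<close> with \<open>R\<close> the pseudoremainder and \<open>e = deg P\<^sub>n - deg P\<^sub>l + 1\<close>.\<close>

definition vanishing_at :: "'c skeleton \<Rightarrow> nat \<Rightarrow> 'c qterm tableau \<Rightarrow> nat \<Rightarrow> nat" where
  "vanishing_at S n T k =
     hd (filter (\<lambda>l. 1 \<le> deg_of S l \<and> point_signs T ! k ! l = 0) [0..<n])"

definition sign_at :: "'c skeleton \<Rightarrow> ('c \<Rightarrow> int) \<Rightarrow> nat \<Rightarrow> 'c qterm tableau \<Rightarrow> nat \<Rightarrow> int" where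
  "sign_at S \<sigma> n T k =
     (if deg_of S n = 0 then \<sigma> (const_of S n)
      else let l = vanishing_at S n T k in
        \<sigma> (lead_const S l) ^ (Suc (deg_of S n) - deg_of S l) * point_signs T ! k ! prem_of S n l)"

definition val_at :: "'c skeleton \<Rightarrow> ('c \<Rightarrow> int) \<Rightarrow> nat \<Rightarrow> 'c qterm tableau \<Rightarrow> nat \<Rightarrow> 'c qterm option" where
  "val_at S \<sigma> n T k =
     (if deg_of S n = 0 then const_val S \<sigma> n
      else let l = vanishing_at S n T k in
        qlin 1 (vals T ! k ! prem_of S n l)
          (- of_nat (Suc (deg_of S n) - deg_of S l)) (Some (QVar (lead_const S l))))"

definition left_sign :: "'c skeleton \<Rightarrow> ('c \<Rightarrow> int) \<Rightarrow> nat \<Rightarrow> 'c qterm tableau \<Rightarrow> nat \<Rightarrow> int" where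
  "left_sign S \<sigma> n T k =
     (if k = 0 then (- 1) ^ deg_of S n * \<sigma> (lead_const S n) else sign_at S \<sigma> n T (k - 1))"

definition right_sign :: "'c skeleton \<Rightarrow> ('c \<Rightarrow> int) \<Rightarrow> nat \<Rightarrow> 'c qterm tableau \<Rightarrow> nat \<Rightarrow> int" where
  "right_sign S \<sigma> n T k =
     (if k = length (point_signs T) then \<sigma> (lead_const S n) else sign_at S \<sigma> n T k)"

definition has_new_root :: "'c skeleton \<Rightarrow> ('c \<Rightarrow> int) \<Rightarrow> nat \<Rightarrow> 'c qterm tableau \<Rightarrow> nat \<Rightarrow> bool" where
  "has_new_root S \<sigma> n T k \<longleftrightarrow> left_sign S \<sigma> n T k * right_sign S \<sigma> n T k = - 1"

text \<open>The generalized Taylor formula on a bounded interval \<open>]a,b[\<close>, on which the derivatives of \<open>P\<close>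
  have constant signs. If \<open>\<bar>Q\<bar>\<close> increases, write \<open>Q(y) = Q(a) + \<integral>\<^bsub>a\<^esub>\<^bsup>y\<^esup> Q'\<close>, otherwise
  \<open>Q(y) = Q(b) - \<integral>\<^bsub>y\<^esub>\<^bsup>b\<^esup> Q'\<close>; either way the two summands have the same sign. Starting from
  \<open>P(x) - P(a) = \<integral>\<^bsub>a\<^esub>\<^bsup>x\<^esup> P'\<close> and iterating, one gets \<open>P(x) - P(a)\<close> as a sum of terms of the same sign,
  namely \<open>P\<^sup>(\<^sup>i\<^sup>)(a\<^sub>i)\<close> times an \<open>i\<close>-fold iterated integral, which has the form \<open>(b - a)\<^sup>i f\<^sub>i(t\<^sub>1)\<close>
  with \<open>f\<^sub>i\<close> a polynomial over \<open>\<rat>\<close> that is positive on \<open>]0,1]\<close>. As \<open>V\<close> is convex, \<open>f\<^sub>i(t\<^sub>1)\<close> has the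
  valuation of \<open>t\<^sub>1\<^sup>k\<close>, where \<open>k\<close> is the order of \<open>f\<^sub>i\<close> at \<open>0\<close>, i.e. the number of integrals
  from the left endpoint that precede the first one from the right endpoint. Likewise at \<open>b\<close> with
  \<open>t\<^sub>2\<close>.

  \<open>expand_left S T k j i\<close> says that on the interval number \<open>k\<close> the derivative \<open>P\<^sub>j\<^sup>(\<^sup>i\<^sup>)\<close> is expanded
  from the left endpoint; \<open>taylor_order S T k j e i\<close> is the exponent of \<open>t\<^sub>1\<close> (if \<open>e\<close>) or \<open>t\<^sub>2\<close>
  (if \<open>\<not> e\<close>) in the term with \<open>P\<^sub>j\<^sup>(\<^sup>i\<^sup>)\<close>; \<open>taylor_coeff S T k j i\<close> is the valuation of
  \<open>P\<^sub>j\<^sup>(\<^sup>i\<^sup>)(a\<^sub>i) (b - a)\<^sup>i\<close>.\<close>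

definition expand_left :: "'c skeleton \<Rightarrow> 'c qterm tableau \<Rightarrow> nat \<Rightarrow> nat \<Rightarrow> nat \<Rightarrow> bool" where
  "expand_left S T k j i \<longleftrightarrow>
     0 \<le> interval_signs T ! k ! iter_deriv S j i * interval_signs T ! k ! iter_deriv S j (Suc i)"

definition taylor_order :: "'c skeleton \<Rightarrow> 'c qterm tableau \<Rightarrow> nat \<Rightarrow> nat \<Rightarrow> bool \<Rightarrow> nat \<Rightarrow> nat" where
  "taylor_order S T k j e i =
     (if i = 0 then 0 else Suc (length (takeWhile (\<lambda>l. expand_left S T k j l = e) [1..<i])))"

definition taylor_coeff :: "'c skeleton \<Rightarrow> 'c qterm tableau \<Rightarrow> nat \<Rightarrow> nat \<Rightarrow> nat \<Rightarrow> 'c qterm option" where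
  "taylor_coeff S T k j i =
     qlin 1 (vals T ! (if expand_left S T k j i then k - 1 else k) ! iter_deriv S j i)
       (of_nat i) (gaps T ! (k - 1))"

text \<open>On the interval number \<open>k\<close> between \<open>a\<close> and \<open>b\<close>: \<open>v(t\<^sub>1)\<close> if \<open>e\<close>, else \<open>v(t\<^sub>2)\<close>, for the
  root of \<open>P\<^sub>n\<close>. The equation \<open>\<alpha> = min\<^sub>i (\<beta>\<^sub>i + k\<^sub>i \<tau>)\<close> with all \<open>k\<^sub>i > 0\<close> has the unique solution
  \<open>\<tau> = max\<^sub>i ((\<alpha> - \<beta>\<^sub>i) / k\<^sub>i)\<close>.\<close>

definition ratio_val ::
  "'c skeleton \<Rightarrow> ('c \<Rightarrow> int) \<Rightarrow> nat \<Rightarrow> 'c qterm tableau \<Rightarrow> nat \<Rightarrow> bool \<Rightarrow> 'c qterm option" where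
  "ratio_val S \<sigma> n T k e =
     qreduce QMax (map (\<lambda>i. let q = 1 / of_nat (taylor_order S T k n e i) in
         qlin q (val_at S \<sigma> n T (if e then k - 1 else k)) (- q) (taylor_coeff S T k n i))
       [1..<Suc (deg_of S n)])"

text \<open>On an unbounded interval with endpoint \<open>x\<^sub>c\<close>: the valuation of the distance from \<open>x\<^sub>c\<close>
  to the root of \<open>P\<^sub>n\<close>. In the ordinary Taylor expansion at \<open>x\<^sub>c\<close> the terms of positive degree
  all have the same sign.\<close>

definition outer_val ::
  "'c skeleton \<Rightarrow> ('c \<Rightarrow> int) \<Rightarrow> nat \<Rightarrow> 'c qterm tableau \<Rightarrow> nat \<Rightarrow> 'c qterm option" where
  "outer_val S \<sigma> n T c =
     qreduce QMax (map (\<lambda>i. let q = 1 / of_nat i in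
         qlin q (val_at S \<sigma> n T c) (- q) (vals T ! c ! iter_deriv S n i))
       [1..<Suc (deg_of S n)])"

text \<open>The valuation of \<open>P\<^sub>j\<close>, \<open>j < n\<close>, at the root of \<open>P\<^sub>n\<close> on the interval number \<open>k\<close>.\<close>

definition val_at_new_root ::
  "'c skeleton \<Rightarrow> ('c \<Rightarrow> int) \<Rightarrow> nat \<Rightarrow> 'c qterm tableau \<Rightarrow> nat \<Rightarrow> nat \<Rightarrow> 'c qterm option" where
  "val_at_new_root S \<sigma> n T k j =
     (let is = [0..<Suc (deg_of S j)]; c = (if k = 0 then 0 else k - 1) in
      if deg_of S j = 0 then const_val S \<sigma> j
      else if 0 < k \<and> k < length (point_signs T) then
        (let e = expand_left S T k j 0 in
         qreduce QMin (map (\<lambda>i. qlin 1 (taylor_coeff S T k j i)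
           (of_nat (taylor_order S T k j e i)) (ratio_val S \<sigma> n T k e)) is))
      else
        qreduce QMin (map (\<lambda>i. qlin 1 (vals T ! c ! iter_deriv S j i)
          (of_nat i) (outer_val S \<sigma> n T c)) is))"

text \<open>The parts of the tableau of \<open>P\<^sub>0, \<dots>, P\<^sub>n\<close> that replace the interval number \<open>k\<close> and,
  for the points, its right endpoint.\<close>

definition new_points ::
  "'c skeleton \<Rightarrow> ('c \<Rightarrow> int) \<Rightarrow> nat \<Rightarrow> 'c qterm tableau \<Rightarrow> nat \<Rightarrow> (int list \<times> 'c qterm option list) list" where
  "new_points S \<sigma> n T k =
     (if has_new_root S \<sigma> n T k
      then [(interval_signs T ! k @ [0], map (val_at_new_root S \<sigma> n T k) [0..<n] @ [None])] else []) @
     (if k < length (point_signs T)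
      then [(point_signs T ! k @ [sign_at S \<sigma> n T k], vals T ! k @ [val_at S \<sigma> n T k])] else [])"

definition new_intervals ::
  "'c skeleton \<Rightarrow> ('c \<Rightarrow> int) \<Rightarrow> nat \<Rightarrow> 'c qterm tableau \<Rightarrow> nat \<Rightarrow> int list list" where
  "new_intervals S \<sigma> n T k =
     (let sl = left_sign S \<sigma> n T k; sr = right_sign S \<sigma> n T k in
      map (\<lambda>s. interval_signs T ! k @ [s])
        (if has_new_root S \<sigma> n T k then [sl, sr] else [if sl = 0 then sr else sl]))"

definition new_gaps ::
  "'c skeleton \<Rightarrow> ('c \<Rightarrow> int) \<Rightarrow> nat \<Rightarrow> 'c qterm tableau \<Rightarrow> nat \<Rightarrow> 'c qterm option list" where
  "new_gaps S \<sigma> n T k =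
     (let r = length (point_signs T); new = has_new_root S \<sigma> n T k in
      if 0 < k \<and> k < r then
        (if new then [qlin 1 (gaps T ! (k - 1)) 1 (ratio_val S \<sigma> n T k True),
                      qlin 1 (gaps T ! (k - 1)) 1 (ratio_val S \<sigma> n T k False)]
         else [gaps T ! (k - 1)])
      else if new \<and> 0 < r then [outer_val S \<sigma> n T (if k = 0 then 0 else k - 1)] else [])"

definition add_polynomial ::
  "'c skeleton \<Rightarrow> ('c \<Rightarrow> int) \<Rightarrow> nat \<Rightarrow> 'c qterm tableau \<Rightarrow> 'c qterm tableau" where
  "add_polynomial S \<sigma> n T =
     (let ks = [0..<Suc (length (point_signs T))];
          pts = concat (map (new_points S \<sigma> n T) ks) in
      Tableau (map fst pts) (concat (map (new_intervals S \<sigma> n T) ks))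
        (concat (map (new_gaps S \<sigma> n T) ks)) (map snd pts))"

text \<open>The tableau of the empty family has no points and one interval.\<close>

primrec skeleton_tableau :: "'c skeleton \<Rightarrow> ('c \<Rightarrow> int) \<Rightarrow> nat \<Rightarrow> 'c qterm tableau" where
  "skeleton_tableau S \<sigma> 0 = Tableau [] [[]] [] []"
| "skeleton_tableau S \<sigma> (Suc n) = add_polynomial S \<sigma> n (skeleton_tableau S \<sigma> n)"

text \<open>The tableau of a subfamily, given by the numbers \<open>js\<close> of its members: points that are not
  roots of (nonzero) members are dropped. The distance of two remaining points is a sum of
  positive gaps.\<close>

definition subtableau :: "'c skeleton \<Rightarrow> nat list \<Rightarrow> 'c qterm tableau \<Rightarrow> 'c qterm tableau" where
  "subtableau S js T =
     (let ks = filter (\<lambda>k. \<exists>j\<in>set js. 1 \<le> deg_of S j \<and> point_signs T ! k ! j = 0)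
                 [0..<length (point_signs T)] in
      Tableau
        (map (\<lambda>k. map (\<lambda>j. point_signs T ! k ! j) js) ks)
        (map (\<lambda>k. map (\<lambda>j. interval_signs T ! k ! j) js) (0 # map Suc ks))
        (map (\<lambda>i. qreduce QMin (map (\<lambda>k. gaps T ! k) [ks ! i..<ks ! Suc i])) [0..<length ks - 1])
        (map (\<lambda>k. map (\<lambda>j. vals T ! k ! j) js) ks))"

definition position :: "'a list \<Rightarrow> 'a \<Rightarrow> nat" where
  "position xs x = length (takeWhile (\<lambda>y. y \<noteq> x) xs)"

definition leaf_skeleton :: "'r::field node \<Rightarrow> 'r mpoly skeleton" where
  "leaf_skeleton s = (let Ps = leaf_family s; pos = (\<lambda>P. position Ps (strip (zeros s) P)) in
     \<lparr>deg_of = (\<lambda>j. degree (Ps ! j)),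
      const_of = (\<lambda>j. coeff (Ps ! j) 0),
      deriv_of = (\<lambda>j. pos (pderiv (Ps ! j))),
      prem_of = (\<lambda>j l. pos (pseudo_mod (Ps ! j) (Ps ! l)))\<rparr>)"

text \<open>The computed tableaux of the family \<open>L'\<close> at the leaf \<open>s\<close> and of \<open>L\<close> itself, for given signs
  of the constants.\<close>

definition rcvf2_family_tableau :: "'r::field node \<Rightarrow> ('r mpoly \<Rightarrow> int) \<Rightarrow> 'r mpoly qterm tableau" where
  "rcvf2_family_tableau s \<sigma> = skeleton_tableau (leaf_skeleton s) \<sigma> (length (leaf_family s))"

definition rcvf2_tableau ::
  "'r::field mpoly poly list \<Rightarrow> 'r node \<Rightarrow> ('r mpoly \<Rightarrow> int) \<Rightarrow> 'r mpoly qterm tableau" where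
  "rcvf2_tableau L s \<sigma> =
     subtableau (leaf_skeleton s) (map (\<lambda>F. position (leaf_family s) (strip (zeros s) F)) L)
       (rcvf2_family_tableau s \<sigma>)"

text \<open>The values of the terms when each variable \<open>c\<close> stands for \<open>v(c)\<close> at the parameters \<open>p\<close>;
  \<open>v(c)\<close> is meant to be finite for the variables that occur.\<close>

definition eval_tableau ::
  "('r::comm_ring_1 \<Rightarrow> 'g::linordered_ab_group_add option) \<Rightarrow> (nat \<Rightarrow> 'r) \<Rightarrow> 'r mpoly qterm tableau \<Rightarrow> 'g tableau" where
  "eval_tableau v p T = map_tableau (qeval (\<lambda>c. the (v (mpoly_eval p c)))) T"

definition tableau_variables :: "'x qterm tableau \<Rightarrow> 'x set" where
  "tableau_variables T = (\<Union>t\<in>set_tableau T. set_qterm t)"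

end

theory Submission
  imports "HOL-Algebra.Algebraic_Closure_Type" "HOL-Library.Multiset" Defs
begin

text \<open>Termination: a polynomial taken from the list of pending ones is replaced by polynomials of
  smaller degree, so the multiset of pending degrees decreases. A coefficient \<open>c\<close> that was tested and
  found nonzero is the leading coefficient of a member of the family, whose last nonzero derivative is
  the constant \<open>d! c\<close>; hence the signs of the constants determine all the tests.

  Correctness of the tableau: on an interval of the tableau of \<open>P\<^sub>0, \<dots>, P\<^sub>n\<^sub>-\<^sub>1\<close> all derivatives of
  \<open>P\<^sub>n\<close> have constant signs, so \<open>P\<^sub>n\<close> is monotonic there. Instead of the exact iterated integrals,
  the generalized Taylor formula is used up to factors bounded by natural numbers, which have
  valuation \<open>0\<close>: \<open>\<bar>P(x) - P(a)\<bar>\<close> and \<open>\<Sum>\<^sub>i \<bar>P\<^sup>(\<^sup>i\<^sup>)(a\<^sub>i)\<bar> (b - a)\<^sup>i t\<^sup>k\<close> bound each other, by induction on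
  the degree, integrating the inequalities for \<open>P'\<close> by means of the mean value theorem. The latter
  rests on the intermediate value theorem for polynomials, which follows from the axioms of a real
  closed field by Laplace's proof of the fundamental theorem of algebra.\<close>

section \<open>Polynomials over real closed fields\<close>

subsection \<open>Power sums and coefficients\<close>

text \<open>The computation sees only a skeleton: degrees, constants and the indices of derivatives
  and pseudoremainders. The locale \<open>tableau_model\<close> collects what a list of polynomials
  over the field must satisfy for the computed tableau to be right, without parameters or trees; at
  a leaf the specialized family satisfies it. Numbering by degree makes the recursion legitimate:
  derivatives and pseudoremainders have smaller degree, hence smaller index, so every entry that is
  looked up is already there. Two obstacles come from the tree. A polynomial enters the family in
  stripped form, and later tests might strip more of it; consistency of the tests excludes this once
  the leading coefficient is known to be nonzero. And two parameters with equal signs of the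
  constants might part at a test; but then one of them reaches a leaf below the outcome nonzero,
  where a scalar multiple of the tested coefficient is a constant, against the equality of signs.
  Divisibility of the value group is derived from the existence of n-th roots of positive elements;
  it gives the rational multiples in the terms their meaning.\<close>

definition field_closed :: "'a::field set \<Rightarrow> bool" where
  "field_closed K \<longleftrightarrow> 1 \<in> K \<and> (\<forall>x\<in>K. \<forall>y\<in>K. x + y \<in> K \<and> x - y \<in> K \<and> x * y \<in> K \<and> x / y \<in> K)"

context
  fixes K :: "'a::field_char_0 set"
  assumes K: "field_closed K"
begin

lemma field_closed_simps:
  "1 \<in> K" "0 \<in> K" "x \<in> K \<Longrightarrow> y \<in> K \<Longrightarrow> x + y \<in> K" "x \<in> K \<Longrightarrow> y \<in> K \<Longrightarrow> x - y \<in> K"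
  "x \<in> K \<Longrightarrow> - x \<in> K" "x \<in> K \<Longrightarrow> y \<in> K \<Longrightarrow> x * y \<in> K" "x \<in> K \<Longrightarrow> y \<in> K \<Longrightarrow> x / y \<in> K"
proof -
  show zero: "0 \<in> K" using K unfolding field_closed_def by (metis diff_self)
  show "x \<in> K \<Longrightarrow> - x \<in> K" using K zero unfolding field_closed_def by (metis diff_0)
qed (use K in \<open>auto simp: field_closed_def\<close>)

lemma field_closed_of_nat: "of_nat n \<in> K"
  by (induction n) (auto intro: field_closed_simps)

lemma field_closed_sum: "(\<And>i. i \<in> I \<Longrightarrow> f i \<in> K) \<Longrightarrow> sum f I \<in> K"
  by (induction I rule: infinite_finite_induct) (auto intro: field_closed_simps)

text \<open>Newton's identities are the coefficients of \<open>X P' = - P S\<close>, where \<open>P = \<Prod>(1 - a\<^sub>i X)\<close> and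
  \<open>S = \<Sum>\<^sub>k s\<^sub>k X\<^sup>k\<close> is the generating function of the power sums.\<close>

lemma newton_fps:
  fixes a :: "'i \<Rightarrow> 'a"
  assumes "finite I"
  shows "fps_X * fps_deriv (\<Prod>i\<in>I. 1 - fps_const (a i) * fps_X) =
    - ((\<Prod>i\<in>I. 1 - fps_const (a i) * fps_X) * Abs_fps (\<lambda>k. if k = 0 then 0 else \<Sum>i\<in>I. a i ^ k))"
  using assms
proof induction
  case (insert i I)
  define f where "f = 1 - fps_const (a i) * fps_X"
  define g where "g = (\<Prod>i\<in>I. 1 - fps_const (a i) * fps_X)"
  define s where "s = Abs_fps (\<lambda>k. if k = 0 then 0 else a i ^ k)"
  define S where "S = Abs_fps (\<lambda>k. if k = 0 then 0 else \<Sum>i\<in>I. a i ^ k)"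
  \<comment> \<open>\<open>s\<close> is the geometric series a X / (1 - a X) with a =
    \<open>a i\<close>, so both sides are - a X.\<close>
  have f: "fps_X * fps_deriv f = - (f * s)"
  proof (rule fps_ext)
    fix n show "(fps_X * fps_deriv f) $ n = (- (f * s)) $ n"
      by (cases n rule: nat.exhaust; cases "n - 1")
        (auto simp: f_def s_def left_diff_distrib mult.assoc)
  qed
  have "Abs_fps (\<lambda>k. if k = 0 then 0 else \<Sum>i\<in>insert i I. a i ^ k) = s + S"
    using insert by (auto simp: s_def S_def fps_eq_iff)
  moreover have "fps_X * fps_deriv (f * g) = (fps_X * fps_deriv f) * g + f * (fps_X * fps_deriv g)"
    by (simp add: algebra_simps)
  ultimately show ?case
    using insert f by (simp flip: f_def g_def S_def) (simp add: algebra_simps)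
qed (simp add: fps_eq_iff)

lemma newton_identity:
  fixes a :: "'i \<Rightarrow> 'a"
  assumes "finite I"
  shows "of_nat n * coeff (\<Prod>i\<in>I. [:1, - a i:]) n =
    - (\<Sum>j<n. coeff (\<Prod>i\<in>I. [:1, - a i:]) j * (\<Sum>i\<in>I. a i ^ (n - j)))"
proof -
  define P where "P = (\<Prod>i\<in>I. 1 - fps_const (a i) * fps_X)"
  have P: "P = fps_of_poly (\<Prod>i\<in>I. [:1, - a i:])"
    by (simp add: P_def fps_of_poly_prod fps_of_poly_pCons algebra_simps del: fps_const_neg
        flip: fps_const_neg)
  have "of_nat n * P $ n = (fps_X * fps_deriv P) $ n"
    by (cases n) auto
  also have "\<dots> = - (\<Sum>j=0..n. P $ j * (if n - j = 0 then 0 else \<Sum>i\<in>I. a i ^ (n - j)))"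
    unfolding P_def newton_fps[OF assms] by (simp add: fps_mult_nth)
  \<comment> \<open>The summand j = n drops out because the generating function of the power sums
    has no constant term.\<close>
  also have "(\<Sum>j=0..n. P $ j * (if n - j = 0 then 0 else \<Sum>i\<in>I. a i ^ (n - j))) =
     (\<Sum>j<n. P $ j * (\<Sum>i\<in>I. a i ^ (n - j)))"
    by (rule sum.mono_neutral_cong_right) auto
  finally show ?thesis by (simp add: P)
qed

text \<open>Newton's identity expresses n times the n-th coefficient through earlier ones;
  characteristic 0 allows division by n.\<close>

lemma coeff_prod_if_power_sums:
  fixes a :: "'i \<Rightarrow> 'a"
  assumes "finite I" "\<And>k. (\<Sum>i\<in>I. a i ^ k) \<in> K"
  shows "coeff (\<Prod>i\<in>I. [:1, - a i:]) n \<in> K"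
proof (induction n rule: less_induct)
  case (less n)
  show ?case
  proof (cases "n = 0")
    case True
    have "coeff (\<Prod>i\<in>I. [:1, - a i:]) 0 = 1"
      using assms(1) by induction (auto simp: coeff_mult)
    then show ?thesis using True by (simp add: field_closed_simps)
  next
    case False
    have "of_nat n * coeff (\<Prod>i\<in>I. [:1, - a i:]) n \<in> K"
      unfolding newton_identity[OF assms(1)]
      using less assms(2) by (intro field_closed_simps(5) field_closed_sum) (auto intro: field_closed_simps)
    from field_closed_simps(7)[OF this field_closed_of_nat[of n]]
    show ?thesis using False by simp
  qed
qed

text \<open>In Newton's identity the summand j = 0 is the k-th power sum itself with coefficient 1,
  so the identity can be solved for it.\<close>

lemma power_sums_if_coeff_prod:
  fixes a :: "'i \<Rightarrow> 'a"
  assumes "finite I" "\<And>n. coeff (\<Prod>i\<in>I. [:1, - a i:]) n \<in> K"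
  shows "(\<Sum>i\<in>I. a i ^ k) \<in> K"
proof (induction k rule: less_induct)
  case (less k)
  show ?case
  proof (cases "k = 0")
    case True
    then show ?thesis by (simp add: field_closed_of_nat)
  next
    case False
    have *: "coeff (\<Prod>i\<in>I. [:1, - a i:]) 0 = 1"
      using assms(1) by induction (auto simp: coeff_mult)
    have "{..<k} = insert 0 {1..<k}" using False by auto
    then have "(\<Sum>j<k. coeff (\<Prod>i\<in>I. [:1, - a i:]) j * (\<Sum>i\<in>I. a i ^ (k - j))) =
       (\<Sum>i\<in>I. a i ^ k) + (\<Sum>j=1..<k. coeff (\<Prod>i\<in>I. [:1, - a i:]) j * (\<Sum>i\<in>I. a i ^ (k - j)))"
      using * by simp
    then have "(\<Sum>i\<in>I. a i ^ k) = - (of_nat k * coeff (\<Prod>i\<in>I. [:1, - a i:]) k) -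
       (\<Sum>j=1..<k. coeff (\<Prod>i\<in>I. [:1, - a i:]) j * (\<Sum>i\<in>I. a i ^ (k - j)))"
      using newton_identity[OF assms(1), of k a] by simp
    also have "\<dots> \<in> K"
      using less assms(2) by (intro field_closed_simps(4,5) field_closed_sum)
        (auto intro: field_closed_simps field_closed_of_nat)
    finally show ?thesis .
  qed
qed

lemma coeffs_closed_reflect: "(\<forall>n. coeff p n \<in> K) \<Longrightarrow> \<forall>n. coeff (reflect_poly p) n \<in> K"
  by (simp add: coeff_reflect_poly field_closed_simps)

lemma reflect_prod_linear:
  "finite I \<Longrightarrow> reflect_poly (\<Prod>i\<in>I. [:- a i, 1:]) = (\<Prod>i\<in>I. [:1, - a i:])" for a :: "'i \<Rightarrow> 'a"
  unfolding reflect_poly_prod by (rule prod.cong) (auto simp: reflect_poly_def)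

text \<open>Takes the place of the theorem on symmetric functions: whether a product of linear
  factors has its coefficients in \<open>K\<close> is decided through power sums alone. Newton's
  identity concerns \<Prod>(1 - a X), a factorization gives \<Prod>(X - a); reflection passes
  between them.\<close>

lemma coeff_prod_iff_power_sums:
  fixes a :: "'i \<Rightarrow> 'a"
  assumes "finite I"
  shows "(\<forall>n. coeff (\<Prod>i\<in>I. [:- a i, 1:]) n \<in> K) \<longleftrightarrow> (\<forall>k. (\<Sum>i\<in>I. a i ^ k) \<in> K)"
proof
  assume "\<forall>n. coeff (\<Prod>i\<in>I. [:- a i, 1:]) n \<in> K"
  then have "\<forall>n. coeff (\<Prod>i\<in>I. [:1, - a i:]) n \<in> K"
    using coeffs_closed_reflect reflect_prod_linear[OF assms] by metis
  then show "\<forall>k. (\<Sum>i\<in>I. a i ^ k) \<in> K" using power_sums_if_coeff_prod[OF assms] by blast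
next
  assume "\<forall>k. (\<Sum>i\<in>I. a i ^ k) \<in> K"
  then have *: "\<forall>n. coeff (\<Prod>i\<in>I. [:1, - a i:]) n \<in> K"
    using coeff_prod_if_power_sums[OF assms] by blast
  have deg: "degree (\<Prod>i\<in>I. [:- a i, 1:]) = card I"
    by (simp add: degree_prod_eq_sum_degree)
  show "\<forall>n. coeff (\<Prod>i\<in>I. [:- a i, 1:]) n \<in> K"
  proof
    fix n
    show "coeff (\<Prod>i\<in>I. [:- a i, 1:]) n \<in> K"
    proof (cases "n \<le> card I")
      case True
      have "coeff (\<Prod>i\<in>I. [:1, - a i:]) (card I - n) = coeff (\<Prod>i\<in>I. [:- a i, 1:]) n"
        unfolding reflect_prod_linear[OF assms, symmetric] using True deg
        by (simp add: coeff_reflect_poly)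
      then show ?thesis using * by metis
    next
      case False
      then show ?thesis using deg by (simp add: coeff_eq_0 field_closed_simps)
    qed
  qed
qed

text \<open>The pairwise combinations of Laplace's proof of the fundamental theorem of algebra.\<close>

lemma power_sums_pairs:
  fixes a :: "nat \<Rightarrow> 'a"
  assumes s: "\<And>k. (\<Sum>i<n. a i ^ k) \<in> K" and c: "c \<in> K"
  shows "(\<Sum>(i,j)\<in>{(i,j). i < j \<and> j < n}. (a i + a j + c * (a i * a j)) ^ k) \<in> K"
proof -
  define b where "b i j = a i + a j + c * (a i * a j)" for i j
  \<comment> \<open>The extra exponents p and q make the induction on k close: expanding one factor
    \<open>b i j\<close> only raises them.\<close>
  have 1: "(\<Sum>i<n. \<Sum>j<n. a i ^ p * a j ^ q * b i j ^ k) \<in> K" for p q k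
  proof (induction k arbitrary: p q)
    case 0
    have "(\<Sum>i<n. \<Sum>j<n. a i ^ p * a j ^ q) = (\<Sum>i<n. a i ^ p) * (\<Sum>j<n. a j ^ q)"
      by (simp add: sum_product)
    then show ?case using s by (auto intro: field_closed_simps)
  next
    case (Suc k)
    have "(\<Sum>i<n. \<Sum>j<n. a i ^ p * a j ^ q * b i j ^ Suc k) =
      (\<Sum>i<n. \<Sum>j<n. a i ^ Suc p * a j ^ q * b i j ^ k) +
      (\<Sum>i<n. \<Sum>j<n. a i ^ p * a j ^ Suc q * b i j ^ k) +
      c * (\<Sum>i<n. \<Sum>j<n. a i ^ Suc p * a j ^ Suc q * b i j ^ k)"
      unfolding sum_distrib_left sum.distrib[symmetric]
      by (intro sum.cong refl) (simp add: b_def algebra_simps)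
    also have "\<dots> \<in> K"
      by (intro field_closed_simps Suc c)
    finally show ?case .
  qed
  have 2: "(\<Sum>i<n. a i ^ p * b i i ^ k) \<in> K" for p k
  proof (induction k arbitrary: p)
    case (Suc k)
    have "(\<Sum>i<n. a i ^ p * b i i ^ Suc k) =
      2 * (\<Sum>i<n. a i ^ Suc p * b i i ^ k) + c * (\<Sum>i<n. a i ^ Suc (Suc p) * b i i ^ k)"
      unfolding sum_distrib_left sum.distrib[symmetric]
      by (intro sum.cong refl) (simp add: b_def algebra_simps)
    also have "\<dots> \<in> K"
      using field_closed_of_nat[of 2] by (intro field_closed_simps Suc c) simp
    finally show ?case .
  qed (use s in simp)
  define U where "U = {(i,j). i < j \<and> j < n}"
  define D where "D = {(i,j). i = j \<and> j < n}"
  define L where "L = {(i,j). j < i \<and> i < n}"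
  have fin: "finite U" "finite D" "finite L"
    by (rule finite_subset[of _ "{..<n} \<times> {..<n}"]; auto simp: U_def D_def L_def)+
  have "(\<Sum>(i,j)\<in>{..<n} \<times> {..<n}. b i j ^ k) = (\<Sum>(i,j)\<in>U \<union> D \<union> L. b i j ^ k)"
    by (rule sum.cong) (auto simp: U_def D_def L_def)
  also have "\<dots> = (\<Sum>(i,j)\<in>U. b i j ^ k) + (\<Sum>(i,j)\<in>D. b i j ^ k) + (\<Sum>(i,j)\<in>L. b i j ^ k)"
    using fin by (subst sum.union_disjoint, (auto simp: U_def D_def L_def)[3])+ simp
  also have "(\<Sum>(i,j)\<in>L. b i j ^ k) = (\<Sum>(i,j)\<in>U. b i j ^ k)"
    by (rule sum.reindex_bij_witness[of _ "\<lambda>(i,j). (j,i)" "\<lambda>(i,j). (j,i)"])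
      (auto simp: L_def U_def b_def algebra_simps)
  also have "(\<Sum>(i,j)\<in>D. b i j ^ k) = (\<Sum>i<n. b i i ^ k)"
    by (rule sum.reindex_bij_witness[of _ "\<lambda>i. (i,i)" "\<lambda>(i,j). i"]) (auto simp: D_def)
  \<comment> \<open>By the symmetry of \<open>b\<close>, all pairs minus the diagonal count every
    pair i < j twice.\<close>
  finally have "(\<Sum>(i,j)\<in>U. b i j ^ k) =
      ((\<Sum>i<n. \<Sum>j<n. b i j ^ k) - (\<Sum>i<n. b i i ^ k)) / of_nat 2"
    by (simp add: sum.cartesian_product)
  also have "\<dots> \<in> K"
    using 1[of 0 0 k] 2[of 0 k] by (intro field_closed_simps field_closed_of_nat) auto
  finally show ?thesis by (simp add: U_def b_def)
qed

end


subsection \<open>Laplace's proof that the field of complex elements is algebraically closed\<close>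

lemma degree_map_poly_to_ac [simp]: "degree (map_poly to_ac p) = degree p"
  by (rule degree_map_poly) simp

lemma poly_map_poly_to_ac: "poly (map_poly to_ac p) (to_ac x) = to_ac (poly p x)"
  by (induction p) (auto simp: map_poly_pCons)

context
  fixes \<iota> :: "'r::real_closed_field alg_closure"
  assumes \<iota>: "\<iota> * \<iota> = - 1"
begin

definition cplx :: "'r alg_closure set" where
  "cplx = {to_ac x + \<iota> * to_ac y | x y. True}"

lemma cplxI: "to_ac x + \<iota> * to_ac y \<in> cplx"
  by (auto simp: cplx_def)

lemma cplx_real: "to_ac x \<in> cplx"
  using cplxI[of x 0] by simp

lemma cplx_add: "z \<in> cplx \<Longrightarrow> w \<in> cplx \<Longrightarrow> z + w \<in> cplx"
proof (unfold cplx_def, clarify)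
  fix x y x' y'
  have "to_ac x + \<iota> * to_ac y + (to_ac x' + \<iota> * to_ac y') = to_ac (x + x') + \<iota> * to_ac (y + y')"
    by (simp add: algebra_simps)
  then show "\<exists>u v. to_ac x + \<iota> * to_ac y + (to_ac x' + \<iota> * to_ac y') = to_ac u + \<iota> * to_ac v \<and> True"
    by blast
qed

lemma cplx_mult: "z \<in> cplx \<Longrightarrow> w \<in> cplx \<Longrightarrow> z * w \<in> cplx"
proof (unfold cplx_def, clarify)
  fix x y x' y'
  have "(to_ac x + \<iota> * to_ac y) * (to_ac x' + \<iota> * to_ac y') =
     to_ac x * to_ac x' + (\<iota> * \<iota>) * (to_ac y * to_ac y') + \<iota> * (to_ac x * to_ac y' + to_ac y * to_ac x')"
    by (simp add: algebra_simps)
  also have "\<dots> = to_ac (x * x' - y * y') + \<iota> * to_ac (x * y' + y * x')"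
    by (simp add: \<iota>)
  finally show "\<exists>u v. (to_ac x + \<iota> * to_ac y) * (to_ac x' + \<iota> * to_ac y') = to_ac u + \<iota> * to_ac v \<and> True"
    by blast
qed

lemma cplx_uminus: "z \<in> cplx \<Longrightarrow> - z \<in> cplx"
  using cplx_mult[OF cplx_real[of "- 1"]] by simp

text \<open>With r the absolute value of z = x + \<iota> y, the two parts of the root are square
  roots of (r + x) / 2 and (r - x) / 2. Twice their product is y or - y, and changing the sign of
  one of them gives y.\<close>

lemma cplx_sqrt:
  assumes "z \<in> cplx"
  obtains w where "w \<in> cplx" "w * w = z"
proof -
  obtain x y where z: "z = to_ac x + \<iota> * to_ac y"
    using assms by (auto simp: cplx_def)
  obtain r0 where "r0 * r0 = x * x + y * y"
    using nonneg_has_sqrt[of "x * x + y * y"] by auto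
  then have r: "\<bar>r0\<bar> * \<bar>r0\<bar> = x * x + y * y" by simp
  define r where "r = \<bar>r0\<bar>"
  have r2: "r * r = x * x + y * y" and r0: "r \<ge> 0" using r by (auto simp: r_def)
  have "\<bar>x\<bar> ^ 2 \<le> r ^ 2" using r2 by (simp add: power2_eq_square)
  then have "\<bar>x\<bar> \<le> r" using r0 by (rule power2_le_imp_le)
  then obtain u w where u: "u * u = (r + x) / 2" and w: "w * w = (r - x) / 2"
    using nonneg_has_sqrt[of "(r + x) / 2"] nonneg_has_sqrt[of "(r - x) / 2"] by (auto simp: abs_le_iff)
  have "(2 * (u * w)) * (2 * (u * w)) = 4 * ((u * u) * (w * w))" by (simp add: algebra_simps)
  also have "\<dots> = y * y" using r2 unfolding u w by (simp add: field_simps)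
  finally have "2 * (u * w) = y \<or> 2 * (u * w) = - y"
    using square_eq_iff by blast
  then obtain w' where w': "w' * w' = (r - x) / 2" "2 * (u * w') = y"
  proof
    assume "2 * (u * w) = - y"
    then show thesis using w by (intro that[of "- w"]) auto
  qed (use w that in blast)
  have "(to_ac u + \<iota> * to_ac w') * (to_ac u + \<iota> * to_ac w') =
      to_ac u * to_ac u + (\<iota> * \<iota>) * (to_ac w' * to_ac w') + \<iota> * (2 * (to_ac u * to_ac w'))"
    by (simp add: algebra_simps)
  also have "\<dots> = to_ac (u * u - w' * w') + \<iota> * to_ac (2 * (u * w'))"
    by (simp add: \<iota>)
  also have "u * u - w' * w' = x" unfolding u w' by (simp add: field_simps)
  also note w'(2)
  finally show thesis using z by (intro that[OF cplxI[of u w']]) simp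
qed

text \<open>a - b is a square root of the discriminant (a + b)^2 - 4 a b, which lies in
  \<open>cplx\<close>.\<close>

lemma cplx_of_sum_prod:
  assumes "a + b \<in> cplx" "a * b \<in> cplx"
  shows "a \<in> cplx"
proof -
  have "(a - b) * (a - b) = (a + b) * (a + b) + to_ac (- 4) * (a * b)"
    by (simp add: algebra_simps)
  also have "\<dots> \<in> cplx" by (intro cplx_add cplx_mult cplx_real assms)
  finally obtain w where w: "w \<in> cplx" "w * w = (a - b) * (a - b)"
    using cplx_sqrt by metis
  then have "w = a - b \<or> w = - (a - b)" by (simp add: square_eq_iff)
  then have "a - b \<in> cplx" using w cplx_uminus[of w] by auto
  then have "to_ac (1 / 2) * ((a + b) + (a - b)) \<in> cplx"
    by (intro cplx_add cplx_mult cplx_real assms)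
  then show ?thesis by simp
qed

lemma field_closed_range_to_ac: "field_closed (range (to_ac :: 'r \<Rightarrow> _))"
  unfolding field_closed_def
  by (auto simp: image_iff simp flip: to_ac_add to_ac_diff to_ac_mult to_ac_divide to_ac_1)

lemma card_pairs: "card {(i::nat,j). i < j \<and> j < n} = n * (n - 1) div 2"
proof -
  have "{(i::nat,j). i < j \<and> j < n} = (\<lambda>(j,i). (i,j)) ` (SIGMA j:{..<n}. {..<j})"
    by (auto simp: image_iff)
  then have "card {(i::nat,j). i < j \<and> j < n} = card (SIGMA j:{..<n}. {..<j})"
    by (simp add: card_image inj_on_def split_def prod_eq_iff)
  also have "\<dots> = (\<Sum>j<n. j)" by simp
  also have "\<dots> = n * (n - 1) div 2"
    using Sum_Ico_nat[of 0 n] by (simp add: atLeast0LessThan)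
  finally show ?thesis .
qed

text \<open>Induction on the exponent of 2 in the degree n, starting from the axiom on odd degrees.
  The pairs of roots number n (n - 1) / 2, which contains one factor 2 less, so for every c some a_i
  + a_j + c a_i a_j lies in \<open>cplx\<close>. Infinitely many c meet finitely many pairs; a pair
  that occurs for two values of c has its sum and its product in \<open>cplx\<close>.\<close>

lemma poly_has_cplx_root_aux:
  fixes p :: "'r poly"
  assumes "degree p = 2 ^ k * m" "odd m"
  shows "\<exists>z\<in>cplx. poly (map_poly to_ac p) z = 0"
  using assms
proof (induction k arbitrary: p m)
  case 0
  then have "odd (degree p)" by simp
  then have "\<exists>x. (\<Sum>k\<le>degree p. coeff p k * x ^ k) = 0"
    by (rule odd_degree_has_root) (use \<open>odd (degree p)\<close> in auto)
  then obtain x where "poly p x = 0" by (auto simp: poly_altdef)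
  then have "poly (map_poly to_ac p) (to_ac x) = 0" by (simp add: poly_map_poly_to_ac)
  then show ?case using cplx_real by blast
next
  case (Suc k)
  define n where "n = degree p"
  have p0: "p \<noteq> 0" using Suc.prems by auto
  define P where "P = map_poly to_ac p"
  have P0: "P \<noteq> 0" and degP: "degree P = n" using p0 by (auto simp: P_def n_def map_poly_eq_0_iff)
  obtain A where A: "size A = n" "P = smult (lead_coeff P) (\<Prod>x\<in>#A. [:-x, 1:])"
    using alg_closed_imp_factorization[OF P0] degP by auto
  obtain xs where xs: "mset xs = A" using ex_mset by blast
  define a where "a i = xs ! i" for i
  have len: "length xs = n" using xs A(1) by auto
  have prod: "(\<Prod>x\<in>#A. [:-x, 1:]) = (\<Prod>i<n. [:- a i, 1:])"
  proof -
    have "(\<Prod>x\<in>#A. [:-x, 1:]) = prod_list (map (\<lambda>x. [:-x, 1:]) xs)"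
      by (metis mset_map prod_mset_prod_list xs)
    also have "\<dots> = (\<Prod>i<n. [:- a i, 1:])"
      by (simp add: prod.list_conv_set_nth len a_def atLeast0LessThan)
    finally show ?thesis .
  qed
  let ?R = "range (to_ac :: 'r \<Rightarrow> _)"
  have "coeff (\<Prod>i<n. [:- a i, 1:]) j \<in> ?R" for j
  proof -
    have "to_ac (coeff p j) = to_ac (lead_coeff p) * coeff (\<Prod>i<n. [:- a i, 1:]) j"
      using arg_cong[OF A(2), of "\<lambda>q. coeff q j"] prod by (simp add: P_def coeff_map_poly)
    then have "coeff (\<Prod>i<n. [:- a i, 1:]) j = to_ac (coeff p j / lead_coeff p)"
      using p0 by (simp add: field_simps)
    then show ?thesis by blast
  qed
  then have s: "(\<Sum>i<n. a i ^ j) \<in> ?R" for j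
    using coeff_prod_iff_power_sums[OF field_closed_range_to_ac, of "{..<n}" a] by auto
  define J where "J = {(i,j). i < j \<and> j < n}"
  define b where "b c ij = (case ij of (i,j) \<Rightarrow> a i + a j + of_nat c * (a i * a j))" for c :: nat and ij
  have finJ: "finite J"
    by (rule finite_subset[of _ "{..<n} \<times> {..<n}"]) (auto simp: J_def)
  obtain m' where m': "n = 2 * m'" "m' = 2 ^ k * m" "n > 0"
    using Suc.prems by (auto simp: n_def intro: Nat.gr0I)
  have card: "card J = 2 ^ k * (m * (n - 1))"
  proof -
    have "card J = n * (n - 1) div 2" unfolding J_def by (rule card_pairs)
    also have "\<dots> = m' * (n - 1)" using m' by (simp add: mult.assoc)
    finally show ?thesis using m' by (simp add: mult.assoc)
  qed
  have odd: "odd (m * (n - 1))" using Suc.prems m' by auto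
  have ex: "\<exists>ij\<in>J. b c ij \<in> cplx" for c
  proof -
    define Q where "Q = (\<Prod>ij\<in>J. [:- b c ij, 1:])"
    have "(\<Sum>ij\<in>J. b c ij ^ k) \<in> ?R" for k
      using power_sums_pairs[OF field_closed_range_to_ac s, of "of_nat c" k]
      using field_closed_of_nat[OF field_closed_range_to_ac, of c]
      unfolding J_def b_def by (simp add: split_def)
    then have Q: "\<forall>j. coeff Q j \<in> ?R"
      unfolding Q_def using coeff_prod_iff_power_sums[OF field_closed_range_to_ac finJ] by blast
    \<comment> \<open>All coefficients of \<open>Q\<close> come from \<open>'r\<close>, so it
      descends to a polynomial over \<open>'r\<close>, to which the induction hypothesis
      applies.\<close>
    define q where "q = map_poly of_ac Q"
    have q: "map_poly to_ac q = Q"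
      using Q by (intro poly_eqI) (simp add: q_def coeff_map_poly to_ac_of_ac)
    have "degree q = degree (map_poly to_ac q)" by simp
    also have "\<dots> = 2 ^ k * (m * (n - 1))"
      unfolding q using card by (simp add: Q_def degree_prod_eq_sum_degree)
    finally obtain z where "z \<in> cplx" "poly Q z = 0"
      using Suc.IH[OF _ odd] q by metis
    then show ?thesis using finJ by (auto simp: Q_def poly_prod)
  qed
  then obtain f where f: "\<And>c. f c \<in> J" "\<And>c. b c (f c) \<in> cplx" by metis
  have "\<not> inj f"
    using finJ f(1) finite_subset[of "range f" J] finite_imageD[of f UNIV] by auto
  then obtain c c' where c: "c \<noteq> c'" "f c = f c'" by (auto simp: inj_def)
  obtain i j where ij: "f c = (i, j)" by fastforce
  have ij': "i < n" using f(1)[of c] ij by (auto simp: J_def)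
  \<comment> \<open>Subtracting the two memberships cancels the sum of the roots and leaves d times
    their product.\<close>
  define d where "d = (of_nat c - of_nat c' :: 'r)"
  have d0: "d \<noteq> 0" using c by (simp add: d_def)
  have "b c (f c) + (- b c' (f c')) = to_ac d * (a i * a j)"
    using c(2)[symmetric] by (simp add: b_def ij d_def algebra_simps)
  then have "to_ac d * (a i * a j) \<in> cplx"
    using f(2) cplx_add cplx_uminus by metis
  then have "to_ac (1 / d) * (to_ac d * (a i * a j)) \<in> cplx"
    using cplx_mult cplx_real by blast
  then have prod': "a i * a j \<in> cplx" using d0 by simp
  have "b c (f c) + (- (to_ac (of_nat c) * (a i * a j))) \<in> cplx"
    by (intro cplx_add[OF f(2)] cplx_uminus cplx_mult[OF cplx_real prod'])
  then have "a i + a j \<in> cplx" by (simp add: b_def ij)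
  then have ai: "a i \<in> cplx" using prod' by (rule cplx_of_sum_prod)
  have "poly (\<Prod>i<n. [:- a i, 1:]) (a i) = 0"
    using ij' by (auto simp: poly_prod)
  then have "poly P (a i) = 0" using A(2) prod by (metis mult_zero_right poly_smult)
  then show ?case using ai by (auto simp: P_def)
qed

lemma poly_has_cplx_root:
  fixes p :: "'r poly"
  assumes "degree p > 0"
  shows "\<exists>x y. poly (map_poly to_ac p) (to_ac x + \<iota> * to_ac y) = 0"
proof -
  have "\<exists>k m. n = 2 ^ k * m \<and> odd m" if "n > 0" for n :: nat
    using that
  proof (induction n rule: less_induct)
    case (less n)
    show ?case
    proof (cases "even n")
      case True
      then obtain n' where n': "n = 2 * n'" by blast
      then obtain k m where "n' = 2 ^ k * m" "odd m" using less.IH[of n'] less.prems by auto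
      then show ?thesis using n' by (intro exI[of _ "Suc k"] exI[of _ m]) auto
    qed (auto intro: exI[of _ 0])
  qed
  then obtain k m where "degree p = 2 ^ k * m" "odd m" using assms by blast
  then show ?thesis using poly_has_cplx_root_aux by (fastforce simp: cplx_def)
qed

end

subsection \<open>The intermediate value theorem and its consequences\<close>

lemma alg_closed_imaginary_unit: "\<exists>\<iota>::'a::alg_closed_field. \<iota> * \<iota> = - 1"
  using nth_root_exists[of 2 "- 1 :: 'a"] by (auto simp: power2_eq_square)

text \<open>The quadratic is (X - x)^2 + y^2, which vanishes at the nonreal root x + \<iota> y. The
  remainder of p modulo it has degree at most 1 and vanishes there too, which forces it to be
  0.\<close>

lemma poly_real_root_or_quadratic_factor:
  fixes p :: "'r::real_closed_field poly"
  assumes "degree p > 0"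
  obtains c q where "p = [:- c, 1:] * q"
  | x y q where "y \<noteq> 0" "p = [:x * x + y * y, - 2 * x, 1:] * q"
proof -
  obtain \<iota> :: "'r alg_closure" where \<iota>: "\<iota> * \<iota> = - 1"
    using alg_closed_imaginary_unit by blast
  obtain x y where root: "poly (map_poly to_ac p) (to_ac x + \<iota> * to_ac y) = 0"
    using poly_has_cplx_root[OF \<iota> assms] by blast
  show thesis
  proof (cases "y = 0")
    case True
    then have "to_ac (poly p x) = 0" using root by (simp add: poly_map_poly_to_ac)
    then have "[:- x, 1:] dvd p" by (simp add: poly_eq_0_iff_dvd)
    then show thesis using that(1) by (auto elim: dvdE)
  next
    case False
    define h where "h = [:x * x + y * y, - 2 * x, 1:]"
    define z where "z = to_ac x + \<iota> * to_ac y"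
    have hom: "map_poly to_ac (u * w + r) = map_poly to_ac u * map_poly to_ac w + map_poly to_ac r"
      for u w r :: "'r poly"
      by (intro poly_eqI) (simp add: coeff_map_poly coeff_mult to_ac_sum)
    have "p = h * (p div h) + p mod h" by simp
    then have "map_poly to_ac p = map_poly to_ac h * map_poly to_ac (p div h) + map_poly to_ac (p mod h)"
      using hom by metis
    moreover have "poly (map_poly to_ac h) z = 0"
    proof -
      have "poly (map_poly to_ac h) z = to_ac y * to_ac y + (\<iota> * \<iota>) * (to_ac y * to_ac y)"
        by (simp add: h_def z_def map_poly_pCons algebra_simps)
      then show ?thesis by (simp add: \<iota>)
    qed
    ultimately have rem: "poly (map_poly to_ac (p mod h)) z = 0"
      using root by (simp add: z_def)
    have "degree (p mod h) < 2"
      using degree_mod_less'[of h p] by (cases "p mod h = 0") (auto simp: h_def)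
    then have "degree (p mod h) \<le> 1" by simp
    then obtain a b where ab: "p mod h = [:a, b:]"
      by (rule_tac that[of "coeff (p mod h) 0" "coeff (p mod h) 1"])
        (auto simp: poly_eq_iff coeff_pCons coeff_eq_0 split: nat.splits)
    \<comment> \<open>Squaring removes \<iota> and leaves a sum of two squares equal to 0; the order
      then makes both squares vanish.\<close>
    have e: "to_ac (a + b * x) = - (\<iota> * to_ac (b * y))"
      using rem by (simp add: ab z_def map_poly_pCons algebra_simps eq_neg_iff_add_eq_0)
    then have "to_ac ((a + b * x) * (a + b * x)) = (\<iota> * \<iota>) * (to_ac (b * y) * to_ac (b * y))"
      unfolding to_ac_mult by (simp add: algebra_simps)
    also have "\<dots> = to_ac (- ((b * y) * (b * y)))" by (simp add: \<iota>)
    finally have "(a + b * x) * (a + b * x) + (b * y) * (b * y) = 0"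
      by (simp only: to_ac_eq_iff)
    then have "b * y = 0 \<and> a + b * x = 0"
      by (metis sum_squares_eq_zero_iff)
    then have "p mod h = 0" using False ab by auto
    then have "p = h * (p div h)" by (metis add.right_neutral mult_div_mod_eq)
    then show thesis using that(2) False by (auto simp: h_def)
  qed
qed

text \<open>Induction on the degree by splitting off factors. A quadratic factor is positive
  everywhere, and a linear factor whose root lies outside ]a,b[ has the same sign at a and b;
  removing either preserves the sign change.\<close>

lemma poly_IVT_rcf:
  fixes p :: "'r::real_closed_field poly"
  assumes "a < b" "poly p a * poly p b < 0"
  shows "\<exists>x. a < x \<and> x < b \<and> poly p x = 0"
  using assms
proof (induction "degree p" arbitrary: p rule: less_induct)
  case less
  have "degree p > 0"
  proof (rule ccontr)
    assume "\<not> degree p > 0"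
    then obtain c where "p = [:c:]" using degree_eq_zeroE by blast
    then show False using less.prems by (simp add: mult_less_0_iff)
  qed
  then show ?case
  proof (cases rule: poly_real_root_or_quadratic_factor)
    case (1 c q)
    have nz: "poly p a \<noteq> 0" "poly p b \<noteq> 0" using less.prems by auto
    show ?thesis
    proof (cases "a < c \<and> c < b")
      case True
      then show ?thesis using 1 by (auto intro!: exI[of _ c])
    next
      case False
      have "c \<noteq> a" "c \<noteq> b" using nz 1 by auto
      then have pos: "(a - c) * (b - c) > 0" using False less.prems(1)
        by (auto simp: zero_less_mult_iff)
      have "(a - c) * (b - c) * (poly q a * poly q b) < 0"
        using less.prems(2) unfolding 1 by (simp add: algebra_simps)
      then have "poly q a * poly q b < 0" using pos by (metis mult_less_0_iff not_less_iff_gr_or_eq)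
      moreover have "degree q < degree p"
        using 1 nz by (subst 1, subst degree_mult_eq) auto
      ultimately show ?thesis using less.hyps[of q] less.prems(1) 1 by auto
    qed
  next
    case (2 x y q)
    have nz: "poly p a \<noteq> 0" using less.prems by auto
    have h: "poly [:x * x + y * y, - 2 * x, 1:] t = (t - x) * (t - x) + y * y" for t
      by (simp add: algebra_simps)
    have pos: "poly [:x * x + y * y, - 2 * x, 1:] t > 0" for t
      unfolding h using 2(1) by (metis sum_squares_gt_zero_iff)
    have "poly [:x * x + y * y, - 2 * x, 1:] a * poly [:x * x + y * y, - 2 * x, 1:] b *
        (poly q a * poly q b) < 0"
      using less.prems(2) unfolding 2(2) poly_mult by (simp only: ac_simps)
    moreover have "poly [:x * x + y * y, - 2 * x, 1:] a * poly [:x * x + y * y, - 2 * x, 1:] b > 0"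
      using pos by (intro mult_pos_pos)
    ultimately have "poly q a * poly q b < 0" by (metis mult_less_0_iff not_less_iff_gr_or_eq)
    moreover have "degree q < degree p"
      using 2 nz by (subst 2, subst degree_mult_eq) auto
    ultimately show ?thesis using less.hyps[of q] less.prems(1) 2 by auto
  qed
qed

lemma poly_same_sign_rcf:
  fixes p :: "'r::real_closed_field poly"
  assumes "\<And>z. min x y \<le> z \<Longrightarrow> z \<le> max x y \<Longrightarrow> poly p z \<noteq> 0"
  shows "poly p x > 0 \<longleftrightarrow> poly p y > 0"
proof (rule ccontr)
  assume *: "\<not> ?thesis"
  have nz: "poly p x \<noteq> 0" "poly p y \<noteq> 0" using assms[of x] assms[of y] by auto
  then have "poly p x * poly p y < 0" "poly p y * poly p x < 0" "x \<noteq> y" using *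
    by (auto simp: mult_less_0_iff)
  then obtain z where "min x y < z" "z < max x y" "poly p z = 0"
    using poly_IVT_rcf[of x y p] poly_IVT_rcf[of y x p] by (cases "x < y") (auto simp: min_def max_def)
  then show False using assms[of z] by auto
qed

text \<open>For consecutive roots write p = (X - a)^(m+1) (X - b)^(n+1) r with r of constant sign on
  [a,b]. Then p' = (X - a)^m (X - b)^n s, and only one summand of s survives at each end, where they
  have opposite signs.\<close>

lemma poly_rolle_aux:
  fixes p :: "'r::real_closed_field poly"
  assumes "a < b" "poly p a = 0" "poly p b = 0" "p \<noteq> 0"
    and nz: "\<And>z. a < z \<Longrightarrow> z < b \<Longrightarrow> poly p z \<noteq> 0"
  shows "\<exists>x. a < x \<and> x < b \<and> poly (pderiv p) x = 0"
proof -
  obtain q where q: "p = [:- a, 1:] ^ order a p * q" "\<not> [:- a, 1:] dvd q"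
    using order_decomp[OF assms(4)] by blast
  have q0: "q \<noteq> 0" using q assms(4) by auto
  obtain r where r: "q = [:- b, 1:] ^ order b q * r" "\<not> [:- b, 1:] dvd r"
    using order_decomp[OF q0] by blast
  have oa: "order a p \<noteq> 0" using assms(2,4) order_root by blast
  have "poly p b = (b - a) ^ order a p * poly q b"
    using arg_cong[OF q(1), of "\<lambda>p. poly p b"] by simp
  then have "poly q b = 0" using assms(1,3) by auto
  then have ob: "order b q \<noteq> 0" using q0 order_root by blast
  obtain m n where m: "order a p = Suc m" and n: "order b q = Suc n"
    using oa ob not0_implies_Suc by meson
  have p: "p = [:- a, 1:] ^ Suc m * ([:- b, 1:] ^ Suc n * r)"
    using q(1) r(1) unfolding m n by simp
  have "poly q a = (a - b) ^ order b q * poly r a"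
    using arg_cong[OF r(1), of "\<lambda>p. poly p a"] by simp
  then have ra: "poly r a \<noteq> 0" using q(2) by (auto simp: poly_eq_0_iff_dvd[symmetric])
  have rb: "poly r b \<noteq> 0" using r(2) by (auto simp: poly_eq_0_iff_dvd[symmetric])
  have "poly r z \<noteq> 0" if "a \<le> z" "z \<le> b" for z
    using that ra rb nz[of z] p by (cases "z = a \<or> z = b") auto
  then have sign: "poly r a > 0 \<longleftrightarrow> poly r b > 0"
    using assms(1) by (intro poly_same_sign_rcf) auto
  define s where "s = smult (of_nat (Suc m)) ([:- b, 1:] * r) + smult (of_nat (Suc n)) ([:- a, 1:] * r) +
     [:- a, 1:] * [:- b, 1:] * pderiv r"
  have D: "pderiv [:- c, 1:] = 1" for c :: 'r by (simp add: pderiv_pCons)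
  have "pderiv (A ^ Suc m * (B ^ Suc n * r)) = A ^ m * B ^ n *
      (smult (of_nat (Suc m)) (B * r) + smult (of_nat (Suc n)) (A * r) + A * B * pderiv r)"
    if "pderiv A = 1" "pderiv B = 1" for A B
    unfolding pderiv_mult pderiv_power_Suc that
    by (simp add: algebra_simps del: of_nat_Suc)
  then have "pderiv p = [:- a, 1:] ^ m * [:- b, 1:] ^ n * s"
    using D unfolding p s_def by blast
  have "poly s a = - (of_nat (Suc m) * (b - a) * poly r a)"
    by (simp add: s_def algebra_simps)
  moreover have "poly s b = of_nat (Suc n) * (b - a) * poly r b"
    by (simp add: s_def algebra_simps)
  moreover have "of_nat (Suc m) * (b - a) > 0" "of_nat (Suc n) * (b - a) > 0"
    using assms(1) by (simp_all del: of_nat_Suc)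
  ultimately have "poly s a * poly s b < 0"
    using sign ra rb by (cases "poly r a > 0") (auto simp: mult_less_0_iff zero_less_mult_iff not_less simp del: of_nat_Suc)
  then obtain x where "a < x" "x < b" "poly s x = 0"
    using poly_IVT_rcf[OF assms(1)] by blast
  then show ?thesis using \<open>pderiv p = _\<close> by auto
qed

lemma poly_rolle_rcf:
  fixes p :: "'r::real_closed_field poly"
  assumes "a < b" "poly p a = 0" "poly p b = 0"
  shows "\<exists>x. a < x \<and> x < b \<and> poly (pderiv p) x = 0"
proof (cases "p = 0")
  case True
  then show ?thesis using assms(1) dense by auto
next
  case False
  \<comment> \<open>The least element of \<open>B\<close> is the first root after a, which reduces
    the claim to consecutive roots.\<close>
  define B where "B = {x. poly p x = 0} \<inter> {a<..b}"
  have B: "finite B" "b \<in> B" using poly_roots_finite[OF False] assms by (auto simp: B_def)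
  define b' where "b' = Min B"
  have "b' \<in> B" unfolding b'_def using B by (intro Min_in) auto
  then have b': "a < b'" "b' \<le> b" "poly p b' = 0" by (auto simp: B_def)
  have "poly p z \<noteq> 0" if "a < z" "z < b'" for z
    using that Min_le[OF B(1), of z] b'(2) by (auto simp: B_def b'_def)
  then obtain x where "a < x" "x < b'" "poly (pderiv p) x = 0"
    using poly_rolle_aux[OF b'(1) assms(2) b'(3) False] by blast
  then show ?thesis using b' by auto
qed

lemma poly_MVT_rcf:
  fixes p :: "'r::real_closed_field poly"
  assumes "a < b"
  shows "\<exists>x. a < x \<and> x < b \<and> poly p b - poly p a = (b - a) * poly (pderiv p) x"
proof -
  define c where "c = (poly p b - poly p a) / (b - a)"
  define q where "q = p - [:poly p a - c * a, c:]"
  have qa: "poly q a = 0" by (simp add: q_def)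
  have "(b - a) * c = poly p b - poly p a" using assms by (simp add: c_def)
  then have "poly q b = 0" by (simp add: q_def algebra_simps)
  with qa obtain x where x: "a < x" "x < b" "poly (pderiv q) x = 0"
    using poly_rolle_rcf[OF assms] by blast
  have "poly (pderiv p) x = c" using x(3) by (simp add: q_def pderiv_diff pderiv_pCons)
  then show ?thesis using x assms by (auto simp: c_def)
qed

lemma poly_mono_rcf:
  fixes p :: "'r::real_closed_field poly"
  assumes "a \<le> b" "\<And>x. a < x \<Longrightarrow> x < b \<Longrightarrow> poly (pderiv p) x \<ge> 0"
  shows "poly p a \<le> poly p b"
proof (cases "a = b")
  case False
  then obtain x where "a < x" "x < b" "poly p b - poly p a = (b - a) * poly (pderiv p) x"
    using assms(1) poly_MVT_rcf[of a b p] by auto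
  moreover have "(b - a) * poly (pderiv p) x \<ge> 0" using calculation assms by (intro mult_nonneg_nonneg) auto
  ultimately show ?thesis by simp
qed auto

lemma poly_ge_at_top:
  fixes p :: "'r::linordered_field poly"
  assumes "lead_coeff p > 0"
  shows "\<exists>n. \<forall>x\<ge>n. poly p x \<ge> lead_coeff p"
  using assms
proof (induction p)
  case (pCons a p)
  show ?case
  proof (cases "p = 0")
    case False
    then have lc: "lead_coeff p > 0" using pCons.prems by simp
    then obtain n where n: "\<forall>x\<ge>n. poly p x \<ge> lead_coeff p" using pCons.IH by blast
    \<comment> \<open>Beyond this threshold x p(x) is at least the leading coefficient plus |a|,
      which absorbs the new constant term a.\<close>
    have "poly (pCons a p) x \<ge> lead_coeff p" if x: "x \<ge> max n (1 + \<bar>a\<bar> / lead_coeff p)" for x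
    proof -
      have x1: "x \<ge> 1 + \<bar>a\<bar> / lead_coeff p" using x by simp
      have "0 \<le> \<bar>a\<bar> / lead_coeff p" using lc by simp
      then have "x \<ge> 0" using x1 by linarith
      have "lead_coeff p + \<bar>a\<bar> = (1 + \<bar>a\<bar> / lead_coeff p) * lead_coeff p"
        using lc False by (simp add: distrib_right)
      also have "\<dots> \<le> x * poly p x"
        using n x lc \<open>x \<ge> 0\<close> by (intro mult_mono) auto
      finally have "lead_coeff p + \<bar>a\<bar> \<le> x * poly p x" .
      moreover have "- a \<le> \<bar>a\<bar>" by (simp add: abs_if)
      ultimately have "lead_coeff p \<le> a + x * poly p x" by linarith
      then show ?thesis using False by simp
    qed
    then show ?thesis using False by (intro exI[of _ "max n (1 + \<bar>a\<bar> / lead_coeff p)"]) auto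
  qed (use pCons.prems in auto)
qed simp

section \<open>Signs of polynomials near endpoints and at infinity\<close>

lemma isgn_simps [simp]: "isgn 0 = 0" "x > 0 \<Longrightarrow> isgn x = 1" "x < 0 \<Longrightarrow> isgn x = - 1"
  "isgn (x :: 'r::linordered_field) = 0 \<longleftrightarrow> x = 0" "isgn x = 1 \<longleftrightarrow> x > 0" "isgn x = - 1 \<longleftrightarrow> x < 0"
  by (auto simp: isgn_def)

lemma isgn_mult: "isgn (x * y) = isgn x * isgn (y :: 'r::linordered_field)"
  by (auto simp: isgn_def mult_less_0_iff zero_less_mult_iff)

lemma isgn_power: "isgn (x ^ n) = isgn (x :: 'r::linordered_field) ^ n"
  by (induction n) (auto simp: isgn_mult)

lemma isgn_minus: "isgn (- x :: 'r::linordered_field) = - isgn x"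
  by (auto simp: isgn_def)

lemma isgn_poly_const:
  fixes p :: "'r::real_closed_field poly"
  assumes "\<And>z. min x y \<le> z \<Longrightarrow> z \<le> max x y \<Longrightarrow> poly p z \<noteq> 0"
  shows "isgn (poly p x) = isgn (poly p y)"
  using poly_same_sign_rcf[of x y p, OF assms] assms[of x] assms[of y]
  by (auto simp: isgn_def)

lemma isgn_poly_at_top:
  fixes p :: "'r::real_closed_field poly"
  assumes "p \<noteq> 0" "\<And>z. x \<le> z \<Longrightarrow> poly p z \<noteq> 0"
  shows "isgn (poly p x) = isgn (lead_coeff p)"
proof -
  have "\<exists>n. \<forall>x\<ge>n. isgn (poly p x) = isgn (lead_coeff p)"
  proof (cases "lead_coeff p > 0")
    case True
    then obtain n where "\<forall>x\<ge>n. poly p x \<ge> lead_coeff p" using poly_ge_at_top by blast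
    then show ?thesis using True by (intro exI[of _ n]) force
  next
    case False
    then have "lead_coeff (- p) > 0" using assms(1)
      by (metis lead_coeff_minus leading_coeff_0_iff linorder_neqE_linordered_idom neg_0_less_iff_less)
    then obtain n where "\<forall>x\<ge>n. poly (- p) x \<ge> lead_coeff (- p)" using poly_ge_at_top by blast
    then have "\<forall>x\<ge>n. poly p x < 0" using \<open>lead_coeff (- p) > 0\<close> by (simp add: lead_coeff_minus) force
    then show ?thesis using \<open>lead_coeff (- p) > 0\<close> by (intro exI[of _ n]) (simp add: lead_coeff_minus)
  qed
  then obtain n where "\<forall>x\<ge>n. isgn (poly p x) = isgn (lead_coeff p)" by blast
  moreover have "isgn (poly p x) = isgn (poly p (max x n))"
    using assms(2) by (intro isgn_poly_const) auto
  ultimately show ?thesis by simp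
qed

lemma isgn_poly_at_bot:
  fixes p :: "'r::real_closed_field poly"
  assumes "p \<noteq> 0" "\<And>z. z \<le> x \<Longrightarrow> poly p z \<noteq> 0"
  shows "isgn (poly p x) = (- 1) ^ degree p * isgn (lead_coeff p)"
proof -
  define q where "q = pcompose p [:0, - 1:]"
  have q: "poly q z = poly p (- z)" for z by (simp add: q_def poly_pcompose)
  have "lead_coeff q = lead_coeff p * (- 1) ^ degree p"
    by (simp add: q_def lead_coeff_comp)
  moreover have "q \<noteq> 0" using calculation assms(1) by auto
  moreover have "poly q z \<noteq> 0" if "z \<ge> - x" for z
    using assms(2)[of "- z"] that q by auto
  ultimately have "isgn (poly q (- x)) = isgn (lead_coeff p * (- 1) ^ degree p)"
    using isgn_poly_at_top[of q "- x"] by auto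
  then show ?thesis by (simp add: q isgn_mult isgn_power isgn_minus mult.commute)
qed

text \<open>Stated with \<open>min\<close> and \<open>max\<close> so that x may be the left or the
  right end of an interval; y is then a point inside. The sign can only drop to 0 at the
  end.\<close>

lemma isgn_poly_endpoint:
  fixes p :: "'r::real_closed_field poly"
  assumes "\<And>z. min x y < z \<Longrightarrow> z \<le> max x y \<Longrightarrow> z \<noteq> x \<Longrightarrow> poly p z \<noteq> 0"
    "\<And>z. min x y \<le> z \<Longrightarrow> z < max x y \<Longrightarrow> z \<noteq> x \<Longrightarrow> poly p z \<noteq> 0"
  shows "isgn (poly p x) = 0 \<or> isgn (poly p x) = isgn (poly p y)"
proof (cases "poly p x = 0")
  case False
  then have "isgn (poly p x) = isgn (poly p y)"
    using assms by (intro isgn_poly_const) (metis le_less max_def min_def order_le_less_trans)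
  then show ?thesis by simp
qed auto

text \<open>Source of the divisibility of the value group. The polynomial Y^n - x changes sign
  between 0 and 1 + x, since x < 1 + x \<le> (1 + x)^n.\<close>

lemma pos_root_exists:
  fixes x :: "'r::real_closed_field"
  assumes "x > 0" "n > 0"
  shows "\<exists>y>0. y ^ n = x"
proof -
  define p where "p = monom 1 n - [:x:]"
  have p: "poly p y = y ^ n - x" for y by (simp add: p_def poly_monom)
  have "x < (1 + x) ^ n"
    by (rule less_le_trans[of _ "1 + x"]) (use assms in \<open>auto intro: self_le_power\<close>)
  then have "poly p 0 * poly p (1 + x) < 0"
    using assms by (auto simp: p mult_less_0_iff power_0_left)
  then obtain y where "0 < y" "poly p y = 0"
    using poly_IVT_rcf[of 0 "1 + x" p] assms by auto
  then show ?thesis by (auto simp: p)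
qed

subsection \<open>The generalized Taylor formula up to bounded factors\<close>

text \<open>The relation in which the generalized Taylor formula is stated: a convex valuation does
  not see factors bounded by natural numbers, so estimates can replace exact iterated integrals.
  Both sides are nonnegative, so sums of comparable terms stay comparable.\<close>

definition comparable :: "nat \<Rightarrow> 'r::linordered_field \<Rightarrow> 'r \<Rightarrow> bool" where
  "comparable N x y \<longleftrightarrow> 0 \<le> x \<and> 0 \<le> y \<and> x \<le> of_nat N * y \<and> y \<le> of_nat N * x"

lemma comparable_mono:
  assumes "comparable N x y" "N \<le> M"
  shows "comparable M x y"
proof -
  have "of_nat N * z \<le> of_nat M * z" if "z \<ge> 0" for z :: 'a
    using that assms(2) by (intro mult_right_mono) auto
  then show ?thesis using assms(1) unfolding comparable_def by (meson order_trans)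
qed

lemma comparable_trans:
  assumes "comparable N x y" "comparable M y z"
  shows "comparable (N * M) x z"
proof -
  have "x \<le> of_nat N * y" "z \<le> of_nat M * y" using assms by (auto simp: comparable_def)
  moreover have "of_nat N * y \<le> of_nat N * (of_nat M * z)" "of_nat M * y \<le> of_nat M * (of_nat N * x)"
    using assms by (auto simp: comparable_def intro: mult_left_mono)
  ultimately show ?thesis using assms by (auto simp: comparable_def algebra_simps)
qed

lemma comparable_add:
  "comparable N x y \<Longrightarrow> comparable N x' y' \<Longrightarrow> comparable N (x + x') (y + y')"
  by (auto simp: comparable_def distrib_left)

lemma comparable_sum:
  "(\<And>i. i \<in> I \<Longrightarrow> comparable N (f i) (g i)) \<Longrightarrow> comparable N (sum f I) (sum g I)"
  by (auto simp: comparable_def sum_distrib_left intro: sum_nonneg sum_mono)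

lemma comparable_mult_left:
  "0 \<le> c \<Longrightarrow> comparable N x y \<Longrightarrow> comparable N (c * x) (c * y)"
  unfolding comparable_def
  by (auto simp: mult.left_commute[of _ c] intro: mult_left_mono)

lemma comparable_refl: "0 \<le> x \<Longrightarrow> comparable 1 x x"
  by (auto simp: comparable_def)

definition endpoint :: "'r \<Rightarrow> 'r \<Rightarrow> bool \<Rightarrow> 'r" where
  "endpoint a b e = (if e then a else b)"

definition ratio :: "'r::linordered_field \<Rightarrow> 'r \<Rightarrow> bool \<Rightarrow> 'r \<Rightarrow> 'r" where
  "ratio a b e y = (if e then (y - a) / (b - a) else (b - y) / (b - a))"

text \<open>This is \<open>taylor_order\<close> with the test \<open>expand_left\<close> abstracted
  to \<open>el\<close>, so that passing to the derivative becomes a shift of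
  \<open>el\<close>.\<close>

definition torder :: "(nat \<Rightarrow> bool) \<Rightarrow> bool \<Rightarrow> nat \<Rightarrow> nat" where
  "torder el e i = (if i = 0 then 0 else Suc (length (takeWhile (\<lambda>l. el l = e) [1..<i])))"

lemma torder_0 [simp]: "torder el e 0 = 0"
  by (simp add: torder_def)

text \<open>The effect of one integration from the end \<open>e\<close>: an integrand expanded from
  the same end gains one power of the ratio, whereas the integral of one expanded from the opposite
  end vanishes to first order only.\<close>

lemma torder_Suc:
  "torder el e (Suc i) = (if el 1 = e then Suc (torder (\<lambda>l. el (Suc l)) e i) else 1)"
proof (cases i)
  case (Suc j)
  have "[1..<Suc i] = 1 # map Suc [1..<i]"
    using Suc by (simp add: map_Suc_upt upt_conv_Cons del: upt_Suc)
  then show ?thesis using Suc by (simp add: torder_def takeWhile_map comp_def)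
qed (simp add: torder_def)

lemma torder_const: "torder (\<lambda>_. e) e i = i"
proof -
  have *: "takeWhile (\<lambda>l. True) xs = xs" for xs :: "nat list" by (induction xs) auto
  show ?thesis by (cases i) (simp_all add: torder_def * del: upt_Suc)
qed

text \<open>The integral of (1 - t)^k from 0 to t, which arises when the expansion changes its end:
  it has first order in t, with a bounded factor.\<close>

lemma one_minus_power_bounds:
  assumes "0 \<le> t" "t \<le> (1::'r::linordered_field)"
  shows "comparable (Suc k) ((1 - (1 - t) ^ Suc k) / of_nat (Suc k)) t"
proof -
  have "(1 - t) ^ Suc k \<le> (1 - t) ^ 1"
    using assms by (intro power_decreasing) auto
  then have 1: "t \<le> 1 - (1 - t) ^ Suc k" by simp
  \<comment> \<open>Bernoulli's inequality bounds 1 - (1 - t)^(k+1) above by (k + 1) t.\<close>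
  have "1 - of_nat n * t \<le> (1 - t) ^ n" for n
  proof (induction n)
    case (Suc n)
    have "(1 - t) * (1 - of_nat n * t) \<le> (1 - t) * (1 - t) ^ n"
      using Suc assms by (intro mult_left_mono) auto
    moreover have "(1 - t) * (1 - of_nat n * t) = 1 - of_nat (Suc n) * t + of_nat n * (t * t)"
      by (simp add: algebra_simps)
    moreover have "of_nat n * (t * t) \<ge> 0" by simp
    ultimately show ?case unfolding power_Suc by linarith
  qed simp
  from this[of "Suc k"] have 2: "1 - (1 - t) ^ Suc k \<le> of_nat (Suc k) * t" by linarith
  have 3: "1 * t \<le> of_nat (Suc k) * t"
    using assms by (intro mult_right_mono) auto
  define Z where "Z = 1 - (1 - t) ^ Suc k"
  have pos: "(of_nat (Suc k) :: 'r) > 0" by (simp del: of_nat_Suc)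
  have "Z / of_nat (Suc k) \<le> t" using 2 pos by (simp add: Z_def[symmetric] pos_divide_le_eq mult.commute del: of_nat_Suc power_Suc)
  moreover have "of_nat (Suc k) * (Z / of_nat (Suc k)) = Z" using pos by (simp del: of_nat_Suc)
  moreover have "Z / of_nat (Suc k) \<ge> 0" using 1 assms pos unfolding Z_def[symmetric]
    by (intro divide_nonneg_pos) auto
  ultimately show ?thesis using 1 3 assms unfolding comparable_def Z_def[symmetric] by auto
qed

lemma ratio_bounds:
  assumes "a < b" "a < y" "y < (b::'r::linordered_field)"
  shows "0 < ratio a b e y" "ratio a b e y < 1" "ratio a b (\<not> e) y = 1 - ratio a b e y"
proof -
  have "ratio a b (\<not> e) y + ratio a b e y = 1"
    using assms by (simp add: ratio_def add_divide_distrib[symmetric])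
  then show "ratio a b (\<not> e) y = 1 - ratio a b e y" by simp
qed (use assms in \<open>auto simp: ratio_def\<close>)

lemma ratio_endpoint:
  assumes "a < (b::'r::linordered_field)"
  shows "ratio a b e (endpoint a b e') = (if e = e' then 0 else 1)"
  using assms by (auto simp: ratio_def endpoint_def)

lemma pderiv_sum: "pderiv (\<Sum>i\<in>I. f i) = (\<Sum>i\<in>I. pderiv (f i :: 'a::field_char_0 poly))"
  by (induction I rule: infinite_finite_induct) (auto simp: pderiv_add)

text \<open>If the derivatives of F and H bound each other up to the factor N, then N H - F and N F
  - H increase, so the increments bound each other as well. H is an explicit primitive of the given
  sum, and its increment from the end \<open>e\<close> is estimated term by term.\<close>

lemma integrate_comparable:
  fixes F :: "'r::real_closed_field poly" and a b :: 'r and d :: nat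
  assumes ab: "a < b" and c: "\<And>i. c i \<ge> 0"
    and sgn: "(\<forall>y. a < y \<and> y < b \<longrightarrow> 0 \<le> poly (pderiv F) y) \<or> (\<forall>y. a < y \<and> y < b \<longrightarrow> poly (pderiv F) y \<le> 0)"
    and cmp: "\<And>y. a < y \<Longrightarrow> y < b \<Longrightarrow>
      comparable N \<bar>poly (pderiv F) y\<bar> (\<Sum>i<d. c i * ratio a b e' y ^ k i)"
  shows "\<exists>M. \<forall>y. a < y \<and> y < b \<longrightarrow> comparable M \<bar>poly F y - poly F (endpoint a b e)\<bar>
     (\<Sum>i<d. c i * (b - a) * ratio a b e y ^ (if e' = e then Suc (k i) else 1))"
proof -
  have main: "\<exists>M. \<forall>y. a < y \<and> y < b \<longrightarrow> comparable M \<bar>poly F y - poly F (endpoint a b e)\<bar>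
     (\<Sum>i<d. c i * (b - a) * ratio a b e y ^ (if e' = e then Suc (k i) else 1))"
    if sgn: "\<forall>y. a < y \<and> y < b \<longrightarrow> 0 \<le> poly (pderiv F) y"
      and cmp: "\<And>y. a < y \<Longrightarrow> y < b \<Longrightarrow>
      comparable N \<bar>poly (pderiv F) y\<bar> (\<Sum>i<d. c i * ratio a b e' y ^ k i)" for F :: "'r poly"
  proof -
    define T where "T = (if e' then [:- a / (b - a), 1 / (b - a):] else [:b / (b - a), - 1 / (b - a):])"
    have T: "poly T y = ratio a b e' y" for y
      by (auto simp: T_def ratio_def diff_divide_distrib)
    \<comment> \<open>The ratio has derivative \<epsilon> / (b - a); this sign and the weights
      \<open>w i\<close> make the derivative of \<open>H\<close> the given sum.\<close>
    define \<epsilon> where "\<epsilon> = (if e' then 1 else - 1 :: 'r)"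
    have \<epsilon>: "\<epsilon> * \<epsilon> = 1" "\<bar>\<epsilon>\<bar> = 1" by (auto simp: \<epsilon>_def)
    have dT: "pderiv T = [:\<epsilon> / (b - a):]"
      by (auto simp: T_def \<epsilon>_def pderiv_pCons)
    define w where "w i = c i * (b - a) / of_nat (Suc (k i))" for i
    have w: "w i \<ge> 0" for i unfolding w_def using ab c by (intro divide_nonneg_nonneg mult_nonneg_nonneg) auto
    define H where "H = (\<Sum>i<d. smult (\<epsilon> * w i) (T ^ Suc (k i)))"
    have dH: "poly (pderiv H) y = (\<Sum>i<d. c i * ratio a b e' y ^ k i)" for y
    proof -
      have "poly (pderiv (smult (\<epsilon> * w i) (T ^ Suc (k i)))) y = c i * ratio a b e' y ^ k i" for i
      proof -
        have "poly (pderiv (smult (\<epsilon> * w i) (T ^ Suc (k i)))) y =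
           (\<epsilon> * \<epsilon>) * (w i * of_nat (Suc (k i)) / (b - a)) * ratio a b e' y ^ k i"
          unfolding pderiv_smult pderiv_power_Suc dT by (simp add: T algebra_simps del: of_nat_Suc)
        also have "w i * of_nat (Suc (k i)) / (b - a) = c i"
          using ab by (simp add: w_def del: of_nat_Suc)
        finally show ?thesis by (simp add: \<epsilon>)
      qed
      then show ?thesis by (simp add: H_def pderiv_sum poly_sum)
    qed
    have mono: "poly F u - poly F v \<le> of_nat N * (poly H u - poly H v) \<and>
        poly H u - poly H v \<le> of_nat N * (poly F u - poly F v) \<and>
        0 \<le> poly F u - poly F v \<and> 0 \<le> poly H u - poly H v"
      if uv: "a \<le> v" "v \<le> u" "u \<le> b" for u v
    proof -
      have in1: "poly (pderiv F) y \<le> of_nat N * poly (pderiv H) y"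
        and in2: "poly (pderiv H) y \<le> of_nat N * poly (pderiv F) y"
        and in3: "0 \<le> poly (pderiv F) y" "0 \<le> poly (pderiv H) y" if "v < y" "y < u" for y
      proof -
        have y: "a < y" "y < b" using that uv by auto
        show "0 \<le> poly (pderiv F) y" using sgn y by blast
        then show "poly (pderiv F) y \<le> of_nat N * poly (pderiv H) y"
          "poly (pderiv H) y \<le> of_nat N * poly (pderiv F) y" "0 \<le> poly (pderiv H) y"
          using cmp[OF y] by (auto simp: comparable_def dH)
      qed
      have "poly (smult (of_nat N) H - F) v \<le> poly (smult (of_nat N) H - F) u"
        using uv in1 by (intro poly_mono_rcf) (auto simp: pderiv_diff pderiv_smult)
      moreover have "poly (smult (of_nat N) F - H) v \<le> poly (smult (of_nat N) F - H) u"
        using uv in2 by (intro poly_mono_rcf) (auto simp: pderiv_diff pderiv_smult)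
      moreover have "poly F v \<le> poly F u" using uv in3 by (intro poly_mono_rcf) auto
      moreover have "poly H v \<le> poly H u" using uv in3 by (intro poly_mono_rcf) auto
      ultimately show ?thesis by (simp add: algebra_simps)
    qed
    have step1: "comparable N \<bar>poly F y - poly F (endpoint a b e)\<bar> \<bar>poly H y - poly H (endpoint a b e)\<bar>"
      if y: "a < y" "y < b" for y
    proof (cases e)
      case True
      then show ?thesis using mono[of a y] y by (simp add: comparable_def endpoint_def)
    next
      case False
      then show ?thesis using mono[of y b] y
        by (simp add: comparable_def endpoint_def abs_minus_commute[of "poly F y"] abs_minus_commute[of "poly H y"])
    qed
    \<comment> \<open>A common factor for all summands: \<open>K\<close> is at least
      \<open>Suc (k i)\<close> for every i.\<close>
    define K where "K = Suc (\<Sum>i<d. k i)"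
    have step2: "comparable K \<bar>poly H y - poly H (endpoint a b e)\<bar>
       (\<Sum>i<d. c i * (b - a) * ratio a b e y ^ (if e' = e then Suc (k i) else 1))" (is "comparable K ?A ?B")
      if y: "a < y" "y < b" for y
    proof -
      define t where "t = ratio a b e y"
      have t: "0 < t" "t < 1" "ratio a b (\<not> e) y = 1 - t"
        using ratio_bounds[OF ab y] by (auto simp: t_def)
      \<comment> \<open>Up to sign, the increment of a power of the ratio for \<open>e'\<close> from
        the end \<open>e\<close> to y; at that end the ratio is 0 if \<open>e' = e\<close> and 1
        otherwise.\<close>
      define Z where "Z i = (if e' = e then t ^ Suc (k i) else 1 - (1 - t) ^ Suc (k i))" for i
      have Z0: "Z i \<ge> 0" for i
      proof -
        have "(1 - t) ^ Suc (k i) \<le> 1" using t by (intro power_le_one) auto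
        then show ?thesis using t by (auto simp: Z_def)
      qed
      have "poly H y - poly H (endpoint a b e) =
         \<epsilon> * (\<Sum>i<d. w i * (ratio a b e' y ^ Suc (k i) - ratio a b e' (endpoint a b e) ^ Suc (k i)))"
        by (simp add: H_def poly_sum T sum_subtractf sum_distrib_left algebra_simps)
      also have "(\<Sum>i<d. w i * (ratio a b e' y ^ Suc (k i) - ratio a b e' (endpoint a b e) ^ Suc (k i))) =
         (if e' = e then 1 else - 1) * (\<Sum>i<d. w i * Z i)"
        unfolding sum_distrib_left
      proof (intro sum.cong refl)
        fix i
        show "w i * (ratio a b e' y ^ Suc (k i) - ratio a b e' (endpoint a b e) ^ Suc (k i)) =
            (if e' = e then 1 else - 1) * (w i * Z i)"
        proof (cases "e' = e")
          case True
          then show ?thesis by (simp add: ratio_endpoint[OF ab] Z_def t_def)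
        next
          case False
          then have "ratio a b e' y = 1 - t" using t(3) by (cases e; cases e') auto
          then show ?thesis using False by (simp add: ratio_endpoint[OF ab] Z_def t(3) right_diff_distrib del: power_Suc)
        qed
      qed
      finally have "?A = \<bar>\<Sum>i<d. w i * Z i\<bar>" using \<epsilon> by (auto simp: abs_mult)
      also have "\<dots> = (\<Sum>i<d. w i * Z i)"
        using w Z0 by (intro abs_of_nonneg sum_nonneg) auto
      also have "\<dots> = (\<Sum>i<d. (c i * (b - a)) * (Z i / of_nat (Suc (k i))))"
        by (simp add: w_def del: of_nat_Suc)
      finally have A: "?A = (\<Sum>i<d. (c i * (b - a)) * (Z i / of_nat (Suc (k i))))" .
      show ?thesis unfolding A
      proof (intro comparable_sum comparable_mult_left)
        fix i assume i: "i \<in> {..<d}"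
        show "0 \<le> c i * (b - a)" using c ab by auto
        have "comparable (Suc (k i)) (Z i / of_nat (Suc (k i))) (t ^ (if e' = e then Suc (k i) else 1))"
        proof (cases "e' = e")
          case True
          define z where "z = t ^ Suc (k i)"
          have z: "z \<ge> 0" using t by (auto simp: z_def)
          have "z * 1 \<le> z * (of_nat (Suc (k i)) * of_nat (Suc (k i)))"
          proof (rule mult_left_mono[OF _ z])
            have "1 * 1 \<le> of_nat (Suc (k i)) * (of_nat (Suc (k i)) :: 'r)"
              by (intro mult_mono) auto
            then show "1 \<le> of_nat (Suc (k i)) * (of_nat (Suc (k i)) :: 'r)" by simp
          qed
          then have "z \<le> z * of_nat (Suc (k i)) * of_nat (Suc (k i))" by (simp only: mult.assoc mult_1_right)
          then have "z / of_nat (Suc (k i)) \<le> of_nat (Suc (k i)) * z"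
            by (subst pos_divide_le_eq) (auto simp: ac_simps simp del: of_nat_Suc)
          then show ?thesis using True z t
            by (auto simp: comparable_def Z_def z_def[symmetric] simp del: power_Suc of_nat_Suc)
        next
          case False
          then show ?thesis using one_minus_power_bounds[of t "k i"] t by (auto simp: Z_def simp del: power_Suc of_nat_Suc)
        qed
        moreover have "Suc (k i) \<le> K"
          unfolding K_def using member_le_sum[of i "{..<d}" k] i by simp
        ultimately show "comparable K (Z i / of_nat (Suc (k i))) (ratio a b e y ^ (if e' = e then Suc (k i) else 1))"
          unfolding t_def[symmetric] by (rule comparable_mono)
      qed
    qed
    show ?thesis using comparable_trans[OF step1 step2] by blast
  qed
  show ?thesis using sgn
  proof
    assume "\<forall>y. a < y \<and> y < b \<longrightarrow> 0 \<le> poly (pderiv F) y"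
    then show ?thesis using main cmp by blast
  next
    assume "\<forall>y. a < y \<and> y < b \<longrightarrow> poly (pderiv F) y \<le> 0"
    then have "\<exists>M. \<forall>y. a < y \<and> y < b \<longrightarrow> comparable M \<bar>poly (- F) y - poly (- F) (endpoint a b e)\<bar>
     (\<Sum>i<d. c i * (b - a) * ratio a b e y ^ (if e' = e then Suc (k i) else 1))"
      using cmp by (intro main) (auto simp: pderiv_minus)
    moreover have "\<bar>poly (- F) y - poly (- F) z\<bar> = \<bar>poly F y - poly F z\<bar>" for y z
      by (simp add: abs_minus_commute)
    ultimately show ?thesis by simp
  qed
qed

text \<open>Here \<open>el i\<close> says that \<open>Q\<^sup>(\<^sup>i\<^sup>)\<close> is expanded from the left endpoint, and \<open>e\<close> that \<open>Q\<close> itself is.\<close>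

definition taylor_term ::
  "'r::real_closed_field poly \<Rightarrow> 'r \<Rightarrow> 'r \<Rightarrow> (nat \<Rightarrow> bool) \<Rightarrow> bool \<Rightarrow> 'r \<Rightarrow> nat \<Rightarrow> 'r" where
  "taylor_term Q a b el e y i =
     \<bar>poly ((pderiv ^^ i) Q) (endpoint a b (el i))\<bar> * (b - a) ^ i * ratio a b e y ^ torder el e i"

lemma funpow_pderiv_shift: "(pderiv ^^ i) (pderiv Q) = (pderiv ^^ Suc i) Q"
  by (simp only: funpow_Suc_right comp_apply)

lemma isgn_const_on_interval:
  fixes Q :: "'r::real_closed_field poly"
  assumes "\<And>y. a < y \<Longrightarrow> y < b \<Longrightarrow> poly Q y \<noteq> 0" "a < y" "y < b" "a < z" "z < b"
  shows "isgn (poly Q y) = isgn (poly Q z)"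
  using assms by (intro isgn_poly_const) (auto simp: min_def max_def split: if_splits)

text \<open>The induction step of the Taylor formula: Q' is expanded from the end
  \<open>el 1\<close>, while the increment of Q may be taken from either end \<open>e\<close>; the
  exponents change as in \<open>torder_Suc\<close>.\<close>

lemma taylor_integrate:
  fixes Q :: "'r::real_closed_field poly" and a b :: 'r
  assumes ab: "a < b" and nz: "\<And>y. a < y \<Longrightarrow> y < b \<Longrightarrow> poly (pderiv Q) y \<noteq> 0"
    and N: "\<And>y. a < y \<Longrightarrow> y < b \<Longrightarrow> comparable N \<bar>poly (pderiv Q) y\<bar>
      (\<Sum>i<Suc d. taylor_term (pderiv Q) a b (\<lambda>i. el (Suc i)) (el 1) y i)"
  shows "\<exists>N. \<forall>y. a < y \<and> y < b \<longrightarrow> comparable N \<bar>poly Q y - poly Q (endpoint a b e)\<bar>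
      (\<Sum>i<Suc d. taylor_term Q a b el e y (Suc i))"
proof -
  define el' where "el' i = el (Suc i)" for i
  obtain m where m: "a < m" "m < b" using dense ab by blast
  define c where "c i = \<bar>poly ((pderiv ^^ Suc i) Q) (endpoint a b (el (Suc i)))\<bar> * (b - a) ^ i" for i
  have c0: "c i \<ge> 0" for i using ab by (simp add: c_def)
  have sc: "isgn (poly (pderiv Q) y) = isgn (poly (pderiv Q) m)" if "a < y" "y < b" for y
    using isgn_const_on_interval[of a b "pderiv Q", OF nz that m] .
  have sgn: "(\<forall>y. a < y \<and> y < b \<longrightarrow> 0 \<le> poly (pderiv Q) y) \<or> (\<forall>y. a < y \<and> y < b \<longrightarrow> poly (pderiv Q) y \<le> 0)"
  proof (cases "poly (pderiv Q) m > 0")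
    case True
    then have "0 \<le> poly (pderiv Q) y" if "a < y" "y < b" for y
      using sc[OF that] by (metis isgn_simps(5) less_imp_le)
    then show ?thesis by blast
  next
    case False
    then have "poly (pderiv Q) m < 0" using nz[OF m] by auto
    then have "poly (pderiv Q) y \<le> 0" if "a < y" "y < b" for y
      using sc[OF that] by (metis isgn_simps(6) less_imp_le)
    then show ?thesis by blast
  qed
  have tt: "taylor_term (pderiv Q) a b (\<lambda>i. el (Suc i)) (el 1) y i = c i * ratio a b (el 1) y ^ torder el' (el 1) i" for y i
    unfolding taylor_term_def funpow_pderiv_shift c_def el'_def by simp
  have "\<exists>M. \<forall>y. a < y \<and> y < b \<longrightarrow> comparable M \<bar>poly Q y - poly Q (endpoint a b e)\<bar>
     (\<Sum>i<Suc d. c i * (b - a) * ratio a b e y ^ (if el 1 = e then Suc (torder el' (el 1) i) else 1))"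
    using N unfolding tt by (intro integrate_comparable[OF ab c0 sgn]) auto
  moreover have "c i * (b - a) * ratio a b e y ^ (if el 1 = e then Suc (torder el' (el 1) i) else 1) =
     taylor_term Q a b el e y (Suc i)" for y i
    unfolding taylor_term_def torder_Suc c_def el'_def by auto
  ultimately show ?thesis by simp
qed

text \<open>Induction on the degree, with \<open>el\<close> shifted for the derivative. The end
  \<open>el 0\<close> is the one from which |Q| grows towards the interior, so the value of Q there
  and the increment up to y never have opposite signs, and |Q(y)| is the sum of their absolute
  values. The increment comes from integrating the formula for Q'.\<close>

lemma taylor_comparable:
  fixes Q :: "'r::real_closed_field poly" and a b :: 'r
  assumes "a < b"
    and "\<And>i y. i \<le> degree Q \<Longrightarrow> a < y \<Longrightarrow> y < b \<Longrightarrow> poly ((pderiv ^^ i) Q) y \<noteq> 0"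
    and "\<And>i y. i < degree Q \<Longrightarrow> a < y \<Longrightarrow> y < b \<Longrightarrow>
      el i \<longleftrightarrow> 0 \<le> isgn (poly ((pderiv ^^ i) Q) y) * isgn (poly ((pderiv ^^ Suc i) Q) y)"
  shows "\<exists>N. \<forall>y. a < y \<and> y < b \<longrightarrow>
      comparable N \<bar>poly Q y\<bar> (\<Sum>i<Suc (degree Q). taylor_term Q a b el (el 0) y i)"
  using assms(2,3)
proof (induction "degree Q" arbitrary: Q el)
  case 0
  then obtain c where "Q = [:c:]" by (metis degree_eq_zeroE)
  then show ?case
    by (auto simp: taylor_term_def comparable_def intro!: exI[of _ 1])
next
  case (Suc d)
  note ab = assms(1)
  have d: "d = degree (pderiv Q)" using Suc.hyps(2) by (simp add: degree_pderiv)
  note D = funpow_pderiv_shift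
  have nz: "poly Q y \<noteq> 0" "poly (pderiv Q) y \<noteq> 0" if "a < y" "y < b" for y
    using Suc.prems(1)[of 0 y] Suc.prems(1)[of 1 y] that Suc.hyps(2) by auto
  have sc: "isgn (poly (pderiv Q) y) = isgn (poly (pderiv Q) z)"
    if "a < y" "y < b" "a < z" "z < b" for y z
    using isgn_const_on_interval[of a b "pderiv Q", OF nz(2) that] .
  have "\<exists>N. \<forall>y. a < y \<and> y < b \<longrightarrow> comparable N \<bar>poly (pderiv Q) y\<bar>
      (\<Sum>i<Suc d. taylor_term (pderiv Q) a b (\<lambda>i. el (Suc i)) (el (Suc 0)) y i)"
  proof -
    have "poly ((pderiv ^^ i) (pderiv Q)) y \<noteq> 0" if "i \<le> degree (pderiv Q)" "a < y" "y < b" for i y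
      unfolding D using that Suc.hyps(2) d by (intro Suc.prems(1)) auto
    moreover have "el (Suc i) \<longleftrightarrow> 0 \<le> isgn (poly ((pderiv ^^ i) (pderiv Q)) y) * isgn (poly ((pderiv ^^ Suc i) (pderiv Q)) y)"
      if "i < degree (pderiv Q)" "a < y" "y < b" for i y
      unfolding D using that Suc.hyps(2) d by (intro Suc.prems(2)) auto
    ultimately show ?thesis
      using Suc.hyps(1)[OF d, of "\<lambda>i. el (Suc i)"] unfolding d by blast
  qed
  then obtain N where N: "comparable N \<bar>poly (pderiv Q) y\<bar>
      (\<Sum>i<Suc d. taylor_term (pderiv Q) a b (\<lambda>i. el (Suc i)) (el 1) y i)" if "a < y" "y < b" for y
    by auto
  define e where "e = el 0"
  obtain M where M: "comparable M \<bar>poly Q y - poly Q (endpoint a b e)\<bar>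
    (\<Sum>i<Suc d. taylor_term Q a b el e y (Suc i))" if "a < y" "y < b" for y
    using taylor_integrate[OF ab nz(2) N] by blast
  have "comparable (Suc M) \<bar>poly Q y\<bar> (\<Sum>i<Suc (Suc d). taylor_term Q a b el e y i)"
    if y: "a < y" "y < b" for y
  proof -
    have e: "e \<longleftrightarrow> 0 \<le> isgn (poly Q y) * isgn (poly (pderiv Q) y)"
      using Suc.prems(2)[of 0 y] y Suc.hyps(2) unfolding e_def by simp
    have "isgn (poly Q (endpoint a b e)) = 0 \<or> isgn (poly Q (endpoint a b e)) = isgn (poly Q y)"
      using y nz by (intro isgn_poly_endpoint) (auto simp: endpoint_def min_def max_def split: if_splits)
    moreover have "isgn (poly Q y - poly Q (endpoint a b e)) = isgn (poly Q y)"
    proof (cases e)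
      case True
      obtain z where z: "a < z" "z < y" "poly Q y - poly Q a = (y - a) * poly (pderiv Q) z"
        using poly_MVT_rcf[OF y(1)] by blast
      then have "isgn (poly Q y - poly Q a) = isgn (poly (pderiv Q) y)"
        using sc[of z y] y by (simp add: isgn_mult)
      then show ?thesis using True e nz[OF y]
        by (auto simp: endpoint_def isgn_def zero_le_mult_iff split: if_splits)
    next
      case False
      obtain z where z: "y < z" "z < b" "poly Q b - poly Q y = (b - y) * poly (pderiv Q) z"
        using poly_MVT_rcf[OF y(2)] by blast
      then have "isgn (poly Q b - poly Q y) = isgn (poly (pderiv Q) y)"
        using sc[of z y] y by (simp add: isgn_mult)
      moreover have "isgn (poly Q y - poly Q b) = - isgn (poly Q b - poly Q y)"
        using isgn_minus[of "poly Q b - poly Q y"] by simp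
      ultimately show ?thesis using False e nz[OF y]
        by (auto simp: endpoint_def isgn_def split: if_splits)
    qed
    ultimately have "\<bar>poly Q y\<bar> = \<bar>poly Q (endpoint a b e)\<bar> + \<bar>poly Q y - poly Q (endpoint a b e)\<bar>"
      by (auto simp: isgn_def split: if_splits)
    moreover have "comparable (Suc M) (\<bar>poly Q (endpoint a b e)\<bar> + \<bar>poly Q y - poly Q (endpoint a b e)\<bar>)
       (taylor_term Q a b el e y 0 + (\<Sum>i<Suc d. taylor_term Q a b el e y (Suc i)))"
    proof (rule comparable_add)
      have "taylor_term Q a b el e y 0 = \<bar>poly Q (endpoint a b e)\<bar>"
        by (simp add: taylor_term_def e_def)
      then show "comparable (Suc M) \<bar>poly Q (endpoint a b e)\<bar> (taylor_term Q a b el e y 0)"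
        using comparable_mono[OF comparable_refl, of "\<bar>poly Q (endpoint a b e)\<bar>" "Suc M"] by simp
      show "comparable (Suc M) \<bar>poly Q y - poly Q (endpoint a b e)\<bar> (\<Sum>i<Suc d. taylor_term Q a b el e y (Suc i))"
        using M[OF y] by (rule comparable_mono) simp
    qed
    ultimately show ?thesis by (simp only: sum.lessThan_Suc_shift)
  qed
  then show ?case unfolding e_def Suc.hyps(2)[symmetric] by blast
qed

text \<open>The version for the polynomial that is being added: its derivatives have constant signs
  on the interval, but the polynomial itself may have a root there, so only its increment is
  expanded.\<close>

lemma taylor_difference_comparable:
  fixes Q :: "'r::real_closed_field poly" and a b :: 'r
  assumes ab: "a < b"
    and nz: "\<And>i y. i < degree Q \<Longrightarrow> a < y \<Longrightarrow> y < b \<Longrightarrow> poly ((pderiv ^^ Suc i) Q) y \<noteq> 0"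
    and el: "\<And>i y. Suc i < degree Q \<Longrightarrow> a < y \<Longrightarrow> y < b \<Longrightarrow>
      el (Suc i) \<longleftrightarrow> 0 \<le> isgn (poly ((pderiv ^^ Suc i) Q) y) * isgn (poly ((pderiv ^^ Suc (Suc i)) Q) y)"
  shows "\<exists>N. \<forall>y. a < y \<and> y < b \<longrightarrow> comparable N \<bar>poly Q y - poly Q (endpoint a b e)\<bar>
      (\<Sum>i<degree Q. taylor_term Q a b el e y (Suc i))"
proof (cases "degree Q")
  case 0
  then obtain c where "Q = [:c:]" by (metis degree_eq_zeroE)
  then show ?thesis by (auto simp: comparable_def)
next
  case (Suc d)
  then have d: "degree (pderiv Q) = d" by (simp add: degree_pderiv)
  have "\<exists>N. \<forall>y. a < y \<and> y < b \<longrightarrow> comparable N \<bar>poly (pderiv Q) y\<bar>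
      (\<Sum>i<Suc (degree (pderiv Q)). taylor_term (pderiv Q) a b (\<lambda>i. el (Suc i)) (el (Suc 0)) y i)"
    using ab by (rule taylor_comparable) (use nz el d Suc in \<open>auto simp only: funpow_pderiv_shift Suc_less_eq less_Suc_eq_le\<close>)
  then obtain N where N: "comparable N \<bar>poly (pderiv Q) y\<bar>
      (\<Sum>i<Suc d. taylor_term (pderiv Q) a b (\<lambda>i. el (Suc i)) (el 1) y i)" if "a < y" "y < b" for y
    unfolding d by auto
  have "poly (pderiv Q) y \<noteq> 0" if "a < y" "y < b" for y
    using nz[of 0 y] that Suc by simp
  then show ?thesis unfolding Suc using taylor_integrate[OF ab _ N] by blast
qed

section \<open>Unbounded intervals and the ordinary Taylor formula\<close>

lemma degree_funpow_pderiv: "degree ((pderiv ^^ i) Q) = degree Q - i"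
  for Q :: "'a::field_char_0 poly"
  by (induction i) (auto simp: degree_pderiv)

lemma isgn_lead_coeff_pderiv:
  fixes Q :: "'r::linordered_field poly"
  assumes "degree Q > 0"
  shows "isgn (lead_coeff (pderiv Q)) = isgn (lead_coeff Q)"
proof -
  have "lead_coeff (pderiv Q) = of_nat (degree Q) * lead_coeff Q"
    using assms by (simp add: degree_pderiv coeff_pderiv)
  then show ?thesis using assms by (simp add: isgn_mult)
qed

text \<open>Near plus infinity a polynomial and its derivative both have the sign of the leading
  coefficient, so on a right ray every derivative is expanded from the finite end.\<close>

lemma ray_right_signs:
  fixes Q :: "'r::real_closed_field poly"
  assumes "Suc i \<le> degree Q" "\<And>y. c < y \<Longrightarrow> poly ((pderiv ^^ i) Q) y \<noteq> 0"
    "\<And>y. c < y \<Longrightarrow> poly ((pderiv ^^ Suc i) Q) y \<noteq> 0" "c < z"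
  shows "0 \<le> isgn (poly ((pderiv ^^ i) Q) z) * isgn (poly ((pderiv ^^ Suc i) Q) z)"
proof -
  define R where "R = (pderiv ^^ i) Q"
  have R: "degree R > 0" using assms(1) by (simp add: R_def degree_funpow_pderiv)
  have "isgn (poly R z) = isgn (lead_coeff R)"
    using assms R unfolding R_def by (intro isgn_poly_at_top) auto
  moreover have "isgn (poly (pderiv R) z) = isgn (lead_coeff (pderiv R))"
    using assms R unfolding R_def by (intro isgn_poly_at_top) (auto simp: pderiv_eq_0_iff)
  ultimately show ?thesis using isgn_lead_coeff_pderiv[OF R] unfolding R_def by simp
qed

text \<open>Near minus infinity the sign carries a factor (-1)^degree, which flips with each
  derivative; again the expansion starts at the finite end, now the right one.\<close>

lemma ray_left_signs:
  fixes Q :: "'r::real_closed_field poly"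
  assumes "Suc i \<le> degree Q" "\<And>y. y < c \<Longrightarrow> poly ((pderiv ^^ i) Q) y \<noteq> 0"
    "\<And>y. y < c \<Longrightarrow> poly ((pderiv ^^ Suc i) Q) y \<noteq> 0" "z < c"
  shows "\<not> 0 \<le> isgn (poly ((pderiv ^^ i) Q) z) * isgn (poly ((pderiv ^^ Suc i) Q) z)"
proof -
  define R where "R = (pderiv ^^ i) Q"
  have R: "degree R > 0" using assms(1) by (simp add: R_def degree_funpow_pderiv)
  then have R0: "R \<noteq> 0" by auto
  have 1: "isgn (poly R z) = (- 1) ^ degree R * isgn (lead_coeff R)"
    using assms R0 unfolding R_def by (intro isgn_poly_at_bot) auto
  have 2: "isgn (poly (pderiv R) z) = (- 1) ^ degree (pderiv R) * isgn (lead_coeff (pderiv R))"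
    using assms R unfolding R_def by (intro isgn_poly_at_bot) (auto simp: pderiv_eq_0_iff)
  obtain m where m: "degree R = Suc m" using R by (cases "degree R") auto
  then have m': "degree (pderiv R) = m" by (simp add: degree_pderiv)
  have "isgn (lead_coeff R) * isgn (lead_coeff R) = 1"
    using R0 by (simp add: isgn_def)
  moreover have "((- 1) ^ m * (- 1) ^ m :: int) = 1" by (simp add: power_mult_distrib[symmetric])
  moreover have "isgn (poly R z) * isgn (poly (pderiv R) z) =
    - (((- 1) ^ m * (- 1) ^ m) * (isgn (lead_coeff R) * isgn (lead_coeff R)))"
    unfolding 1 2 isgn_lead_coeff_pderiv[OF R] unfolding m m' by (simp add: ac_simps)
  ultimately have "isgn (poly R z) * isgn (poly (pderiv R) z) = - 1" by simp
  then show ?thesis unfolding R_def by simp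
qed

text \<open>Cutting the ray at y + 1 makes the bounded formula applicable. All expansions start at
  c, so the exponent of the i-th term is i, and the length of the cut interval cancels against the
  denominator of the ratio.\<close>

lemma taylor_ray_right:
  fixes Q :: "'r::real_closed_field poly"
  assumes nz: "\<And>i y. i < degree Q \<Longrightarrow> c < y \<Longrightarrow> poly ((pderiv ^^ Suc i) Q) y \<noteq> 0" and y: "c < y"
  shows "\<exists>N. comparable N \<bar>poly Q y - poly Q c\<bar>
      (\<Sum>i<degree Q. \<bar>poly ((pderiv ^^ Suc i) Q) c\<bar> * (y - c) ^ Suc i)"
    and "(\<And>y. c < y \<Longrightarrow> poly Q y \<noteq> 0) \<Longrightarrow>
      \<exists>N. comparable N \<bar>poly Q y\<bar> (\<Sum>i<Suc (degree Q). \<bar>poly ((pderiv ^^ i) Q) c\<bar> * (y - c) ^ i)"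
proof -
  define b where "b = y + 1"
  have b: "c < b" "y < b" using y by (auto simp: b_def)
  have tt: "taylor_term Q c b (\<lambda>_. True) True y i = \<bar>poly ((pderiv ^^ i) Q) c\<bar> * (y - c) ^ i" for i
    using b by (simp add: taylor_term_def endpoint_def ratio_def torder_const power_divide)
  have e: "endpoint c b True = c" by (simp add: endpoint_def)
  have "\<exists>N. \<forall>y. c < y \<and> y < b \<longrightarrow> comparable N \<bar>poly Q y - poly Q (endpoint c b True)\<bar>
      (\<Sum>i<degree Q. taylor_term Q c b (\<lambda>_. True) True y (Suc i))"
    by (rule taylor_difference_comparable[OF b(1)], rule nz)
      (use ray_right_signs[OF _ nz nz] in simp_all)
  then show "\<exists>N. comparable N \<bar>poly Q y - poly Q c\<bar>
      (\<Sum>i<degree Q. \<bar>poly ((pderiv ^^ Suc i) Q) c\<bar> * (y - c) ^ Suc i)"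
    using b y unfolding tt[symmetric] e by blast
  assume "\<And>y. c < y \<Longrightarrow> poly Q y \<noteq> 0"
  then have nz': "poly ((pderiv ^^ i) Q) y \<noteq> 0" if "i \<le> degree Q" "c < y" for i y
    using nz[of "i - 1" y] that by (cases i) auto
  have "\<exists>N. \<forall>y. c < y \<and> y < b \<longrightarrow> comparable N \<bar>poly Q y\<bar>
      (\<Sum>i<Suc (degree Q). taylor_term Q c b (\<lambda>_. True) True y i)"
    by (rule taylor_comparable[OF b(1)], rule nz')
      (use ray_right_signs[OF _ nz' nz'] in simp_all)
  then show "\<exists>N. comparable N \<bar>poly Q y\<bar> (\<Sum>i<Suc (degree Q). \<bar>poly ((pderiv ^^ i) Q) c\<bar> * (y - c) ^ i)"
    using b y unfolding tt[symmetric] by blast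
qed

lemma taylor_ray_left:
  fixes Q :: "'r::real_closed_field poly"
  assumes nz: "\<And>i y. i < degree Q \<Longrightarrow> y < c \<Longrightarrow> poly ((pderiv ^^ Suc i) Q) y \<noteq> 0" and y: "y < c"
  shows "\<exists>N. comparable N \<bar>poly Q y - poly Q c\<bar>
      (\<Sum>i<degree Q. \<bar>poly ((pderiv ^^ Suc i) Q) c\<bar> * (c - y) ^ Suc i)"
    and "(\<And>y. y < c \<Longrightarrow> poly Q y \<noteq> 0) \<Longrightarrow>
      \<exists>N. comparable N \<bar>poly Q y\<bar> (\<Sum>i<Suc (degree Q). \<bar>poly ((pderiv ^^ i) Q) c\<bar> * (c - y) ^ i)"
proof -
  define a where "a = y - 1"
  have a: "a < c" "a < y" using y by (auto simp: a_def)
  have tt: "taylor_term Q a c (\<lambda>_. False) False y i = \<bar>poly ((pderiv ^^ i) Q) c\<bar> * (c - y) ^ i" for i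
    using a by (simp add: taylor_term_def endpoint_def ratio_def torder_const power_divide)
  have e: "endpoint a c False = c" by (simp add: endpoint_def)
  have "\<exists>N. \<forall>y. a < y \<and> y < c \<longrightarrow> comparable N \<bar>poly Q y - poly Q (endpoint a c False)\<bar>
      (\<Sum>i<degree Q. taylor_term Q a c (\<lambda>_. False) False y (Suc i))"
    by (rule taylor_difference_comparable[OF a(1)], rule nz)
      (use ray_left_signs[OF _ nz nz] in simp_all)
  then show "\<exists>N. comparable N \<bar>poly Q y - poly Q c\<bar>
      (\<Sum>i<degree Q. \<bar>poly ((pderiv ^^ Suc i) Q) c\<bar> * (c - y) ^ Suc i)"
    using a y unfolding tt[symmetric] e by blast
  assume "\<And>y. y < c \<Longrightarrow> poly Q y \<noteq> 0"
  then have nz': "poly ((pderiv ^^ i) Q) y \<noteq> 0" if "i \<le> degree Q" "y < c" for i y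
    using nz[of "i - 1" y] that by (cases i) auto
  have "\<exists>N. \<forall>y. a < y \<and> y < c \<longrightarrow> comparable N \<bar>poly Q y\<bar>
      (\<Sum>i<Suc (degree Q). taylor_term Q a c (\<lambda>_. False) False y i)"
    by (rule taylor_comparable[OF a(1)], rule nz')
      (use ray_left_signs[OF _ nz' nz'] in simp_all)
  then show "\<exists>N. comparable N \<bar>poly Q y\<bar> (\<Sum>i<Suc (degree Q). \<bar>poly ((pderiv ^^ i) Q) c\<bar> * (c - y) ^ i)"
    using a y unfolding tt[symmetric] by blast
qed

section \<open>Convex valuations and semilinear terms\<close>

abbreviation nmult :: "nat \<Rightarrow> 'g::linordered_ab_group_add \<Rightarrow> 'g" where
  "nmult n g \<equiv> (\<Sum>i<n. g)"

lemma nmult_diff: "nmult n (g - h) = nmult n g - nmult n h"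
  by (rule sum_subtractf)

lemma nmult_strict_mono: "0 < n \<Longrightarrow> g < h \<Longrightarrow> nmult n g < nmult n h"
  by (rule sum_strict_mono) auto

lemma nmult_le_iff: "0 < n \<Longrightarrow> nmult n g \<le> nmult n h \<longleftrightarrow> g \<le> h"
  using nmult_strict_mono[of n g h] nmult_strict_mono[of n h g]
  by (cases g h rule: linorder_cases) (auto simp: not_le)

lemma nmult_eq_iff: "0 < n \<Longrightarrow> nmult n g = nmult n h \<longleftrightarrow> g = h"
  using nmult_strict_mono[of n g h] nmult_strict_mono[of n h g]
  by (cases g h rule: linorder_cases) auto

lemma int_mult_1: "int_mult 1 g = g"
  by (simp add: int_mult_def)

lemma rat_mult_of_nat: "rat_mult (of_nat n) (g :: 'g::linordered_ab_group_add) = nmult n g"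
proof -
  have "quotient_of (of_nat n) = (int n, 1)" using quotient_of_int[of "int n"] by simp
  then show ?thesis by (simp add: rat_mult_def int_mult_1) (simp add: int_mult_def)
qed

lemma rat_mult_minus_of_nat: "rat_mult (- of_nat n) (g :: 'g::linordered_ab_group_add) = - nmult n g"
proof -
  have "quotient_of (- of_nat n) = (- int n, 1)"
    using quotient_of_int[of "int n"] by (simp add: rat_uminus_code)
  then show ?thesis by (simp add: rat_mult_def int_mult_1) (simp add: int_mult_def)
qed

lemma rat_mult_1: "rat_mult 1 (g :: 'g::linordered_ab_group_add) = g"
  using rat_mult_of_nat[of 1 g] by simp

lemma quotient_of_inverse_nat: "0 < k \<Longrightarrow> quotient_of (1 / of_nat k) = (1, int k)"
proof -
  assume k: "0 < k"
  have "quotient_of (of_nat k) = (int k, 1)" using quotient_of_int[of "int k"] by simp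
  then show ?thesis using k by (simp add: inverse_eq_divide[symmetric] rat_inverse_code sgn_if)
qed

text \<open>Exhibiting a k-th part h gives the \<open>THE\<close> in \<open>rat_mult\<close> a
  witness; it is unique because an ordered group is torsion-free.\<close>

lemma rat_mult_inverse_nat:
  assumes "0 < k" "nmult k h = (g :: 'g::linordered_ab_group_add)"
  shows "rat_mult (1 / of_nat k) g = h" "rat_mult (- (1 / of_nat k)) g = - h"
proof -
  have 1: "int_mult (int k) x = nmult k x" for x :: 'g by (simp add: int_mult_def)
  have 2: "int_mult (- 1) x = - x" for x :: 'g by (simp add: int_mult_def)
  show "rat_mult (1 / of_nat k) g = h"
    unfolding rat_mult_def quotient_of_inverse_nat[OF assms(1)]
    by (rule the_equality) (auto simp: 1 int_mult_1 assms nmult_eq_iff simp flip: assms(2))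
  have "quotient_of (- (1 / of_nat k)) = (- 1, int k)"
    unfolding rat_uminus_code quotient_of_inverse_nat[OF assms(1)] by simp
  moreover have "nmult k x = - g \<Longrightarrow> x = - h" for x
    using assms nmult_eq_iff[of k x "- h"] by (simp add: sum_negf)
  ultimately show "rat_mult (- (1 / of_nat k)) g = - h"
    unfolding rat_mult_def using assms
    by (intro the_equality) (auto simp: 1 2 sum_negf)
qed

section \<open>A convex valuation on a real closed field\<close>

locale convex_valuation =
  fixes v :: "'r::real_closed_field \<Rightarrow> 'g::linordered_ab_group_add option" and V P :: "'r set"
  assumes valuation: "valuation_of_ring v V" and convex: "ordered_valued_field UNIV V P"
begin

text \<open>At 0 this is \<open>the None\<close>, hence the hypotheses that elements are nonzero
  below.\<close>

definition val :: "'r \<Rightarrow> 'g" where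
  "val x = the (v x)"

lemma v_eq_None_iff: "v x = None \<longleftrightarrow> x = 0"
  using valuation by (auto simp: valuation_of_ring_def)

lemma v_eq_Some: "x \<noteq> 0 \<Longrightarrow> v x = Some (val x)"
  using v_eq_None_iff[of x] by (auto simp: val_def)

lemma val_mult: "x \<noteq> 0 \<Longrightarrow> y \<noteq> 0 \<Longrightarrow> val (x * y) = val x + val y"
proof -
  assume "x \<noteq> 0" "y \<noteq> 0"
  then have "v (x * y) = Some (val x + val y)"
    using valuation v_eq_Some[of x] v_eq_Some[of y] by (auto simp: valuation_of_ring_def)
  then show ?thesis by (simp add: val_def)
qed

lemma val_1: "val 1 = 0"
  using val_mult[of 1 1] by simp

lemma val_minus: "val (- x) = val x"
proof (cases "x = 0")
  case False
  have "val (- 1) + val (- 1) = 0" using val_mult[of "- 1" "- 1"] val_1 by simp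
  then have "val (- 1) = 0" by simp
  then show ?thesis using False val_mult[of "- 1" x] by simp
qed simp

lemma val_abs: "val \<bar>x\<bar> = val x"
  by (simp add: abs_if val_minus)

lemma in_ring_iff: "x \<in> V \<longleftrightarrow> x = 0 \<or> 0 \<le> val x"
proof -
  have "x \<in> V \<longleftrightarrow> (\<forall>a. v x = Some a \<longrightarrow> 0 \<le> a)"
    using valuation by (auto simp: valuation_of_ring_def)
  then show ?thesis using v_eq_Some[of x] v_eq_None_iff[of x] by auto
qed

lemma val_divide: "x \<noteq> 0 \<Longrightarrow> y \<noteq> 0 \<Longrightarrow> val (x / y) = val x - val y"
  using val_mult[of "x / y" y] by (simp add: algebra_simps)

text \<open>Convexity applied to x / y + (1 - x / y) = 1 puts x / y into the valuation ring.\<close>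

lemma val_antimono:
  assumes "0 < x" "x \<le> y"
  shows "val y \<le> val x"
proof -
  have "1 \<in> V" using convex by (auto simp: ordered_valued_field_def)
  moreover have "x / y + (1 - x / y) = 1" by simp
  moreover have "0 \<le> x / y" "0 \<le> 1 - x / y" using assms by auto
  ultimately have "x / y \<in> V"
    using convex unfolding ordered_valued_field_def by (metis (no_types, lifting) UNIV_I mem_Collect_eq)
  then show ?thesis using assms by (auto simp: in_ring_iff val_divide)
qed

lemma val_of_nat: "0 < n \<Longrightarrow> val (of_nat n) = 0"
proof (rule antisym)
  assume n: "0 < n"
  then have "(1::'r) \<le> of_nat n" by (metis Suc_leI of_nat_1 of_nat_le_iff One_nat_def)
  then show "val (of_nat n) \<le> 0" using val_antimono[of 1 "of_nat n"] val_1 by simp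
  have "of_nat m \<in> V" for m
  proof (induction m)
    case 0
    then show ?case by (simp add: in_ring_iff)
  next
    case (Suc m)
    moreover have "1 \<in> V" "\<And>x y. x \<in> V \<Longrightarrow> y \<in> V \<Longrightarrow> x + y \<in> V"
      using convex unfolding ordered_valued_field_def by blast+
    ultimately show ?case by simp
  qed
  then have "of_nat n \<in> V" .
  then show "0 \<le> val (of_nat n)" using n by (simp add: in_ring_iff)
qed

lemma val_power: "x \<noteq> 0 \<Longrightarrow> val (x ^ n) = nmult n (val x)"
  by (induction n) (simp_all add: val_1 val_mult add.commute)

text \<open>Positive elements cannot cancel: x + y dominates both summands, which turns the
  ultrametric inequality into an equality.\<close>

lemma val_add:
  assumes "0 < x" "0 < y"
  shows "val (x + y) = min (val x) (val y)"
proof (rule antisym)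
  show "val (x + y) \<le> min (val x) (val y)"
    using assms val_antimono[of x "x + y"] val_antimono[of y "x + y"] by simp
  have "x + y \<noteq> 0" using assms by simp
  then show "min (val x) (val y) \<le> val (x + y)"
    using valuation assms v_eq_Some[of x] v_eq_Some[of y] v_eq_Some[of "x + y"]
    by (force simp: valuation_of_ring_def)
qed

text \<open>The purpose of \<open>comparable\<close>: a positive natural number N is a unit of the
  valuation ring, so mutual bounds up to N force equal valuations.\<close>

lemma val_comparable:
  assumes "comparable N x y" "x \<noteq> 0"
  shows "y \<noteq> 0 \<and> val x = val y"
proof -
  have pos: "x > 0" using assms by (auto simp: comparable_def)
  then have "of_nat N * y > 0" using assms by (auto simp: comparable_def)
  then have y: "y > 0" "N > 0" using assms(1) by (auto simp: comparable_def zero_less_mult_iff)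
  have "val (of_nat N * z) = val z" if "z > 0" for z
    using that y val_of_nat[of N] val_mult[of "of_nat N" z] by simp
  then show ?thesis
    using val_antimono[of x "of_nat N * y"] val_antimono[of y "of_nat N * x"] assms pos y
    by (auto simp: comparable_def)
qed

lemma nmult_divisible: "x \<noteq> 0 \<Longrightarrow> 0 < k \<Longrightarrow> \<exists>h. nmult k h = val x"
  using pos_root_exists[of "\<bar>x\<bar>" k] val_power val_abs by (metis zero_less_abs_iff less_irrefl)

lemma val_sum_list:
  assumes "\<And>x. x \<in> set xs \<Longrightarrow> 0 \<le> x" "sum_list xs \<noteq> 0"
  shows "\<exists>x\<in>set xs. x \<noteq> 0 \<and> val x = val (sum_list xs)"
  using assms
proof (induction xs)
  case (Cons x xs)
  have x: "0 \<le> x" "0 \<le> sum_list xs" using Cons.prems by (auto intro: sum_list_nonneg)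
  show ?case
  proof (cases "x = 0 \<or> sum_list xs = 0")
    case True
    then show ?thesis using Cons by auto
  next
    case False
    then have "val (x + sum_list xs) = min (val x) (val (sum_list xs))"
      using x by (intro val_add) auto
    then show ?thesis using False Cons by (auto simp: min_def)
  qed
qed simp

lemma val_le_summand:
  assumes "\<And>x. x \<in> set xs \<Longrightarrow> 0 \<le> x" "x \<in> set xs" "x \<noteq> 0"
  shows "val (sum_list xs) \<le> val x"
proof (rule val_antimono)
  show "0 < x" using assms(1)[OF assms(2)] assms(3) by simp
  show "x \<le> sum_list xs" using assms by (intro member_le_sum_list) auto
qed

end

section \<open>Terms that represent valuations\<close>

locale valuation_terms = convex_valuation v V P
  for v :: "'r::real_closed_field \<Rightarrow> 'g::linordered_ab_group_add option" and V P :: "'r set" +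
  fixes env :: "'c \<Rightarrow> 'g" and A :: "'c set"
begin

text \<open>The condition on the variables is carried along so that the correctness of the terms and
  the bound on their variables come out of the same induction.\<close>

definition val_rep :: "'c qterm option \<Rightarrow> 'r \<Rightarrow> bool" where
  "val_rep t x \<longleftrightarrow> (case t of None \<Rightarrow> x = 0
     | Some s \<Rightarrow> x \<noteq> 0 \<and> set_qterm s \<subseteq> A \<and> qeval env s = val x)"

lemma val_rep_None [simp]: "val_rep None x \<longleftrightarrow> x = 0"
  by (simp add: val_rep_def)

lemma val_rep_Some: "val_rep (Some s) x \<longleftrightarrow> x \<noteq> 0 \<and> set_qterm s \<subseteq> A \<and> qeval env s = val x"
  by (simp add: val_rep_def)

lemma val_rep_zero_iff: "val_rep t x \<Longrightarrow> x = 0 \<longleftrightarrow> t = None"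
  by (cases t) (auto simp: val_rep_Some)

lemma val_rep_v: "val_rep t x \<Longrightarrow> map_option (qeval env) t = v x"
  by (cases t) (auto simp: val_rep_Some v_eq_Some v_eq_None_iff[THEN iffD2])

lemma val_rep_vars: "val_rep (Some s) x \<Longrightarrow> set_qterm s \<subseteq> A"
  by (simp add: val_rep_Some)

lemma val_rep_comparable:
  assumes "val_rep t x" "comparable N \<bar>x\<bar> \<bar>y\<bar>"
  shows "val_rep t y"
proof (cases "x = 0")
  case True
  then show ?thesis using assms by (cases t) (auto simp: val_rep_Some comparable_def)
next
  case False
  then have "\<bar>y\<bar> \<noteq> 0 \<and> val \<bar>x\<bar> = val \<bar>y\<bar>" using assms by (intro val_comparable) auto
  then show ?thesis using assms False by (cases t) (auto simp: val_rep_Some val_abs)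
qed

lemma val_rep_abs: "val_rep t \<bar>x\<bar> \<longleftrightarrow> val_rep t x"
  by (cases t) (auto simp: val_rep_Some val_abs)

text \<open>y must be nonzero: for y = 0 and i = 0 the product is x, whereas \<open>None\<close> is
  absorbing in \<open>qlin\<close>.\<close>

lemma val_rep_mult:
  assumes "val_rep t x" "val_rep u y" "y \<noteq> 0"
  shows "val_rep (qlin 1 t (of_nat i) u) (x * y ^ i)"
  using assms
  by (cases t; cases u) (auto simp: val_rep_Some val_mult val_power rat_mult_1 rat_mult_of_nat)

lemma val_rep_divide:
  assumes "val_rep t x" "c \<in> A" "a \<noteq> 0" "env c = val a"
  shows "val_rep (qlin 1 t (- of_nat n) (Some (QVar c))) (x / a ^ n)"
  using assms
  by (cases t) (auto simp: val_rep_Some val_divide val_power rat_mult_1 rat_mult_minus_of_nat)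

lemma val_rep_fold_min:
  assumes "val_rep (Some u) x" "0 < x" "list_all2 (\<lambda>s y. val_rep (Some s) y \<and> 0 < y) us ys"
  shows "val_rep (Some (fold QMin us u)) (x + sum_list ys)"
  using assms(3,1,2)
proof (induction arbitrary: u x rule: list_all2_induct)
  case (Cons s us y ys)
  have "val_rep (Some (QMin s u)) (y + x)"
    using Cons by (auto simp: val_rep_Some val_add)
  then have "val_rep (Some (fold QMin us (QMin s u))) ((y + x) + sum_list ys)"
    using Cons by (intro Cons.IH) auto
  then show ?case by (simp add: ac_simps)
qed simp

lemma map_filter_val_rep:
  assumes "list_all2 val_rep ts xs" "\<And>x. x \<in> set xs \<Longrightarrow> 0 \<le> x"
  shows "list_all2 (\<lambda>s y. val_rep (Some s) y \<and> 0 < y) (List.map_filter (\<lambda>t. t) ts) (filter (\<lambda>x. x \<noteq> 0) xs)"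
  using assms
  by (induction rule: list_all2_induct) (auto simp: List.map_filter_simps val_rep_zero_iff less_le split: option.splits)

lemma val_rep_sum_list:
  assumes "list_all2 val_rep ts xs" "\<And>x. x \<in> set xs \<Longrightarrow> 0 \<le> x"
  shows "val_rep (qreduce QMin ts) (sum_list xs)"
proof -
  define us where "us = List.map_filter (\<lambda>t. t) ts"
  define ys where "ys = filter (\<lambda>x. x \<noteq> 0) xs"
  have l: "list_all2 (\<lambda>s y. val_rep (Some s) y \<and> 0 < y) us ys"
    unfolding us_def ys_def using assms by (rule map_filter_val_rep)
  have s: "sum_list ys = sum_list xs" unfolding ys_def by (induction xs) auto
  show ?thesis
  proof (cases us)
    case Nil
    then show ?thesis using l s by (simp add: qreduce_def us_def[symmetric])
  next
    case (Cons u us')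
    then obtain y ys' where ys: "ys = y # ys'" using l by (auto simp: list_all2_Cons1)
    have "val_rep (Some (fold QMin us' u)) (y + sum_list ys')"
      using l Cons ys by (intro val_rep_fold_min) auto
    then show ?thesis using Cons ys s by (simp add: qreduce_def us_def[symmetric])
  qed
qed

lemma val_rep_sum:
  assumes "\<And>i. i \<in> set is \<Longrightarrow> val_rep (t i) (f i) \<and> 0 \<le> f i"
  shows "val_rep (qreduce QMin (map t is)) (\<Sum>i\<leftarrow>is. f i)"
  using assms by (intro val_rep_sum_list) (auto simp: list_all2_map1 list_all2_map2 list_all2_same)

lemma fold_max:
  assumes "\<forall>s\<in>set (u # us). qeval env s \<le> B \<and> set_qterm s \<subseteq> A" "\<exists>s\<in>set (u # us). qeval env s = B"
  shows "qeval env (fold QMax us u) = B \<and> set_qterm (fold QMax us u) \<subseteq> A"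
  using assms
proof (induction us arbitrary: u)
  case (Cons s us)
  then have "qeval env (fold QMax us (QMax s u)) = B \<and> set_qterm (fold QMax us (QMax s u)) \<subseteq> A"
    by (intro Cons.IH) (auto simp: max_def)
  then show ?case by simp
qed auto

text \<open>Every i with \<beta>_i nonzero gives (val \<alpha> - val \<beta>_i) / k_i \<le> val
  \<tau>, since a sum of nonnegative elements has at most the valuation of each nonzero term; a term
  that attains the valuation of the sum gives equality. Vanishing \<beta>_i contribute
  \<open>None\<close> and are skipped.\<close>

lemma val_rep_max:
  assumes t0: "val_rep t0 \<alpha>" "\<alpha> \<noteq> 0"
    and u: "\<And>i. i \<in> set is \<Longrightarrow> val_rep (u i) (\<beta> i) \<and> 0 \<le> \<beta> i \<and> 0 < k i"
    and \<tau>: "0 < \<tau>" and cmp: "comparable N \<bar>\<alpha>\<bar> (\<Sum>i\<leftarrow>is. \<beta> i * \<tau> ^ k i)"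
  shows "val_rep (qreduce QMax (map (\<lambda>i. let q = 1 / of_nat (k i) in qlin q t0 (- q) (u i)) is)) \<tau>"
proof -
  define w where "w i = (let q = 1 / of_nat (k i) in qlin q t0 (- q) (u i))" for i
  obtain s0 where s0: "t0 = Some s0" "set_qterm s0 \<subseteq> A" "qeval env s0 = val \<alpha>"
    using t0 by (cases t0) (auto simp: val_rep_Some)
  have w: "if \<beta> i = 0 then w i = None else \<exists>s. w i = Some s \<and> set_qterm s \<subseteq> A \<and>
      nmult (k i) (qeval env s) = val \<alpha> - val (\<beta> i)" if i: "i \<in> set is" for i
  proof (cases "\<beta> i = 0")
    case True
    then show ?thesis using u[OF i] val_rep_zero_iff[of "u i" "\<beta> i"] by (auto simp: w_def Let_def)
  next
    case False
    then obtain s where s: "u i = Some s" "set_qterm s \<subseteq> A" "qeval env s = val (\<beta> i)"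
      using u[OF i] by (cases "u i") (auto simp: val_rep_Some)
    \<comment> \<open>These k-th parts are what allows the rational multiples in \<open>w i\<close>
      to be evaluated.\<close>
    obtain h h' where h: "nmult (k i) h = val \<alpha>" "nmult (k i) h' = val (\<beta> i)"
      using nmult_divisible False t0 u[OF i] by metis
    have "w i = Some (QAdd (QScale (1 / of_nat (k i)) s0) (QScale (- (1 / of_nat (k i))) s))"
      by (simp add: w_def Let_def s0 s)
    then show ?thesis
      using False s s0 h u[OF i] rat_mult_inverse_nat[of "k i" h] rat_mult_inverse_nat[of "k i" h']
        nmult_diff[of h h' "k i"]
      by auto
  qed
  let ?S = "\<Sum>i\<leftarrow>is. \<beta> i * \<tau> ^ k i"
  have S: "?S \<noteq> 0" "val \<alpha> = val ?S"
    using val_comparable[OF cmp] t0 by (auto simp: val_abs)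
  have nonneg: "0 \<le> x" if "x \<in> set (map (\<lambda>i. \<beta> i * \<tau> ^ k i) is)" for x
    using that u \<tau> by auto
  have vt: "val (\<beta> i * \<tau> ^ k i) = val (\<beta> i) + nmult (k i) (val \<tau>)" if "\<beta> i \<noteq> 0" for i
    using that \<tau> by (simp add: val_mult val_power)
  \<comment> \<open>The index at which the valuation of the sum is attained, hence where the maximum
    equals \<open>val \<tau>\<close>.\<close>
  obtain j where j: "j \<in> set is" "\<beta> j \<noteq> 0" "val \<alpha> = val (\<beta> j * \<tau> ^ k j)"
    using val_sum_list[OF nonneg S(1)] S(2) by auto
  have le: "val \<alpha> \<le> val (\<beta> i * \<tau> ^ k i)" if "i \<in> set is" "\<beta> i \<noteq> 0" for i
    unfolding S(2) using that \<tau> by (intro val_le_summand nonneg) auto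
  define us where "us = List.map_filter (\<lambda>t. t) (map w is)"
  have "s \<in> set (List.map_filter (\<lambda>t. t) ts) \<longleftrightarrow> Some s \<in> set ts" for s :: "'c qterm" and ts
    by (induction ts) (auto simp: List.map_filter_simps split: option.splits)
  then have us: "s \<in> set us \<longleftrightarrow> (\<exists>i\<in>set is. w i = Some s)" for s
    by (force simp: us_def)
  have 1: "qeval env s \<le> val \<tau> \<and> set_qterm s \<subseteq> A" if "s \<in> set us" for s
  proof -
    from us[THEN iffD1, OF that] obtain i where i: "i \<in> set is" "w i = Some s" by auto
    then have b: "\<beta> i \<noteq> 0" "set_qterm s \<subseteq> A" "nmult (k i) (qeval env s) = val \<alpha> - val (\<beta> i)"
      using w[OF i(1)] by (auto split: if_splits)
    then have "nmult (k i) (qeval env s) \<le> nmult (k i) (val \<tau>)"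
      using le[OF i(1) b(1)] unfolding b(3) vt[OF b(1)] by (simp only: diff_le_eq add.commute)
    then show ?thesis using b(2) u[OF i(1)] nmult_le_iff[of "k i"] by blast
  qed
  obtain s where s: "w j = Some s" "nmult (k j) (qeval env s) = val \<alpha> - val (\<beta> j)"
    using w[OF j(1)] j(2) by auto
  then have "nmult (k j) (qeval env s) = nmult (k j) (val \<tau>)" using j vt by simp
  then have 2: "qeval env s = val \<tau>" using u[OF j(1)] nmult_eq_iff[of "k j"] by blast
  have 3: "s \<in> set us" using us s(1) j(1) by auto
  from 3 obtain u0 us' where us': "us = u0 # us'" by (cases us) auto
  have "qeval env (fold QMax us' u0) = val \<tau> \<and> set_qterm (fold QMax us' u0) \<subseteq> A"
    using 1 2 3 unfolding us' by (intro fold_max) auto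
  then have "val_rep (qreduce QMax (map w is)) \<tau>"
    using \<tau> us' by (simp add: qreduce_def us_def[symmetric] val_rep_Some)
  then show ?thesis by (simp only: w_def[abs_def])
qed

end

section \<open>Correctness of the tableau computation\<close>

subsection \<open>Lists of points, intervals and gaps\<close>

text \<open>Recursive so that lists sharing a point can be glued there, as in
  \<open>diffs_append\<close>; the indexed form is recovered by
  \<open>diffs_conv_nth\<close>.\<close>

fun diffs :: "'r::minus list \<Rightarrow> 'r list" where
  "diffs (x # y # zs) = (y - x) # diffs (y # zs)"
| "diffs [] = []"
| "diffs [x] = []"

lemma diffs_append: "diffs (us @ m # ws) = diffs (us @ [m]) @ diffs (m # ws)"
  by (induction us rule: diffs.induct) auto

lemma length_diffs: "length (diffs xs) = length xs - 1"
  by (induction xs rule: diffs.induct) auto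

lemma nth_diffs: "Suc k < length xs \<Longrightarrow> diffs xs ! k = xs ! Suc k - xs ! k"
proof (induction xs arbitrary: k rule: diffs.induct)
  case (1 x y zs)
  then show ?case by (cases k) auto
qed auto

lemma diffs_conv_nth: "diffs xs = map (\<lambda>k. xs ! Suc k - xs ! k) [0..<length xs - 1]"
  by (rule nth_equalityI) (auto simp: length_diffs nth_diffs)

definition between :: "'r::linorder option \<Rightarrow> 'r option \<Rightarrow> 'r \<Rightarrow> bool" where
  "between lo hi y \<longleftrightarrow> (\<forall>l. lo = Some l \<longrightarrow> l < y) \<and> (\<forall>h. hi = Some h \<longrightarrow> y < h)"

text \<open>The outer bounds \<open>lo\<close> and \<open>hi\<close>, with \<open>None\<close> for
  an infinite one, are arguments so that two stretches can be glued at a common point.\<close>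

fun signs_ok :: "('r::linorder \<Rightarrow> 's) \<Rightarrow> 'r option \<Rightarrow> 'r list \<Rightarrow> 'r option \<Rightarrow> 's list \<Rightarrow> bool" where
  "signs_ok f lo [] hi Is \<longleftrightarrow> (\<exists>I. Is = [I] \<and> (\<forall>y. between lo hi y \<longrightarrow> I = f y))"
| "signs_ok f lo (x # xs) hi Is \<longleftrightarrow> (\<exists>I Is'. Is = I # Is' \<and>
     (\<forall>y. between lo (Some x) y \<longrightarrow> I = f y) \<and> signs_ok f (Some x) xs hi Is')"

lemma signs_ok_append:
  "signs_ok f lo xs (Some m) Is \<Longrightarrow> signs_ok f (Some m) ys hi Js \<Longrightarrow> signs_ok f lo (xs @ m # ys) hi (Is @ Js)"
  by (induction xs arbitrary: lo Is) auto

lemma signs_ok_nth: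
  assumes "signs_ok f lo xs hi Is"
  shows "length Is = Suc (length xs) \<and> (\<forall>k\<le>length xs. \<forall>y.
    between (if k = 0 then lo else Some (xs ! (k - 1))) (if k < length xs then Some (xs ! k) else hi) y \<longrightarrow> Is ! k = f y)"
  using assms
proof (induction xs arbitrary: lo Is)
  case (Cons x xs)
  then obtain I Is' where I: "Is = I # Is'" "\<forall>y. between lo (Some x) y \<longrightarrow> I = f y"
    and ok: "signs_ok f (Some x) xs hi Is'" by auto
  note IH = Cons.IH[OF ok]
  have "Is ! k = f y" if "k \<le> length (x # xs)" "between (if k = 0 then lo else Some ((x # xs) ! (k - 1)))
     (if k < length (x # xs) then Some ((x # xs) ! k) else hi) y" for k y
  proof (cases k)
    case 0
    then show ?thesis using that I by simp
  next
    case (Suc k')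
    then have "between (if k' = 0 then Some x else Some (xs ! (k' - 1))) (if k' < length xs then Some (xs ! k') else hi) y"
      using that(2) by (cases k') auto
    then show ?thesis using IH Suc that(1) I by auto
  qed
  then show ?case using IH I by auto
qed auto

lemma in_nth_interval_iff:
  "y \<in> nth_interval xs k \<longleftrightarrow>
    between (if k = 0 then None else Some (xs ! (k - 1))) (if k < length xs then Some (xs ! k) else None) y"
  by (auto simp: nth_interval_def between_def)

lemma list_all2_concat_map:
  "(\<And>k. k \<in> set ks \<Longrightarrow> list_all2 Q (f k) (g k)) \<Longrightarrow>
   list_all2 Q (concat (map f ks)) (concat (map g ks))"
  by (induction ks) (auto intro: list_all2_appendI)

lemma set_all_roots: "set (all_roots Fs) = {x. \<exists>F\<in>set Fs. F \<noteq> 0 \<and> poly F x = 0}"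
proof -
  have "{x. \<exists>F\<in>set Fs. F \<noteq> 0 \<and> poly F x = 0} = (\<Union>F\<in>{F \<in> set Fs. F \<noteq> 0}. {x. poly F x = 0})"
    by auto
  moreover have "finite (\<Union>F\<in>{F \<in> set Fs. F \<noteq> 0}. {x. poly F x = 0})"
    by (auto intro: poly_roots_finite)
  ultimately show ?thesis by (simp only: all_roots_def set_sorted_list_of_set)
qed

lemma sorted_all_roots: "sorted_wrt (<) (all_roots Fs)"
  unfolding all_roots_def by simp

lemma all_roots_eqI:
  "sorted_wrt (<) ys \<Longrightarrow> set ys = {x. \<exists>F\<in>set Fs. F \<noteq> 0 \<and> poly F x = 0} \<Longrightarrow> all_roots Fs = ys"
  by (rule strict_sorted_equal[OF _ sorted_all_roots]) (simp_all add: set_all_roots)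

lemma nth_interval_not_in:
  assumes "sorted_wrt (<) xs" "y \<in> nth_interval xs k" "k \<le> length xs"
  shows "y \<notin> set xs"
proof
  assume "y \<in> set xs"
  then obtain i where i: "i < length xs" "y = xs ! i" by (auto simp: in_set_conv_nth)
  have "k \<le> i"
  proof (rule ccontr)
    assume "\<not> k \<le> i"
    then have "xs ! i \<le> xs ! (k - 1)"
    proof (cases "i = k - 1")
      case False
      then have "i < k - 1" "k - 1 < length xs" using \<open>\<not> k \<le> i\<close> assms(3) by arith+
      then show ?thesis using sorted_wrt_nth_less[OF assms(1), of i "k - 1"] by simp
    qed simp
    then show False using assms(2) i \<open>\<not> k \<le> i\<close> by (auto simp: nth_interval_def)
  qed
  then have "xs ! k \<le> xs ! i"
    using assms(1) i by (cases "i = k") (auto simp: sorted_wrt_iff_nth_less intro!: less_imp_le)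
  then show False using assms(2) i \<open>k \<le> i\<close> by (auto simp: nth_interval_def)
qed

lemma nth_interval_cover:
  assumes "y \<notin> set xs"
  shows "\<exists>k\<le>length xs. y \<in> nth_interval xs k"
proof -
  \<comment> \<open>The first point beyond y, or \<open>length xs\<close> if there is none.\<close>
  define k where "k = (LEAST k. k = length xs \<or> y < xs ! k)"
  have k: "k = length xs \<or> y < xs ! k" unfolding k_def by (rule LeastI[of _ "length xs"]) simp
  have le: "k \<le> length xs" unfolding k_def by (rule Least_le) simp
  have "xs ! (k - 1) < y" if "0 < k"
  proof -
    have "\<not> (k - 1 = length xs \<or> y < xs ! (k - 1))"
      using not_less_Least[of "k - 1" "\<lambda>k. k = length xs \<or> y < xs ! k"] that unfolding k_def by auto
    moreover have "xs ! (k - 1) \<noteq> y" using assms le that by (metis One_nat_def Suc_le_eq Suc_pred nth_mem)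
    ultimately show ?thesis by auto
  qed
  then have "y \<in> nth_interval xs k" using k by (auto simp: nth_interval_def)
  then show ?thesis using le by blast
qed

lemma nth_interval_nonempty:
  assumes "sorted_wrt (<) xs" "k \<le> length xs"
  shows "\<exists>y :: 'r::linordered_field. y \<in> nth_interval xs k"
proof -
  consider "k = 0" "k = length xs" | "k = 0" "k < length xs" | "0 < k" "k = length xs" | "0 < k" "k < length xs"
    using assms(2) by linarith
  then show ?thesis
  proof cases
    case 2
    then show ?thesis using lt_ex[of "xs ! 0"] by (auto simp: nth_interval_def)
  next
    case 3
    then show ?thesis using gt_ex[of "xs ! (k - 1)"] by (auto simp: nth_interval_def)
  next
    case 4
    then have "xs ! (k - 1) < xs ! k" using assms(1) by (auto simp: sorted_wrt_iff_nth_less)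
    then show ?thesis using dense[of "xs ! (k - 1)" "xs ! k"] by (auto simp: nth_interval_def)
  qed (auto simp: nth_interval_def)
qed

lemma nth_interval_open:
  assumes "(y :: 'r::linordered_field) \<in> nth_interval xs k"
  shows "\<exists>z\<in>nth_interval xs k. z < y" "\<exists>z\<in>nth_interval xs k. y < z"
proof -
  show "\<exists>z\<in>nth_interval xs k. z < y"
  proof (cases "0 < k")
    case True
    then have "xs ! (k - 1) < y" using assms by (auto simp: nth_interval_def)
    then obtain z where "xs ! (k - 1) < z" "z < y" using dense by blast
    then show ?thesis using assms by (intro bexI[of _ z]) (auto simp: nth_interval_def)
  next
    case False
    obtain z where "z < y" using lt_ex by blast
    then show ?thesis using assms False by (intro bexI[of _ z]) (auto simp: nth_interval_def)
  qed
  show "\<exists>z\<in>nth_interval xs k. y < z"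
  proof (cases "k < length xs")
    case True
    then have "y < xs ! k" using assms by (auto simp: nth_interval_def)
    then obtain z where "y < z" "z < xs ! k" using dense by blast
    then show ?thesis using assms by (intro bexI[of _ z]) (auto simp: nth_interval_def)
  next
    case False
    obtain z where "y < z" using gt_ex by blast
    then show ?thesis using assms False by (intro bexI[of _ z]) (auto simp: nth_interval_def)
  qed
qed

lemma nth_interval_convex:
  "y \<in> nth_interval xs k \<Longrightarrow> z \<in> nth_interval xs k \<Longrightarrow> y \<le> w \<Longrightarrow> w \<le> z \<Longrightarrow> w \<in> nth_interval xs k"
  by (auto simp: nth_interval_def)

lemma funpow_pderiv_nonzero:
  "Q \<noteq> 0 \<Longrightarrow> i \<le> degree Q \<Longrightarrow> (pderiv ^^ i) Q \<noteq> 0" for Q :: "'a::field_char_0 poly"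
proof (induction i)
  case (Suc i)
  have "degree ((pderiv ^^ i) Q) \<noteq> 0" using Suc.prems by (simp add: degree_funpow_pderiv)
  then show ?case by (simp add: pderiv_eq_0_iff)
qed simp

text \<open>Each derivation multiplies the leading coefficient by a positive integer, which changes
  neither its sign nor its valuation; hence \<open>lead_const\<close> can stand for the leading
  coefficient.\<close>

lemma (in convex_valuation) lead_coeff_funpow_pderiv:
  assumes "Q \<noteq> 0" "i \<le> degree Q"
  shows "isgn (lead_coeff ((pderiv ^^ i) Q)) = isgn (lead_coeff Q) \<and>
    val (lead_coeff ((pderiv ^^ i) Q)) = val (lead_coeff Q)"
  using assms
proof (induction i)
  case (Suc i)
  define R where "R = (pderiv ^^ i) Q"
  have R: "degree R > 0" using Suc.prems by (simp add: R_def degree_funpow_pderiv)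
  have "lead_coeff (pderiv R) = of_nat (degree R) * lead_coeff R"
    using R by (simp add: degree_pderiv coeff_pderiv)
  moreover have "R \<noteq> 0" using R by auto
  ultimately have "val (lead_coeff (pderiv R)) = val (lead_coeff R)"
    using R by (simp add: val_mult val_of_nat)
  then show ?case using Suc isgn_lead_coeff_pderiv[OF R] by (simp add: R_def)
qed simp

text \<open>The interface between the tree and the computation. The inequalities
  \<open>deriv_of S j < j\<close> and \<open>prem_of S j l < j\<close> say that column j refers only
  to earlier columns. The constants are tied to the terms by \<open>\<sigma>\<close>,
  \<open>env\<close> and \<open>A\<close>, with a value demanded only where the constant is
  nonzero.\<close>

locale tableau_model = valuation_terms v V P env A
  for v :: "'r::real_closed_field \<Rightarrow> 'g::linordered_ab_group_add option" and V P :: "'r set"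
    and env :: "'c \<Rightarrow> 'g" and A :: "'c set" +
  fixes S :: "'c skeleton" and \<sigma> :: "'c \<Rightarrow> int" and fs :: "'r poly list"
  assumes deg_of: "j < length fs \<Longrightarrow> deg_of S j = degree (fs ! j)"
    and deriv_of: "j < length fs \<Longrightarrow> 1 \<le> degree (fs ! j) \<Longrightarrow>
      deriv_of S j < j \<and> fs ! deriv_of S j = pderiv (fs ! j)"
    and prem_of: "j < length fs \<Longrightarrow> l < length fs \<Longrightarrow> 1 \<le> degree (fs ! l) \<Longrightarrow> degree (fs ! l) \<le> degree (fs ! j) \<Longrightarrow>
      prem_of S j l < j \<and> (\<exists>q. smult (lead_coeff (fs ! l) ^ (Suc (degree (fs ! j)) - degree (fs ! l))) (fs ! j) =
        fs ! l * q + fs ! prem_of S j l)"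
    and const_of: "j < length fs \<Longrightarrow> degree (fs ! j) = 0 \<Longrightarrow> \<sigma> (const_of S j) = isgn (coeff (fs ! j) 0) \<and>
      (coeff (fs ! j) 0 \<noteq> 0 \<longrightarrow> const_of S j \<in> A \<and> env (const_of S j) = val (coeff (fs ! j) 0))"
    and sorted_degrees: "i \<le> j \<Longrightarrow> j < length fs \<Longrightarrow> degree (fs ! i) \<le> degree (fs ! j)"
begin

lemma iter_deriv:
  assumes "j < length fs" "i \<le> degree (fs ! j)"
  shows "iter_deriv S j i \<le> j \<and> (1 \<le> i \<longrightarrow> iter_deriv S j i < j) \<and> fs ! iter_deriv S j i = (pderiv ^^ i) (fs ! j)"
  using assms(2)
proof (induction i)
  case 0
  then show ?case by (simp add: iter_deriv_def)
next
  case (Suc i)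
  define m where "m = iter_deriv S j i"
  have m: "m \<le> j" "fs ! m = (pderiv ^^ i) (fs ! j)" using Suc by (auto simp: m_def)
  have "1 \<le> degree (fs ! m)" using Suc.prems by (simp add: m degree_funpow_pderiv)
  then have "deriv_of S m < m \<and> fs ! deriv_of S m = pderiv (fs ! m)"
    using m assms(1) by (intro deriv_of) auto
  moreover have "iter_deriv S j (Suc i) = deriv_of S m" by (simp add: iter_deriv_def m_def)
  ultimately show ?case using m by simp
qed

lemma lead_const:
  assumes "j < length fs" "fs ! j \<noteq> 0"
  shows "\<sigma> (lead_const S j) = isgn (lead_coeff (fs ! j))" "lead_const S j \<in> A"
    "env (lead_const S j) = val (lead_coeff (fs ! j))"
proof -
  define m where "m = iter_deriv S j (degree (fs ! j))"
  have m: "m < length fs" "fs ! m = (pderiv ^^ degree (fs ! j)) (fs ! j)"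
    using iter_deriv[OF assms(1), of "degree (fs ! j)"] assms(1) by (auto simp: m_def)
  have d: "degree (fs ! m) = 0" by (simp add: m degree_funpow_pderiv)
  have "fs ! m \<noteq> 0" using funpow_pderiv_nonzero[OF assms(2)] m by simp
  then have "coeff (fs ! m) 0 \<noteq> 0" using d by (metis leading_coeff_0_iff)
  moreover have "lead_const S j = const_of S m" by (simp add: lead_const_def deg_of assms m_def)
  moreover note const_of[OF m(1) d] lead_coeff_funpow_pderiv[OF assms(2) order_refl]
  ultimately show "\<sigma> (lead_const S j) = isgn (lead_coeff (fs ! j))" "lead_const S j \<in> A"
    "env (lead_const S j) = val (lead_coeff (fs ! j))"
    using d m by auto
qed

lemma val_rep_const:
  assumes "j < length fs" "degree (fs ! j) = 0"
  shows "val_rep (const_val S \<sigma> j) (poly (fs ! j) y)"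
proof -
  have "poly (fs ! j) y = coeff (fs ! j) 0"
    using assms(2) by (metis degree_eq_zeroE coeff_pCons_0 poly_const_conv)
  then show ?thesis using const_of[OF assms] by (auto simp: const_val_def val_rep_Some)
qed

definition signs :: "nat \<Rightarrow> 'r \<Rightarrow> int list" where
  "signs n y = map (\<lambda>F. isgn (poly F y)) (take n fs)"

definition pts :: "nat \<Rightarrow> 'r list" where
  "pts n = all_roots (take n fs)"

text \<open>Uses \<open>signs_ok\<close> and \<open>diffs\<close> where the specification indexes
  intervals and gaps, because \<open>add_polynomial\<close> builds its lists by concatenating one
  piece per interval.\<close>

definition rep :: "nat \<Rightarrow> 'c qterm tableau \<Rightarrow> bool" where
  "rep n T \<longleftrightarrow> point_signs T = map (signs n) (pts n) \<and>
    signs_ok (signs n) None (pts n) None (interval_signs T) \<and>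
    list_all2 val_rep (gaps T) (diffs (pts n)) \<and>
    list_all2 (\<lambda>w y. list_all2 (\<lambda>t F. val_rep t (poly F y)) w (take n fs)) (vals T) (pts n)"

lemma rep_0: "rep 0 (skeleton_tableau S \<sigma> 0)"
proof -
  have "pts 0 = []" using set_all_roots[of "[] :: 'r poly list"] by (simp add: pts_def)
  then show ?thesis by (simp add: rep_def signs_def)
qed

end

subsection \<open>Adding one polynomial\<close>

locale tableau_step = tableau_model v V P env A S \<sigma> fs
  for v :: "'r::real_closed_field \<Rightarrow> 'g::linordered_ab_group_add option" and V P :: "'r set"
    and env :: "'c \<Rightarrow> 'g" and A :: "'c set" and S :: "'c skeleton" and \<sigma> :: "'c \<Rightarrow> int"
    and fs :: "'r poly list" +
  fixes n :: nat and T :: "'c qterm tableau"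
  assumes n: "n < length fs" and rep: "rep n T"
begin

abbreviation (input) "xs \<equiv> pts n"
abbreviation (input) "p \<equiv> fs ! n"

lemma length_point_signs: "length (point_signs T) = length xs"
  using rep by (simp add: rep_def)

lemma point_sign: "k < length xs \<Longrightarrow> j < n \<Longrightarrow> point_signs T ! k ! j = isgn (poly (fs ! j) (xs ! k))"
  using rep n by (simp add: rep_def signs_def)

lemma interval_sign:
  assumes "k \<le> length xs" "y \<in> nth_interval xs k"
  shows "interval_signs T ! k = signs n y"
  using rep assms signs_ok_nth[of "signs n" None xs None "interval_signs T"]
  by (simp add: rep_def in_nth_interval_iff)

lemma gap: "Suc k < length xs \<Longrightarrow> val_rep (gaps T ! k) (xs ! Suc k - xs ! k)"
  using rep list_all2_nthD2[of val_rep "gaps T" "diffs xs" k]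
  by (simp add: rep_def length_diffs nth_diffs)

lemma point_val: "k < length xs \<Longrightarrow> j < n \<Longrightarrow> val_rep (vals T ! k ! j) (poly (fs ! j) (xs ! k))"
proof -
  assume k: "k < length xs" and j: "j < n"
  have "list_all2 (\<lambda>t F. val_rep t (poly F (xs ! k))) (vals T ! k) (take n fs)"
    using rep k list_all2_nthD2[of "\<lambda>w y. list_all2 (\<lambda>t F. val_rep t (poly F y)) w (take n fs)" "vals T" xs k]
    by (simp add: rep_def)
  then show ?thesis using list_all2_nthD2[of "\<lambda>t F. val_rep t (poly F (xs ! k))" "vals T ! k" "take n fs" j] n j
    by simp
qed

lemma sorted_pts: "sorted_wrt (<) xs"
  unfolding pts_def by (rule sorted_all_roots)

lemma set_pts: "x \<in> set xs \<longleftrightarrow> (\<exists>j<n. fs ! j \<noteq> 0 \<and> poly (fs ! j) x = 0)"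
  using n by (auto simp: pts_def set_all_roots simp flip: nth_image[of n fs])

lemma vanishing_at:
  assumes "k < length xs"
  shows "vanishing_at S n T k < n" "1 \<le> degree (fs ! vanishing_at S n T k)"
    "poly (fs ! vanishing_at S n T k) (xs ! k) = 0"
proof -
  obtain j where j: "j < n" "fs ! j \<noteq> 0" "poly (fs ! j) (xs ! k) = 0"
    using assms nth_mem set_pts by metis
  have "1 \<le> degree (fs ! j)"
  proof (rule ccontr)
    assume "\<not> ?thesis"
    then obtain c where "fs ! j = [:c:]" by (metis degree_eq_zeroE not_one_le_zero less_one not_le)
    then show False using j by simp
  qed
  define ls where "ls = filter (\<lambda>l. 1 \<le> deg_of S l \<and> point_signs T ! k ! l = 0) [0..<n]"
  have "j \<in> set ls"
    using j assms n \<open>1 \<le> degree (fs ! j)\<close> by (simp add: ls_def deg_of point_sign)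
  then have "ls \<noteq> []" by auto
  then have "hd ls \<in> set ls" by (rule hd_in_set)
  then have "vanishing_at S n T k \<in> set ls" by (simp add: vanishing_at_def ls_def)
  then show "vanishing_at S n T k < n" "1 \<le> degree (fs ! vanishing_at S n T k)"
    "poly (fs ! vanishing_at S n T k) (xs ! k) = 0"
    using assms n by (auto simp: ls_def deg_of point_sign)
qed

lemma pseudo_remainder_at:
  assumes "k < length xs" "1 \<le> degree p"
  defines "l \<equiv> vanishing_at S n T k"
  shows "prem_of S n l < n" "lead_coeff (fs ! l) \<noteq> 0"
    "lead_coeff (fs ! l) ^ (Suc (degree p) - degree (fs ! l)) * poly p (xs ! k) = poly (fs ! prem_of S n l) (xs ! k)"
proof -
  note l = vanishing_at[OF assms(1), folded l_def]
  have "degree (fs ! l) \<le> degree p" using l n by (intro sorted_degrees) auto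
  then obtain q where q: "prem_of S n l < n"
    "smult (lead_coeff (fs ! l) ^ (Suc (degree p) - degree (fs ! l))) p = fs ! l * q + fs ! prem_of S n l"
    using prem_of[of n l] n l by auto
  then show "prem_of S n l < n" by simp
  show "lead_coeff (fs ! l) \<noteq> 0" using l by auto
  show "lead_coeff (fs ! l) ^ (Suc (degree p) - degree (fs ! l)) * poly p (xs ! k) = poly (fs ! prem_of S n l) (xs ! k)"
    using arg_cong[OF q(2), of "\<lambda>q. poly q (xs ! k)"] l by simp
qed

lemma sign_at:
  assumes "k < length xs"
  shows "sign_at S \<sigma> n T k = isgn (poly p (xs ! k))"
proof (cases "degree p = 0")
  case True
  then have "poly p (xs ! k) = coeff p 0" by (metis degree_eq_zeroE coeff_pCons_0 poly_const_conv)
  then show ?thesis using True n const_of[OF n True] by (simp add: sign_at_def deg_of)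
next
  case False
  define l where "l = vanishing_at S n T k"
  note l = vanishing_at[OF assms, folded l_def]
  define e where "e = Suc (degree p) - degree (fs ! l)"
  note R = pseudo_remainder_at[OF assms, folded l_def, folded e_def]
  have d: "1 \<le> degree p" using False by simp
  define c where "c = lead_coeff (fs ! l)"
  have "sign_at S \<sigma> n T k = isgn c ^ e * isgn (poly (fs ! prem_of S n l) (xs ! k))"
    using False n l assms R(1)[OF d] lead_const(1)[of l] R(2)[OF d]
    by (simp add: sign_at_def deg_of l_def[symmetric] point_sign e_def c_def)
  \<comment> \<open>The computation multiplies by the sign of c^e instead of dividing by it; the
    resulting factor is a square.\<close>
  also have "\<dots> = isgn (c ^ e * (c ^ e * poly p (xs ! k)))"
    using R(3)[OF d] by (simp add: isgn_mult isgn_power c_def)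
  also have "c ^ e * (c ^ e * poly p (xs ! k)) = (c ^ e)\<^sup>2 * poly p (xs ! k)"
    by (simp add: power2_eq_square)
  also have "isgn \<dots> = isgn (poly p (xs ! k))"
    using R(2)[OF d] by (subst isgn_mult) (simp add: c_def)
  finally show ?thesis .
qed

lemma val_at:
  assumes "k < length xs"
  shows "val_rep (val_at S \<sigma> n T k) (poly p (xs ! k))"
proof (cases "degree p = 0")
  case True
  then show ?thesis using n val_rep_const[OF n True] by (simp add: val_at_def deg_of)
next
  case False
  define l where "l = vanishing_at S n T k"
  note l = vanishing_at[OF assms, folded l_def]
  define e where "e = Suc (degree p) - degree (fs ! l)"
  note R = pseudo_remainder_at[OF assms, folded l_def, folded e_def]
  have d: "1 \<le> degree p" using False by simp
  have l0: "fs ! l \<noteq> 0" using l by auto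
  have "poly p (xs ! k) = poly (fs ! prem_of S n l) (xs ! k) / lead_coeff (fs ! l) ^ e"
    using R(2,3)[OF d] by (simp add: field_simps)
  moreover have "val_at S \<sigma> n T k = qlin 1 (vals T ! k ! prem_of S n l) (- of_nat e) (Some (QVar (lead_const S l)))"
    using False n l by (simp add: val_at_def deg_of l_def[symmetric] e_def)
  ultimately show ?thesis
    using val_rep_divide[OF point_val[OF assms R(1)[OF d]] lead_const(2)[OF _ l0] R(2)[OF d] lead_const(3)[OF _ l0]] l n
    by simp
qed

lemma poly_nonzero_on_interval:
  assumes "k \<le> length xs" "y \<in> nth_interval xs k" "j < n" "fs ! j \<noteq> 0"
  shows "poly (fs ! j) y \<noteq> 0"
  using nth_interval_not_in[OF sorted_pts assms(2,1)] set_pts assms by blast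

text \<open>Includes j = n when 1 \<le> i: the proper derivatives of the new polynomial precede it
  in the family, so they have no roots between the present points.\<close>

lemma derivative_on_interval:
  assumes "j \<le> n" "i \<le> degree (fs ! j)" "fs ! j \<noteq> 0" "j < n \<or> 1 \<le> i"
  shows "iter_deriv S j i < n" "fs ! iter_deriv S j i = (pderiv ^^ i) (fs ! j)"
    "k \<le> length xs \<Longrightarrow> y \<in> nth_interval xs k \<Longrightarrow> poly ((pderiv ^^ i) (fs ! j)) y \<noteq> 0"
proof -
  note I = iter_deriv[of j i]
  show 1: "iter_deriv S j i < n" and 2: "fs ! iter_deriv S j i = (pderiv ^^ i) (fs ! j)"
    using I assms n by auto
  show "poly ((pderiv ^^ i) (fs ! j)) y \<noteq> 0" if "k \<le> length xs" "y \<in> nth_interval xs k"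
    using poly_nonzero_on_interval[OF that 1] unfolding 2
    using funpow_pderiv_nonzero[OF assms(3,2)] by blast
qed

lemma expand_left_iff:
  assumes "j \<le> n" "Suc i \<le> degree (fs ! j)" "j < n \<or> 1 \<le> i" "k \<le> length xs" "y \<in> nth_interval xs k"
  shows "expand_left S T k j i \<longleftrightarrow>
    0 \<le> isgn (poly ((pderiv ^^ i) (fs ! j)) y) * isgn (poly ((pderiv ^^ Suc i) (fs ! j)) y)"
proof -
  have "fs ! j \<noteq> 0" using assms(2) by auto
  then have D: "iter_deriv S j i < n" "fs ! iter_deriv S j i = (pderiv ^^ i) (fs ! j)"
      "iter_deriv S j (Suc i) < n" "fs ! iter_deriv S j (Suc i) = (pderiv ^^ Suc i) (fs ! j)"
    using derivative_on_interval[of j i] derivative_on_interval[of j "Suc i"] assms by auto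
  have "interval_signs T ! k ! m = isgn (poly (fs ! m) y)" if "m < n" for m
    using interval_sign[OF assms(4,5)] that n by (simp add: signs_def)
  then show ?thesis unfolding expand_left_def using D by simp
qed

text \<open>The derivative of degree 1 of a nonconstant member belongs to the family as well, and a
  linear polynomial has a root.\<close>

lemma points_exist:
  assumes "j < n" "1 \<le> degree (fs ! j)"
  shows "xs \<noteq> []"
proof -
  define d where "d = degree (fs ! j)"
  have f0: "fs ! j \<noteq> 0" using assms by auto
  define m where "m = iter_deriv S j (d - 1)"
  have m: "m < n" "fs ! m = (pderiv ^^ (d - 1)) (fs ! j)"
    using derivative_on_interval[of j "d - 1"] f0 assms by (auto simp: m_def d_def)
  have d1: "degree (fs ! m) = 1" using assms(2) by (simp add: m degree_funpow_pderiv d_def)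
  define a b where "a = coeff (fs ! m) 0" and "b = coeff (fs ! m) 1"
  have m0: "fs ! m \<noteq> 0" using d1 by auto
  then have "b \<noteq> 0" unfolding b_def d1[symmetric] by simp
  then have "poly (fs ! m) (- a / b) = 0" by (simp add: poly_altdef d1 a_def b_def)
  then have "- a / b \<in> set xs" using set_pts m m0 by blast
  then show ?thesis by auto
qed

lemma isgn_derivative_const:
  assumes d: "1 \<le> degree p" and k: "k \<le> length xs" and y: "y \<in> nth_interval xs k" "z \<in> nth_interval xs k"
  shows "isgn (poly (pderiv p) y) = isgn (poly (pderiv p) z)" "isgn (poly (pderiv p) y) \<noteq> 0"
proof -
  have p0: "p \<noteq> 0" using d by auto
  have nz: "poly (pderiv p) w \<noteq> 0" if "w \<in> nth_interval xs k" for w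
    using derivative_on_interval(3)[of n 1 k w] d p0 k that by simp
  show "isgn (poly (pderiv p) y) \<noteq> 0" using nz[OF y(1)] by simp
  show "isgn (poly (pderiv p) y) = isgn (poly (pderiv p) z)"
  proof (rule isgn_poly_const)
    fix w assume w: "min y z \<le> w" "w \<le> max y z"
    have "w \<in> nth_interval xs k"
    proof (cases "y \<le> z")
      case True
      then show ?thesis using nth_interval_convex[OF y] w by simp
    next
      case False
      then show ?thesis using nth_interval_convex[OF y(2,1)] w by simp
    qed
    then show "poly (pderiv p) w \<noteq> 0" by (rule nz)
  qed
qed

text \<open>Strict monotonicity in terms of signs. Only the points between a and b have to lie in
  the interval, so a and b may be old points, at which the values are known.\<close>

lemma isgn_difference:
  assumes d: "1 \<le> degree p" and k: "k \<le> length xs" and ab: "a < b"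
    and sub: "\<And>w. a < w \<Longrightarrow> w < b \<Longrightarrow> w \<in> nth_interval xs k" and y: "y \<in> nth_interval xs k"
  shows "isgn (poly p b - poly p a) = isgn (poly (pderiv p) y)"
proof -
  obtain w where w: "a < w" "w < b" "poly p b - poly p a = (b - a) * poly (pderiv p) w"
    using poly_MVT_rcf[OF ab] by blast
  then have "isgn (poly p b - poly p a) = isgn (poly (pderiv p) w)"
    using ab by (simp add: isgn_mult)
  also have "\<dots> = isgn (poly (pderiv p) y)"
    using isgn_derivative_const(1)[OF d k sub[OF w(1,2)] y] .
  finally show ?thesis .
qed

lemma left_sign_eq:
  assumes "1 \<le> degree p" "k \<le> length xs"
  shows "left_sign S \<sigma> n T k = (if k = 0 then (- 1) ^ degree p * isgn (lead_coeff p) else isgn (poly p (xs ! (k - 1))))"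
proof -
  have "p \<noteq> 0" using assms by auto
  then show ?thesis using n lead_const(1)[OF n] sign_at[of "k - 1"] assms by (simp add: left_sign_def deg_of)
qed

lemma right_sign_eq:
  assumes "1 \<le> degree p" "k \<le> length xs"
  shows "right_sign S \<sigma> n T k = (if k = length xs then isgn (lead_coeff p) else isgn (poly p (xs ! k)))"
proof -
  have "p \<noteq> 0" using assms by auto
  then show ?thesis using n lead_const(1)[OF n] sign_at[of k] assms by (simp add: right_sign_def length_point_signs)
qed

text \<open>Zeros are excluded only between the left end and y, so this also applies to points on
  the left of a root inside the interval.\<close>

lemma left_sign_near:
  assumes d: "1 \<le> degree p" and k: "k \<le> length xs" and y: "y \<in> nth_interval xs k"
    and nz: "\<And>z. z \<in> nth_interval xs k \<Longrightarrow> z \<le> y \<Longrightarrow> poly p z \<noteq> 0"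
  shows "left_sign S \<sigma> n T k = 0 \<or> isgn (poly p y) = left_sign S \<sigma> n T k"
proof (cases "k = 0")
  case True
  have "z \<in> nth_interval xs k" if "z \<le> y" for z
    using that y True by (auto simp: nth_interval_def)
  then have "isgn (poly p y) = (- 1) ^ degree p * isgn (lead_coeff p)"
    using nz d by (intro isgn_poly_at_bot) auto
  then show ?thesis using left_sign_eq[OF d k] True by simp
next
  case False
  have *: "xs ! (k - 1) < y" using y False by (auto simp: nth_interval_def)
  have "z \<in> nth_interval xs k" if "xs ! (k - 1) < z" "z \<le> y" for z
    using that y by (auto simp: nth_interval_def)
  then have "isgn (poly p (xs ! (k - 1))) = 0 \<or> isgn (poly p (xs ! (k - 1))) = isgn (poly p y)"
    using nz * by (intro isgn_poly_endpoint) (auto simp: min_def max_def split: if_splits)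
  then show ?thesis using left_sign_eq[OF d k] False by auto
qed

lemma right_sign_near:
  assumes d: "1 \<le> degree p" and k: "k \<le> length xs" and y: "y \<in> nth_interval xs k"
    and nz: "\<And>z. z \<in> nth_interval xs k \<Longrightarrow> y \<le> z \<Longrightarrow> poly p z \<noteq> 0"
  shows "right_sign S \<sigma> n T k = 0 \<or> isgn (poly p y) = right_sign S \<sigma> n T k"
proof (cases "k = length xs")
  case True
  have "z \<in> nth_interval xs k" if "y \<le> z" for z
    using that y True by (auto simp: nth_interval_def)
  then have "isgn (poly p y) = isgn (lead_coeff p)"
    using nz d by (intro isgn_poly_at_top) auto
  then show ?thesis using right_sign_eq[OF d k] True by simp
next
  case False
  have *: "y < xs ! k" using y False k by (auto simp: nth_interval_def)
  have "z \<in> nth_interval xs k" if "z < xs ! k" "y \<le> z" for z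
    using that y by (auto simp: nth_interval_def)
  then have "isgn (poly p (xs ! k)) = 0 \<or> isgn (poly p (xs ! k)) = isgn (poly p y)"
    using nz * by (intro isgn_poly_endpoint) (auto simp: min_def max_def split: if_splits)
  then show ?thesis using right_sign_eq[OF d k] False by auto
qed

lemma isgn_cases: "isgn (x :: 'r) \<in> {- 1, 0, 1}"
  by (auto simp: isgn_def)

lemma degree_zero_case:
  assumes "degree p = 0" "k \<le> length xs"
  shows "\<not> has_new_root S \<sigma> n T k" "left_sign S \<sigma> n T k = isgn (poly p y)" "right_sign S \<sigma> n T k = isgn (poly p y)"
proof -
  have c: "poly p z = coeff p 0" for z
    using assms(1) by (metis degree_eq_zeroE coeff_pCons_0 poly_const_conv)
  have l: "lead_const S n = const_of S n"
    using assms n by (simp add: lead_const_def deg_of iter_deriv_def)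
  show 1: "left_sign S \<sigma> n T k = isgn (poly p y)"
    using sign_at[of "k - 1"] assms n const_of[OF n assms(1)] by (simp add: left_sign_def deg_of l c)
  show 2: "right_sign S \<sigma> n T k = isgn (poly p y)"
    using sign_at[of k] assms n const_of[OF n assms(1)] by (simp add: right_sign_def l c length_point_signs)
  show "\<not> has_new_root S \<sigma> n T k"
    unfolding has_new_root_def 1 2 using isgn_cases[of "poly p y"] by auto
qed

lemma root_unique:
  assumes d: "1 \<le> degree p" and k: "k \<le> length xs"
    and y: "y \<in> nth_interval xs k" "z \<in> nth_interval xs k" "poly p y = 0" "poly p z = 0"
  shows "y = z"
proof -
  have "\<not> u < w" if u: "u \<in> nth_interval xs k" "w \<in> nth_interval xs k" "poly p u = 0" "poly p w = 0" for u w
  proof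
    assume "u < w"
    then have "isgn (poly p w - poly p u) = isgn (poly (pderiv p) u)"
      using nth_interval_convex[OF u(1,2)] by (intro isgn_difference[OF d k]) (auto simp: u)
    then show False using isgn_derivative_const(2)[OF d k u(1,1)] u by simp
  qed
  then show ?thesis using y by (metis linorder_less_linear)
qed

definition root :: "nat \<Rightarrow> 'r" where
  "root k = (SOME y. y \<in> nth_interval xs k \<and> poly p y = 0)"

lemma no_root_sign:
  assumes d: "1 \<le> degree p" and k: "k \<le> length xs" and y: "y \<in> nth_interval xs k"
    and nz: "\<And>z. z \<in> nth_interval xs k \<Longrightarrow> poly p z \<noteq> 0"
  shows "\<not> has_new_root S \<sigma> n T k"
    "isgn (poly p y) = (if left_sign S \<sigma> n T k = 0 then right_sign S \<sigma> n T k else left_sign S \<sigma> n T k)"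
proof -
  have L: "left_sign S \<sigma> n T k = 0 \<or> isgn (poly p y) = left_sign S \<sigma> n T k"
    using left_sign_near[OF d k y nz] by blast
  have R: "right_sign S \<sigma> n T k = 0 \<or> isgn (poly p y) = right_sign S \<sigma> n T k"
    using right_sign_near[OF d k y nz] by blast
  show "\<not> has_new_root S \<sigma> n T k"
    using L R isgn_cases[of "poly p y"] by (auto simp: has_new_root_def)
  have p0: "p \<noteq> 0" using d by auto
  \<comment> \<open>The sign is read off from an end where it is nonzero. The sign at an infinite
    end is never 0, and zeros at two finite ends would contradict monotonicity.\<close>
  have False if 0: "left_sign S \<sigma> n T k = 0" "right_sign S \<sigma> n T k = 0"
  proof -
    have 1: "0 < k" "k < length xs" "poly p (xs ! (k - 1)) = 0" "poly p (xs ! k) = 0"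
      using 0 p0 k left_sign_eq[OF d k] right_sign_eq[OF d k] by (auto split: if_splits)
    then have "isgn (poly p (xs ! k) - poly p (xs ! (k - 1))) = isgn (poly (pderiv p) y)"
      using y by (intro isgn_difference[OF d k]) (auto simp: nth_interval_def)
    then show False using isgn_derivative_const(2)[OF d k y y] 1 by simp
  qed
  then show "isgn (poly p y) = (if left_sign S \<sigma> n T k = 0 then right_sign S \<sigma> n T k else left_sign S \<sigma> n T k)"
    using L R by auto
qed

text \<open>Without a root inside, the end signs cannot be opposite by \<open>no_root_sign\<close>.
  With one, monotonicity gives opposite signs at points u and w on its two sides, and these are the
  signs at the ends.\<close>

lemma has_new_root_iff:
  assumes d: "1 \<le> degree p" and k: "k \<le> length xs"
  shows "has_new_root S \<sigma> n T k \<longleftrightarrow> (\<exists>y\<in>nth_interval xs k. poly p y = 0)"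
proof
  assume h: "has_new_root S \<sigma> n T k"
  obtain y where "y \<in> nth_interval xs k" using nth_interval_nonempty[OF sorted_pts k] by blast
  then show "\<exists>y\<in>nth_interval xs k. poly p y = 0" using no_root_sign(1)[OF d k] h by blast
next
  assume "\<exists>y\<in>nth_interval xs k. poly p y = 0"
  then obtain y where y: "y \<in> nth_interval xs k" "poly p y = 0" by blast
  obtain u w where u: "u \<in> nth_interval xs k" "u < y" and w: "w \<in> nth_interval xs k" "y < w"
    using nth_interval_open[OF y(1)] by blast
  have uniq: "z = y" if "z \<in> nth_interval xs k" "poly p z = 0" for z
    using root_unique[OF d k that(1) y(1) that(2) y(2)] .
  have p0: "p \<noteq> 0" using d by auto
  have L: "left_sign S \<sigma> n T k = 0 \<or> isgn (poly p u) = left_sign S \<sigma> n T k"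
    using uniq u by (intro left_sign_near[OF d k u(1)]) force
  have R: "right_sign S \<sigma> n T k = 0 \<or> isgn (poly p w) = right_sign S \<sigma> n T k"
    using uniq w by (intro right_sign_near[OF d k w(1)]) force
  have s: "isgn (poly (pderiv p) y) \<noteq> 0" by (rule isgn_derivative_const(2)[OF d k y(1,1)])
  \<comment> \<open>A zero at the end besides the one inside would contradict monotonicity.\<close>
  have L0: "left_sign S \<sigma> n T k \<noteq> 0"
  proof
    assume 0: "left_sign S \<sigma> n T k = 0"
    then have 1: "0 < k" "poly p (xs ! (k - 1)) = 0"
      using p0 left_sign_eq[OF d k] by (auto split: if_splits)
    then have "isgn (poly p y - poly p (xs ! (k - 1))) = isgn (poly (pderiv p) y)"
      using y(1) by (intro isgn_difference[OF d k]) (auto simp: nth_interval_def)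
    then show False using s 1 y by simp
  qed
  have R0: "right_sign S \<sigma> n T k \<noteq> 0"
  proof
    assume 0: "right_sign S \<sigma> n T k = 0"
    then have 1: "k < length xs" "poly p (xs ! k) = 0"
      using p0 right_sign_eq[OF d k] k by (auto split: if_splits)
    then have "isgn (poly p (xs ! k) - poly p y) = isgn (poly (pderiv p) y)"
      using y(1) by (intro isgn_difference[OF d k]) (auto simp: nth_interval_def)
    then show False using s 1 y by simp
  qed
  have "isgn (poly p y - poly p u) = isgn (poly (pderiv p) y)"
    using nth_interval_convex[OF u(1) y(1)] u by (intro isgn_difference[OF d k _ _ y(1)]) auto
  then have "isgn (poly p u) = - isgn (poly (pderiv p) y)"
    using y isgn_minus[of "poly p u"] by simp
  moreover have "isgn (poly p w - poly p y) = isgn (poly (pderiv p) y)"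
    using nth_interval_convex[OF y(1) w(1)] w by (intro isgn_difference[OF d k _ _ y(1)]) auto
  ultimately show "has_new_root S \<sigma> n T k"
    using L L0 R R0 s y isgn_cases[of "poly (pderiv p) y"] by (auto simp: has_new_root_def)
qed

lemma new_root:
  assumes k: "k \<le> length xs" and h: "has_new_root S \<sigma> n T k"
  shows "1 \<le> degree p" "root k \<in> nth_interval xs k" "poly p (root k) = 0"
    "y \<in> nth_interval xs k \<Longrightarrow> poly p y = 0 \<Longrightarrow> y = root k"
    "y \<in> nth_interval xs k \<Longrightarrow> y < root k \<Longrightarrow> isgn (poly p y) = left_sign S \<sigma> n T k"
    "y \<in> nth_interval xs k \<Longrightarrow> root k < y \<Longrightarrow> isgn (poly p y) = right_sign S \<sigma> n T k"
    "left_sign S \<sigma> n T k \<noteq> 0" "right_sign S \<sigma> n T k \<noteq> 0"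
proof -
  show d: "1 \<le> degree p" using degree_zero_case(1)[OF _ k] h by (cases "degree p = 0") auto
  from has_new_root_iff[OF d k] h
  have "\<exists>y. y \<in> nth_interval xs k \<and> poly p y = 0" by (simp add: Bex_def)
  then have "root k \<in> nth_interval xs k \<and> poly p (root k) = 0"
    unfolding root_def by (rule someI_ex)
  then show r: "root k \<in> nth_interval xs k" "poly p (root k) = 0" by auto
  show uniq: "y = root k" if "y \<in> nth_interval xs k" "poly p y = 0" for y
    using root_unique[OF d k that(1) r(1) that(2) r(2)] .
  show nz: "left_sign S \<sigma> n T k \<noteq> 0" "right_sign S \<sigma> n T k \<noteq> 0"
    using h by (auto simp: has_new_root_def)
  show "isgn (poly p y) = left_sign S \<sigma> n T k" if "y \<in> nth_interval xs k" "y < root k"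
    using left_sign_near[OF d k that(1)] uniq that nz by force
  show "isgn (poly p y) = right_sign S \<sigma> n T k" if "y \<in> nth_interval xs k" "root k < y"
    using right_sign_near[OF d k that(1)] uniq that nz by force
qed

lemma no_new_root:
  assumes k: "k \<le> length xs" and h: "\<not> has_new_root S \<sigma> n T k" and y: "y \<in> nth_interval xs k"
  shows "p \<noteq> 0 \<Longrightarrow> poly p y \<noteq> 0"
    "isgn (poly p y) = (if left_sign S \<sigma> n T k = 0 then right_sign S \<sigma> n T k else left_sign S \<sigma> n T k)"
proof -
  have "(p \<noteq> 0 \<longrightarrow> poly p y \<noteq> 0) \<and> isgn (poly p y) = (if left_sign S \<sigma> n T k = 0 then right_sign S \<sigma> n T k else left_sign S \<sigma> n T k)"
  proof (cases "degree p = 0")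
    case True
    then obtain c where "p = [:c:]" using degree_eq_zeroE by blast
    then show ?thesis using degree_zero_case(2,3)[OF True k] by simp
  next
    case False
    then have d: "1 \<le> degree p" by simp
    have "poly p z \<noteq> 0" if "z \<in> nth_interval xs k" for z
      using h has_new_root_iff[OF d k] that by blast
    then show ?thesis using no_root_sign(2)[OF d k y] y by blast
  qed
  then show "p \<noteq> 0 \<Longrightarrow> poly p y \<noteq> 0"
    "isgn (poly p y) = (if left_sign S \<sigma> n T k = 0 then right_sign S \<sigma> n T k else left_sign S \<sigma> n T k)"
    by auto
qed

subsection \<open>The points of the new tableau\<close>

definition new_roots :: "nat \<Rightarrow> 'r list" where
  "new_roots k = (if has_new_root S \<sigma> n T k then [root k] else [])"

text \<open>What the intervals 0, ..., K - 1 contribute, each with its right end: for K > 0 the last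
  entry is the old point K - 1. The inductions run over these prefixes.\<close>

definition pre_points :: "nat \<Rightarrow> 'r list" where
  "pre_points K = concat (map (\<lambda>k. new_roots k @ [xs ! k]) [0..<K])"

lemma pre_points_simps [simp]: "pre_points 0 = []"
  "pre_points (Suc K) = pre_points K @ new_roots K @ [xs ! K]"
  by (auto simp: pre_points_def)

lemma root_bounds:
  assumes "k \<le> length xs" "has_new_root S \<sigma> n T k"
  shows "0 < k \<Longrightarrow> xs ! (k - 1) < root k" "k < length xs \<Longrightarrow> root k < xs ! k"
  using new_root(2)[OF assms] by (auto simp: nth_interval_def)

lemma sorted_pre_points:
  "K \<le> length xs \<Longrightarrow> sorted_wrt (<) (pre_points K) \<and> (\<forall>z\<in>set (pre_points K). 0 < K \<and> z \<le> xs ! (K - 1))"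
proof (induction K)
  case (Suc K)
  then have IH: "sorted_wrt (<) (pre_points K)" "\<And>z. z \<in> set (pre_points K) \<Longrightarrow> 0 < K \<and> z \<le> xs ! (K - 1)"
    by auto
  have lt: "z < xs ! K" if "z \<in> set (pre_points K)" for z
  proof -
    have "xs ! (K - 1) < xs ! K" if "0 < K"
      using that Suc.prems sorted_wrt_nth_less[OF sorted_pts, of "K - 1" K] by simp
    then show ?thesis using IH(2)[OF that] by auto
  qed
  have lt': "z < root K" if "z \<in> set (pre_points K)" "has_new_root S \<sigma> n T K" for z
    using IH(2)[OF that(1)] root_bounds(1)[of K] Suc.prems that(2) by force
  show ?case
    using IH lt lt' root_bounds(2)[of K] Suc.prems
    by (auto simp: sorted_wrt_append new_roots_def intro: less_imp_le)
qed simp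

lemma set_pre_points: "set (pre_points K) = (!) xs ` {..<K} \<union> {root k |k. k < K \<and> has_new_root S \<sigma> n T k}"
  by (auto simp: pre_points_def new_roots_def split: if_splits)

lemma pts_Suc: "pts (Suc n) = pre_points (length xs) @ new_roots (length xs)"
  unfolding pts_def
proof (rule all_roots_eqI, unfold pts_def[symmetric])
  note s = sorted_pre_points[OF order_refl]
  show "sorted_wrt (<) (pre_points (length xs) @ new_roots (length xs))"
    using s root_bounds(1)[of "length xs"] by (force simp: sorted_wrt_append new_roots_def)
  have 1: "set (pre_points (length xs) @ new_roots (length xs)) =
     set xs \<union> {root k |k. k \<le> length xs \<and> has_new_root S \<sigma> n T k}"
    using nth_image[of "length xs" xs]
    by (auto simp: set_pre_points new_roots_def le_less atLeast0LessThan split: if_splits)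
  have 2: "{x. \<exists>F\<in>set (take (Suc n) fs). F \<noteq> 0 \<and> poly F x = 0} =
     set xs \<union> {x. p \<noteq> 0 \<and> poly p x = 0}"
    using n set_all_roots[of "take n fs"] by (auto simp: take_Suc_conv_app_nth pts_def)
  have 3: "x \<in> set xs \<union> {root k |k. k \<le> length xs \<and> has_new_root S \<sigma> n T k}"
    if x: "p \<noteq> 0" "poly p x = 0" for x
  proof (cases "x \<in> set xs")
    case False
    then obtain k where k: "k \<le> length xs" "x \<in> nth_interval xs k" using nth_interval_cover by blast
    then have "has_new_root S \<sigma> n T k" using no_new_root(1)[OF k(1) _ k(2)] x by blast
    then show ?thesis using new_root(4)[OF k(1) _ k(2) x(2)] k by blast
  qed simp
  have 4: "p \<noteq> 0 \<and> poly p (root k) = 0" if "k \<le> length xs" "has_new_root S \<sigma> n T k" for k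
    using new_root(1,3)[OF that] by auto
  show "set (pre_points (length xs) @ new_roots (length xs)) =
     {x. \<exists>F\<in>set (take (Suc n) fs). F \<noteq> 0 \<and> poly F x = 0}"
    unfolding 1 2 using 3 4 by blast
qed

subsection \<open>The valuations at a new root\<close>

lemma taylor_order_eq: "taylor_order S T k j e i = torder (expand_left S T k j) e i"
  by (simp add: taylor_order_def torder_def)

lemma sum_list_Suc: "(\<Sum>i\<leftarrow>[1..<Suc d]. f i) = (\<Sum>i<d. f (Suc i))"
proof -
  have "[1..<Suc d] = map Suc [0..<d]" by (simp add: map_Suc_upt)
  then show ?thesis by (simp add: interv_sum_list_conv_sum_set_nat atLeast0LessThan comp_def del: upt_Suc)
qed

lemma sum_list_upt: "(\<Sum>i\<leftarrow>[0..<d]. f i) = (\<Sum>i<d. f i)"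
  by (simp add: interv_sum_list_conv_sum_set_nat atLeast0LessThan)

context
  fixes k :: nat
  assumes k: "k \<le> length xs" and h: "has_new_root S \<sigma> n T k"
begin

lemmas root_in = new_root(2)[OF k h] and root_zero = new_root(3)[OF k h] and degree_pos = new_root(1)[OF k h]

lemma p_nonzero: "p \<noteq> 0"
  using degree_pos by auto

lemma poly_endpoint_nonzero:
  "0 < k \<Longrightarrow> poly p (xs ! (k - 1)) \<noteq> 0" "k < length xs \<Longrightarrow> poly p (xs ! k) \<noteq> 0"
  using new_root(7,8)[OF k h] left_sign_eq[OF degree_pos k] right_sign_eq[OF degree_pos k] by auto

context
  assumes inner: "0 < k" "k < length xs"
begin

abbreviation (input) "a \<equiv> xs ! (k - 1)"
abbreviation (input) "b \<equiv> xs ! k"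
abbreviation (input) "el \<equiv> expand_left S T k"

lemma interval_inner: "y \<in> nth_interval xs k \<longleftrightarrow> a < y \<and> y < b"
  using inner by (auto simp: nth_interval_def)

lemma endpoints_less: "a < b"
  using sorted_wrt_nth_less[OF sorted_pts, of "k - 1" k] inner by simp

lemma gap_inner: "val_rep (gaps T ! (k - 1)) (b - a)"
  using gap[of "k - 1"] inner by simp

lemma taylor_coeff_rep:
  assumes "j \<le> n" "i \<le> degree (fs ! j)" "fs ! j \<noteq> 0" "j < n \<or> 1 \<le> i"
  shows "val_rep (taylor_coeff S T k j i) (\<bar>poly ((pderiv ^^ i) (fs ! j)) (endpoint a b (el j i))\<bar> * (b - a) ^ i)"
proof -
  define c where "c = (if el j i then k - 1 else k)"
  have c: "c < length xs" "xs ! c = endpoint a b (el j i)" using inner by (auto simp: c_def endpoint_def)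
  have "val_rep (vals T ! c ! iter_deriv S j i) (poly ((pderiv ^^ i) (fs ! j)) (endpoint a b (el j i)))"
    using point_val[OF c(1) derivative_on_interval(1)[OF assms]] derivative_on_interval(2)[OF assms] c(2) by simp
  then show ?thesis
    using val_rep_mult[of _ "\<bar>poly ((pderiv ^^ i) (fs ! j)) (endpoint a b (el j i))\<bar>", OF _ gap_inner, of _ i] endpoints_less
    by (simp add: taylor_coeff_def c_def[symmetric] val_rep_abs)
qed

text \<open>Since p vanishes at the root, its increment from the end \<open>e\<close> is, up to
  sign, the known value of p at that end. Its comparability with a sum of monomials in the ratio is
  an equation for the valuation of the ratio, which \<open>val_rep_max\<close> solves.\<close>

lemma ratio_val_rep: "val_rep (ratio_val S \<sigma> n T k e) (ratio a b e (root k))"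
proof -
  have r: "a < root k" "root k < b" using root_in interval_inner by auto
  have nz: "poly ((pderiv ^^ Suc i) p) y \<noteq> 0" if "i < degree p" "a < y" "y < b" for i y
    using derivative_on_interval(3)[of n "Suc i" k y] that k p_nonzero interval_inner by simp
  have el: "el n (Suc i) \<longleftrightarrow> 0 \<le> isgn (poly ((pderiv ^^ Suc i) p) y) * isgn (poly ((pderiv ^^ Suc (Suc i)) p) y)"
    if "Suc i < degree p" "a < y" "y < b" for i y
    using expand_left_iff[of n "Suc i" k y] that k interval_inner by simp
  obtain N where N: "comparable N \<bar>poly p (root k) - poly p (endpoint a b e)\<bar>
      (\<Sum>i<degree p. taylor_term p a b (el n) e (root k) (Suc i))"
    using taylor_difference_comparable[where Q = p and el = "el n" and e = e, OF endpoints_less nz el] r by blast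
  define \<beta> where "\<beta> i = \<bar>poly ((pderiv ^^ i) p) (endpoint a b (el n i))\<bar> * (b - a) ^ i" for i
  define c where "c = (if e then k - 1 else k)"
  have c: "c < length xs" "xs ! c = endpoint a b e" using inner by (auto simp: c_def endpoint_def)
  have "val_rep (qreduce QMax (map (\<lambda>i. let q = 1 / of_nat (torder (el n) e i) in
      qlin q (val_at S \<sigma> n T c) (- q) (taylor_coeff S T k n i)) [1..<Suc (degree p)])) (ratio a b e (root k))"
  proof (rule val_rep_max)
    show "val_rep (val_at S \<sigma> n T c) (poly p (xs ! c))" using val_at[OF c(1)] .
    show "poly p (xs ! c) \<noteq> 0" using poly_endpoint_nonzero inner by (simp add: c_def)
    show "0 < ratio a b e (root k)" using ratio_bounds(1)[OF endpoints_less r] .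
    show "comparable N \<bar>poly p (xs ! c)\<bar> (\<Sum>i\<leftarrow>[1..<Suc (degree p)]. \<beta> i * ratio a b e (root k) ^ torder (el n) e i)"
      using N unfolding sum_list_Suc c(2) taylor_term_def \<beta>_def root_zero by simp
    show "val_rep (taylor_coeff S T k n i) (\<beta> i) \<and> 0 \<le> \<beta> i \<and> 0 < torder (el n) e i"
      if "i \<in> set [1..<Suc (degree p)]" for i
    proof (intro conjI)
      show "val_rep (taylor_coeff S T k n i) (\<beta> i)"
        unfolding \<beta>_def using that p_nonzero by (intro taylor_coeff_rep) auto
      show "0 \<le> \<beta> i" using endpoints_less by (simp add: \<beta>_def)
      show "0 < torder (el n) e i" using that by (simp add: torder_def del: upt_Suc)
    qed
  qed
  then show ?thesis using n by (simp add: ratio_val_def taylor_order_eq deg_of c_def del: upt_Suc)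
qed

text \<open>An earlier polynomial and its derivatives have no zeros on the interval, so its value at
  the root can be expanded directly; the end chosen by \<open>expand_left S T k j 0\<close> decides
  which of the two ratios enters.\<close>

lemma val_at_new_root_inner:
  assumes j: "j < n" "1 \<le> degree (fs ! j)"
  shows "val_rep (val_at_new_root S \<sigma> n T k j) (poly (fs ! j) (root k))"
proof -
  define Q where "Q = fs ! j"
  have Q0: "Q \<noteq> 0" using j by (auto simp: Q_def)
  have r: "a < root k" "root k < b" using root_in interval_inner by auto
  have nz: "poly ((pderiv ^^ i) Q) y \<noteq> 0" if "i \<le> degree Q" "a < y" "y < b" for i y
    using derivative_on_interval(3)[of j i k y] that k Q0 interval_inner j by (simp add: Q_def)
  have el: "el j i \<longleftrightarrow> 0 \<le> isgn (poly ((pderiv ^^ i) Q) y) * isgn (poly ((pderiv ^^ Suc i) Q) y)"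
    if "i < degree Q" "a < y" "y < b" for i y
    using expand_left_iff[of j i k y] that k interval_inner j by (simp add: Q_def)
  obtain N where N: "comparable N \<bar>poly Q (root k)\<bar>
      (\<Sum>i<Suc (degree Q). taylor_term Q a b (el j) (el j 0) (root k) i)"
    using taylor_comparable[where Q = Q and el = "el j", OF endpoints_less nz el] r by blast
  have pos: "0 < ratio a b e (root k)" for e using ratio_bounds(1)[OF endpoints_less r] .
  have tt: "val_rep (qlin 1 (taylor_coeff S T k j i) (of_nat (torder (el j) (el j 0) i)) (ratio_val S \<sigma> n T k (el j 0)))
      (taylor_term Q a b (el j) (el j 0) (root k) i) \<and> 0 \<le> taylor_term Q a b (el j) (el j 0) (root k) i"
    if "i \<in> set [0..<Suc (degree Q)]" for i
  proof
    have "val_rep (taylor_coeff S T k j i) (\<bar>poly ((pderiv ^^ i) Q) (endpoint a b (el j i))\<bar> * (b - a) ^ i)"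
      unfolding Q_def using that j Q0 by (intro taylor_coeff_rep) (auto simp: Q_def)
    then show "val_rep (qlin 1 (taylor_coeff S T k j i) (of_nat (torder (el j) (el j 0) i)) (ratio_val S \<sigma> n T k (el j 0)))
      (taylor_term Q a b (el j) (el j 0) (root k) i)"
      unfolding taylor_term_def using pos[of "el j 0"] by (intro val_rep_mult ratio_val_rep) auto
    show "0 \<le> taylor_term Q a b (el j) (el j 0) (root k) i"
      using endpoints_less pos[of "el j 0"] by (simp add: taylor_term_def)
  qed
  have rs: "val_rep (qreduce QMin (map (\<lambda>i. qlin 1 (taylor_coeff S T k j i) (of_nat (torder (el j) (el j 0) i))
      (ratio_val S \<sigma> n T k (el j 0))) [0..<Suc (degree Q)]))
      (\<Sum>i<Suc (degree Q). taylor_term Q a b (el j) (el j 0) (root k) i)" (is "val_rep ?t ?s")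
    unfolding sum_list_upt[symmetric] by (rule val_rep_sum) (rule tt)
  have "0 \<le> ?s" using N by (simp add: comparable_def)
  then have "comparable N \<bar>?s\<bar> \<bar>poly Q (root k)\<bar>" using N by (simp add: comparable_def)
  then have "val_rep ?t (poly Q (root k))" by (rule val_rep_comparable[OF rs])
  moreover have "val_at_new_root S \<sigma> n T k j = ?t"
    using j n inner by (simp add: val_at_new_root_def deg_of taylor_order_eq length_point_signs Q_def Let_def del: upt_Suc)
  ultimately show ?thesis by (simp add: Q_def)
qed

end

context
  assumes outer: "k = 0 \<or> k = length xs" and points: "xs \<noteq> []"
begin

text \<open>The index of the finite end of the unbounded interval.\<close>

abbreviation (input) "ci \<equiv> (if k = 0 then 0 else k - 1)"
abbreviation (input) "c \<equiv> xs ! ci"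

lemma ci: "ci < length xs"
  using outer points by (auto simp: neq_Nil_conv)

text \<open>Treats both unbounded intervals at once: the distance to the finite end replaces the
  ratio, and the exponents are those of the ordinary Taylor formula.\<close>

lemma taylor_outer:
  assumes nz: "\<And>i y. i < degree Q \<Longrightarrow> y \<in> nth_interval xs k \<Longrightarrow> poly ((pderiv ^^ Suc i) Q) y \<noteq> 0"
  shows "\<exists>N. comparable N \<bar>poly Q (root k) - poly Q c\<bar>
      (\<Sum>i<degree Q. \<bar>poly ((pderiv ^^ Suc i) Q) c\<bar> * \<bar>root k - c\<bar> ^ Suc i)"
    and "(\<And>y. y \<in> nth_interval xs k \<Longrightarrow> poly Q y \<noteq> 0) \<Longrightarrow>
      \<exists>N. comparable N \<bar>poly Q (root k)\<bar> (\<Sum>i<Suc (degree Q). \<bar>poly ((pderiv ^^ i) Q) c\<bar> * \<bar>root k - c\<bar> ^ i)"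
proof -
  have *: "(\<forall>y. y \<in> nth_interval xs k \<longleftrightarrow> y < c) \<or> (\<forall>y. y \<in> nth_interval xs k \<longleftrightarrow> c < y)"
    using outer points by (cases "k = 0") (auto simp: nth_interval_def)
  show "\<exists>N. comparable N \<bar>poly Q (root k) - poly Q c\<bar>
      (\<Sum>i<degree Q. \<bar>poly ((pderiv ^^ Suc i) Q) c\<bar> * \<bar>root k - c\<bar> ^ Suc i)"
    using *
  proof
    assume I: "\<forall>y. y \<in> nth_interval xs k \<longleftrightarrow> y < c"
    then have r: "root k < c" using root_in by simp
    show ?thesis using taylor_ray_left(1)[of Q c "root k"] nz I r by simp
  next
    assume I: "\<forall>y. y \<in> nth_interval xs k \<longleftrightarrow> c < y"
    then have r: "c < root k" using root_in by simp
    show ?thesis using taylor_ray_right(1)[of Q c "root k"] nz I r by simp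
  qed
  assume nz': "\<And>y. y \<in> nth_interval xs k \<Longrightarrow> poly Q y \<noteq> 0"
  show "\<exists>N. comparable N \<bar>poly Q (root k)\<bar> (\<Sum>i<Suc (degree Q). \<bar>poly ((pderiv ^^ i) Q) c\<bar> * \<bar>root k - c\<bar> ^ i)"
    using *
  proof
    assume I: "\<forall>y. y \<in> nth_interval xs k \<longleftrightarrow> y < c"
    then have r: "root k < c" using root_in by simp
    show ?thesis using taylor_ray_left(2)[of Q c "root k"] nz nz' I r by simp
  next
    assume I: "\<forall>y. y \<in> nth_interval xs k \<longleftrightarrow> c < y"
    then have r: "c < root k" using root_in by simp
    show ?thesis using taylor_ray_right(2)[of Q c "root k"] nz nz' I r by simp
  qed
qed

lemma point_deriv_val:
  assumes "j \<le> n" "i \<le> degree (fs ! j)" "fs ! j \<noteq> 0" "j < n \<or> 1 \<le> i"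
  shows "val_rep (vals T ! ci ! iter_deriv S j i) \<bar>poly ((pderiv ^^ i) (fs ! j)) c\<bar>"
  using point_val[OF ci derivative_on_interval(1)[OF assms]] derivative_on_interval(2)[OF assms]
  by (simp add: val_rep_abs)

lemma distance_pos: "0 < \<bar>root k - c\<bar>"
proof -
  have "c \<notin> nth_interval xs k" using outer points by (cases "k = 0") (auto simp: nth_interval_def)
  then show ?thesis using root_in by auto
qed

lemma outer_val_rep: "val_rep (outer_val S \<sigma> n T ci) \<bar>root k - c\<bar>"
proof -
  have nz: "poly ((pderiv ^^ Suc i) p) y \<noteq> 0" if "i < degree p" "y \<in> nth_interval xs k" for i y
    using derivative_on_interval(3)[of n "Suc i" k y] that k p_nonzero by simp
  obtain N where N: "comparable N \<bar>poly p (root k) - poly p c\<bar>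
      (\<Sum>i<degree p. \<bar>poly ((pderiv ^^ Suc i) p) c\<bar> * \<bar>root k - c\<bar> ^ Suc i)"
    using taylor_outer(1)[OF nz] by blast
  have "val_rep (qreduce QMax (map (\<lambda>i. let q = 1 / of_nat i in
      qlin q (val_at S \<sigma> n T ci) (- q) (vals T ! ci ! iter_deriv S n i)) [1..<Suc (degree p)])) \<bar>root k - c\<bar>"
  proof (rule val_rep_max)
    show "val_rep (val_at S \<sigma> n T ci) (poly p c)" using val_at[OF ci] .
    show "poly p c \<noteq> 0" using poly_endpoint_nonzero outer points by (cases "k = 0") auto
    show "0 < \<bar>root k - c\<bar>" by (rule distance_pos)
    show "comparable N \<bar>poly p c\<bar> (\<Sum>i\<leftarrow>[1..<Suc (degree p)]. \<bar>poly ((pderiv ^^ i) p) c\<bar> * \<bar>root k - c\<bar> ^ i)"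
      using N unfolding sum_list_Suc root_zero by simp
    show "val_rep (vals T ! ci ! iter_deriv S n i) \<bar>poly ((pderiv ^^ i) p) c\<bar> \<and> 0 \<le> \<bar>poly ((pderiv ^^ i) p) c\<bar> \<and> 0 < i"
      if "i \<in> set [1..<Suc (degree p)]" for i
    proof (intro conjI)
      show "val_rep (vals T ! ci ! iter_deriv S n i) \<bar>poly ((pderiv ^^ i) p) c\<bar>"
        using that p_nonzero by (intro point_deriv_val) auto
    qed (use that in auto)
  qed
  then show ?thesis using n by (simp add: outer_val_def deg_of del: upt_Suc)
qed

lemma val_at_new_root_outer:
  assumes j: "j < n" "1 \<le> degree (fs ! j)"
  shows "val_rep (val_at_new_root S \<sigma> n T k j) (poly (fs ! j) (root k))"
proof -
  define Q where "Q = fs ! j"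
  have Q0: "Q \<noteq> 0" using j by (auto simp: Q_def)
  have nz: "poly ((pderiv ^^ i) Q) y \<noteq> 0" if "i \<le> degree Q" "y \<in> nth_interval xs k" for i y
    using derivative_on_interval(3)[of j i k y] that k Q0 j by (simp add: Q_def)
  have nz': "poly ((pderiv ^^ Suc i) Q) y \<noteq> 0" if "i < degree Q" "y \<in> nth_interval xs k" for i y
    using nz[of "Suc i"] that by simp
  have nz'': "poly Q y \<noteq> 0" if "y \<in> nth_interval xs k" for y
    using nz[of 0] that by simp
  obtain N where N: "comparable N \<bar>poly Q (root k)\<bar>
      (\<Sum>i<Suc (degree Q). \<bar>poly ((pderiv ^^ i) Q) c\<bar> * \<bar>root k - c\<bar> ^ i)"
    using taylor_outer(2)[OF nz' nz''] by blast
  have tt: "val_rep (qlin 1 (vals T ! ci ! iter_deriv S j i) (of_nat i) (outer_val S \<sigma> n T ci))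
      (\<bar>poly ((pderiv ^^ i) Q) c\<bar> * \<bar>root k - c\<bar> ^ i) \<and> 0 \<le> \<bar>poly ((pderiv ^^ i) Q) c\<bar> * \<bar>root k - c\<bar> ^ i"
    if "i \<in> set [0..<Suc (degree Q)]" for i
  proof
    have "val_rep (vals T ! ci ! iter_deriv S j i) \<bar>poly ((pderiv ^^ i) Q) c\<bar>"
      unfolding Q_def using that j Q0 by (intro point_deriv_val) (auto simp: Q_def)
    then show "val_rep (qlin 1 (vals T ! ci ! iter_deriv S j i) (of_nat i) (outer_val S \<sigma> n T ci))
      (\<bar>poly ((pderiv ^^ i) Q) c\<bar> * \<bar>root k - c\<bar> ^ i)"
      using distance_pos by (intro val_rep_mult outer_val_rep) auto
  qed simp
  have rs: "val_rep (qreduce QMin (map (\<lambda>i. qlin 1 (vals T ! ci ! iter_deriv S j i) (of_nat i) (outer_val S \<sigma> n T ci))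
      [0..<Suc (degree Q)])) (\<Sum>i<Suc (degree Q). \<bar>poly ((pderiv ^^ i) Q) c\<bar> * \<bar>root k - c\<bar> ^ i)" (is "val_rep ?t ?s")
    unfolding sum_list_upt[symmetric] by (rule val_rep_sum) (rule tt)
  have "0 \<le> ?s" using N by (simp only: comparable_def)
  then have "comparable N \<bar>?s\<bar> \<bar>poly Q (root k)\<bar>" using N by (simp only: comparable_def abs_of_nonneg)
  then have "val_rep ?t (poly Q (root k))" by (rule val_rep_comparable[OF rs])
  moreover have "(0 < k \<and> k < length xs) = False" using outer by auto
  then have "val_at_new_root S \<sigma> n T k j = ?t"
    using j n unfolding val_at_new_root_def Let_def length_point_signs by (simp only: if_False) (simp add: deg_of Q_def del: upt_Suc)
  ultimately show ?thesis by (simp add: Q_def)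
qed

end

lemma val_at_new_root_rep:
  assumes j: "j < n"
  shows "val_rep (val_at_new_root S \<sigma> n T k j) (poly (fs ! j) (root k))"
proof (cases "degree (fs ! j) = 0")
  case True
  then show ?thesis using j n val_rep_const[of j] by (simp add: val_at_new_root_def deg_of)
next
  case False
  then have d: "1 \<le> degree (fs ! j)" by simp
  show ?thesis
  proof (cases "0 < k \<and> k < length xs")
    case True
    then show ?thesis using val_at_new_root_inner[OF _ _ j d] by blast
  next
    case False
    then have "k = 0 \<or> k = length xs" using k by auto
    \<comment> \<open>The nonconstant member \<open>fs ! j\<close> guarantees that some point
      exists, so the unbounded interval has a finite end.\<close>
    then show ?thesis using val_at_new_root_outer[OF _ points_exist[OF j d] j d] by blast
  qed
qed

end

subsection \<open>The new tableau\<close>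

lemma signs_Suc: "signs (Suc n) y = signs n y @ [isgn (poly p y)]"
  using n by (simp add: signs_def take_Suc_conv_app_nth)

lemma point_signs_nth: "k < length xs \<Longrightarrow> point_signs T ! k = signs n (xs ! k)"
  using rep by (simp add: rep_def)

definition point_rep :: "int list \<times> 'c qterm option list \<Rightarrow> 'r \<Rightarrow> bool" where
  "point_rep sw y \<longleftrightarrow> fst sw = signs (Suc n) y \<and>
     list_all2 (\<lambda>t F. val_rep t (poly F y)) (snd sw) (take (Suc n) fs)"

lemma new_points_rep:
  assumes k: "k \<le> length xs"
  shows "list_all2 point_rep (new_points S \<sigma> n T k) (new_roots k @ (if k < length xs then [xs ! k] else []))"
proof -
  have 1: "point_rep (interval_signs T ! k @ [0], map (val_at_new_root S \<sigma> n T k) [0..<n] @ [None]) (root k)"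
    if h: "has_new_root S \<sigma> n T k"
  proof -
    have "list_all2 (\<lambda>t F. val_rep t (poly F (root k))) (map (val_at_new_root S \<sigma> n T k) [0..<n]) (take n fs)"
      using n val_at_new_root_rep[OF k h] by (simp add: list_all2_conv_all_nth)
    then show ?thesis
      using new_root(2,3)[OF k h] interval_sign[OF k, of "root k"] n
      by (simp add: point_rep_def signs_Suc take_Suc_conv_app_nth list_all2_appendI)
  qed
  have 2: "point_rep (point_signs T ! k @ [sign_at S \<sigma> n T k], vals T ! k @ [val_at S \<sigma> n T k]) (xs ! k)"
    if k: "k < length xs"
  proof -
    have "list_all2 (\<lambda>t F. val_rep t (poly F (xs ! k))) (vals T ! k) (take n fs)"
      using rep k list_all2_nthD2[of "\<lambda>w y. list_all2 (\<lambda>t F. val_rep t (poly F y)) w (take n fs)" "vals T" xs k]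
      by (simp add: rep_def)
    then show ?thesis
      using k n sign_at[OF k] val_at[OF k]
      by (simp add: point_rep_def signs_Suc take_Suc_conv_app_nth list_all2_appendI point_signs_nth)
  qed
  show ?thesis using 1 2 by (auto simp: new_points_def new_roots_def length_point_signs)
qed

abbreviation (input) "lo k \<equiv> (if k = 0 then None else Some (xs ! (k - 1)))"
abbreviation (input) "hi k \<equiv> (if k < length xs then Some (xs ! k) else None)"

lemma new_intervals_ok:
  assumes k: "k \<le> length xs"
  shows "signs_ok (signs (Suc n)) (lo k) (new_roots k) (hi k) (new_intervals S \<sigma> n T k)"
proof (cases "has_new_root S \<sigma> n T k")
  case True
  note R = new_root[OF k True]
  have 1: "interval_signs T ! k @ [left_sign S \<sigma> n T k] = signs (Suc n) y" if "between (lo k) (Some (root k)) y" for y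
  proof -
    have "y \<in> nth_interval xs k" "y < root k"
      using that R(2) unfolding in_nth_interval_iff by (auto simp: between_def)
    then show ?thesis using interval_sign[OF k] R(5) by (simp add: signs_Suc)
  qed
  have 2: "interval_signs T ! k @ [right_sign S \<sigma> n T k] = signs (Suc n) y" if "between (Some (root k)) (hi k) y" for y
  proof -
    have "y \<in> nth_interval xs k" "root k < y"
      using that R(2) unfolding in_nth_interval_iff by (auto simp: between_def)
    then show ?thesis using interval_sign[OF k] R(6) by (simp add: signs_Suc)
  qed
  show ?thesis using True 1 2 by (simp add: new_intervals_def new_roots_def Let_def)
next
  case False
  have "interval_signs T ! k @ [if left_sign S \<sigma> n T k = 0 then right_sign S \<sigma> n T k else left_sign S \<sigma> n T k] = signs (Suc n) y"
    if "between (lo k) (hi k) y" for y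
    using that interval_sign[OF k] no_new_root(2)[OF k False] unfolding in_nth_interval_iff[symmetric]
    by (simp add: signs_Suc)
  then show ?thesis using False by (simp add: new_intervals_def new_roots_def Let_def)
qed

text \<open>The left end is put in front so that the gap reaching back to it belongs to this
  interval; thus every gap of the new tableau is counted once.\<close>

lemma new_gaps_rep:
  assumes k: "k \<le> length xs"
  shows "list_all2 val_rep (new_gaps S \<sigma> n T k)
    (diffs ((if k = 0 then [] else [xs ! (k - 1)]) @ new_roots k @ (if k < length xs then [xs ! k] else [])))"
proof (cases "has_new_root S \<sigma> n T k")
  case False
  then show ?thesis using gap[of "k - 1"] k
    by (auto simp: new_gaps_def new_roots_def Let_def length_point_signs)
next
  case h: True
  show ?thesis
  proof (cases "0 < k \<and> k < length xs")
    case True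
    then have i: "0 < k" "k < length xs" by auto
    define a b where "a = xs ! (k - 1)" and "b = xs ! k"
    have ab: "a < b" "val_rep (gaps T ! (k - 1)) (b - a)"
      using endpoints_less[OF k h i] gap_inner[OF k h i] by (auto simp: a_def b_def)
    have r: "a < root k" "root k < b" using root_bounds[OF k h] i by (auto simp: a_def b_def)
    have R: "val_rep (ratio_val S \<sigma> n T k e) (ratio a b e (root k))" for e
      using ratio_val_rep[OF k h i] by (simp add: a_def b_def)
    \<comment> \<open>Multiplying a ratio by b - a gives the distance of the root from the
      respective end.\<close>
    have "val_rep (qlin 1 (gaps T ! (k - 1)) (of_nat 1) (ratio_val S \<sigma> n T k e)) ((b - a) * ratio a b e (root k) ^ 1)" for e
      using ratio_bounds(1)[OF ab(1) r, of e] by (intro val_rep_mult ab R) auto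
    from this[of True] this[of False]
    have "val_rep (qlin 1 (gaps T ! (k - 1)) 1 (ratio_val S \<sigma> n T k True)) (root k - a)"
      "val_rep (qlin 1 (gaps T ! (k - 1)) 1 (ratio_val S \<sigma> n T k False)) (b - root k)"
      using ab by (simp_all add: ratio_def)
    then show ?thesis using i h by (simp add: new_gaps_def new_roots_def Let_def length_point_signs a_def b_def)
  next
    case False
    then have o: "k = 0 \<or> k = length xs" using k by auto
    show ?thesis
    proof (cases "xs = []")
      case True
      then show ?thesis using k h by (simp add: new_gaps_def new_roots_def Let_def length_point_signs)
    next
      case ne: False
      note O = outer_val_rep[OF k h o ne]
      show ?thesis
      proof (cases "k = 0")
        case True
        then have "val_rep (outer_val S \<sigma> n T 0) (xs ! 0 - root k)"
          using O root_bounds(2)[OF k h] ne by simp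
        then show ?thesis using True ne h by (simp add: new_gaps_def new_roots_def Let_def length_point_signs)
      next
        case False
        then have "val_rep (outer_val S \<sigma> n T (k - 1)) (root k - xs ! (k - 1))"
          using O root_bounds(1)[OF k h] by simp
        then show ?thesis using False o ne h by (simp add: new_gaps_def new_roots_def Let_def length_point_signs)
      qed
    qed
  qed
qed

lemma pre_points_snoc: "0 < K \<Longrightarrow> pre_points K = (pre_points (K - 1) @ new_roots (K - 1)) @ [xs ! (K - 1)]"
  by (cases K) auto

text \<open>The list stops short of the old point K, which appears as the upper bound
  \<open>hi K\<close>; the piece of the next interval is glued there.\<close>

lemma intervals_prefix:
  "K \<le> length xs \<Longrightarrow> signs_ok (signs (Suc n)) None (pre_points K @ new_roots K) (hi K)
     (concat (map (new_intervals S \<sigma> n T) [0..<Suc K]))"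
proof (induction K)
  case 0
  then show ?case using new_intervals_ok[of 0] by simp
next
  case (Suc K)
  have "signs_ok (signs (Suc n)) None ((pre_points K @ new_roots K) @ xs ! K # new_roots (Suc K)) (hi (Suc K))
     (concat (map (new_intervals S \<sigma> n T) [0..<Suc K]) @ new_intervals S \<sigma> n T (Suc K))"
    using Suc new_intervals_ok[OF Suc.prems] by (intro signs_ok_append) (auto simp del: upt_Suc)
  then show ?case by simp
qed

lemma gaps_prefix:
  "K \<le> length xs \<Longrightarrow> list_all2 val_rep (concat (map (new_gaps S \<sigma> n T) [0..<K])) (diffs (pre_points K))"
proof (induction K)
  case (Suc K)
  have G: "list_all2 val_rep (new_gaps S \<sigma> n T K) (diffs ((if K = 0 then [] else [xs ! (K - 1)]) @ new_roots K @ [xs ! K]))"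
    using new_gaps_rep[of K] Suc.prems by simp
  \<comment> \<open>For K > 0 the two lists on the right share the old point K - 1, where they are
    glued.\<close>
  have "diffs (pre_points (Suc K)) =
     diffs (pre_points K) @ diffs ((if K = 0 then [] else [xs ! (K - 1)]) @ new_roots K @ [xs ! K])"
  proof (cases "K = 0")
    case False
    then show ?thesis
      using pre_points_snoc[of K] diffs_append[of "pre_points (K - 1) @ new_roots (K - 1)" "xs ! (K - 1)" "new_roots K @ [xs ! K]"]
      by simp
  qed simp
  then show ?case using list_all2_appendI[OF Suc.IH G] Suc.prems by simp
qed simp

lemma rep_Suc: "rep (Suc n) (add_polynomial S \<sigma> n T)"
proof -
  define r where "r = length xs"
  define f where "f k = new_roots k @ (if k < r then [xs ! k] else [])" for k
  have pts: "pts (Suc n) = concat (map f [0..<Suc r])"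
  proof -
    have "concat (map f [0..<r]) = pre_points r"
      unfolding pre_points_def f_def by (intro arg_cong[where f = concat] map_cong) auto
    then show ?thesis by (simp add: pts_Suc r_def[symmetric] f_def)
  qed
  define ks where "ks = [0..<Suc r]"
  have T': "add_polynomial S \<sigma> n T = Tableau (map fst (concat (map (new_points S \<sigma> n T) ks)))
      (concat (map (new_intervals S \<sigma> n T) ks)) (concat (map (new_gaps S \<sigma> n T) ks))
      (map snd (concat (map (new_points S \<sigma> n T) ks)))"
    by (simp add: add_polynomial_def Let_def length_point_signs ks_def r_def)
  have P: "list_all2 point_rep (concat (map (new_points S \<sigma> n T) ks)) (pts (Suc n))"
    unfolding pts ks_def[symmetric]
  proof (rule list_all2_concat_map)
    fix k assume "k \<in> set ks"
    then have "k \<le> length xs" by (auto simp: ks_def r_def)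
    then show "list_all2 point_rep (new_points S \<sigma> n T k) (f k)"
      using new_points_rep[of k] by (simp only: f_def r_def)
  qed
  have 1: "map fst (concat (map (new_points S \<sigma> n T) ks)) = map (signs (Suc n)) (pts (Suc n))"
    using P by (auto simp: list_all2_conv_all_nth point_rep_def intro: nth_equalityI)
  have 2: "list_all2 (\<lambda>w y. list_all2 (\<lambda>t F. val_rep t (poly F y)) w (take (Suc n) fs))
      (map snd (concat (map (new_points S \<sigma> n T) ks))) (pts (Suc n))"
    unfolding list_all2_map1 using P by (rule list_all2_mono) (simp add: point_rep_def)
  have 3: "signs_ok (signs (Suc n)) None (pts (Suc n)) None (concat (map (new_intervals S \<sigma> n T) ks))"
    using intervals_prefix[of r] by (simp add: pts_Suc r_def ks_def del: upt_Suc)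
  \<comment> \<open>\<open>gaps_prefix\<close> ends at the last old point; the last interval has no
    right end and is appended separately.\<close>
  have 4: "list_all2 val_rep (concat (map (new_gaps S \<sigma> n T) ks)) (diffs (pts (Suc n)))"
  proof -
    have G: "list_all2 val_rep (new_gaps S \<sigma> n T r) (diffs ((if r = 0 then [] else [xs ! (r - 1)]) @ new_roots r))"
      using new_gaps_rep[of r] by (simp add: r_def)
    have "diffs (pre_points r @ new_roots r) =
       diffs (pre_points r) @ diffs ((if r = 0 then [] else [xs ! (r - 1)]) @ new_roots r)"
    proof (cases "r = 0")
      case False
      then show ?thesis
        using pre_points_snoc[of r] diffs_append[of "pre_points (r - 1) @ new_roots (r - 1)" "xs ! (r - 1)" "new_roots r"]
        by simp
    qed simp
    then show ?thesis
      using list_all2_appendI[OF gaps_prefix[of r] G] by (simp add: pts_Suc r_def[symmetric] ks_def)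
  qed
  show ?thesis unfolding T' rep_def using 1 2 3 4 by simp
qed

end

lemma (in tableau_model) rep_skeleton_tableau:
  "m \<le> length fs \<Longrightarrow> rep m (skeleton_tableau S \<sigma> m)"
proof (induction m)
  case 0
  show ?case by (rule rep_0)
next
  case (Suc m)
  then interpret tableau_step v V P env A S \<sigma> fs m "skeleton_tableau S \<sigma> m"
    by unfold_locales auto
  show ?case using rep_Suc by simp
qed

subsection \<open>Complete tableaux and subtableaux\<close>

context valuation_terms
begin

text \<open>Mirrors \<open>complete_tableau_of_vscs\<close>, with \<open>val_rep\<close> in place of
  equality of valuations, so that both evaluation and variables can be read off.\<close>

definition rep_tableau :: "'r poly list \<Rightarrow> 'c qterm tableau \<Rightarrow> bool" where
  "rep_tableau Fs T \<longleftrightarrow> (let xs = all_roots Fs in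
     point_signs T = map (\<lambda>y. map (\<lambda>F. isgn (poly F y)) Fs) xs \<and>
     length (interval_signs T) = Suc (length xs) \<and>
     (\<forall>k\<le>length xs. \<forall>y\<in>nth_interval xs k. interval_signs T ! k = map (\<lambda>F. isgn (poly F y)) Fs) \<and>
     list_all2 val_rep (gaps T) (map (\<lambda>k. xs ! Suc k - xs ! k) [0..<length xs - 1]) \<and>
     list_all2 (\<lambda>w y. list_all2 (\<lambda>t F. val_rep t (poly F y)) w Fs) (vals T) xs)"

lemma map_val_rep: "list_all2 (\<lambda>t x. val_rep t (f x)) ts xs \<Longrightarrow> map (map_option (qeval env)) ts = map (\<lambda>x. v (f x)) xs"
  by (induction rule: list_all2_induct) (auto simp: val_rep_v)

lemma vars_val_rep: "list_all2 (\<lambda>t x. val_rep t (f x)) ts xs \<Longrightarrow> Some s \<in> set ts \<Longrightarrow> set_qterm s \<subseteq> A"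
  by (induction rule: list_all2_induct) (auto dest: val_rep_vars)

lemma rep_tableau_complete:
  assumes "rep_tableau Fs T"
  shows "complete_tableau_of_vscs v Fs (map_tableau (qeval env) T)"
proof -
  define xs where "xs = all_roots Fs"
  note R = assms[unfolded rep_tableau_def Let_def, folded xs_def]
  have "map (map_option (qeval env)) (gaps T) = map (\<lambda>k. v (xs ! Suc k - xs ! k)) [0..<length xs - 1]"
  proof -
    have "list_all2 (\<lambda>t k. val_rep t (xs ! Suc k - xs ! k)) (gaps T) [0..<length xs - 1]"
      using R by (simp add: list_all2_map2)
    then show ?thesis by (rule map_val_rep)
  qed
  moreover have "map (map (map_option (qeval env))) (vals T) = map (\<lambda>x. map (\<lambda>F. v (poly F x)) Fs) xs"
  proof -
    have "list_all2 (\<lambda>w y. list_all2 (\<lambda>t F. val_rep t (poly F y)) w Fs) (vals T) xs" using R by blast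
    then show ?thesis
      by (induction rule: list_all2_induct) (auto dest: map_val_rep)
  qed
  ultimately show ?thesis
    using R unfolding complete_tableau_of_vscs_def complete_tableau_of_signs_def Let_def xs_def[symmetric]
    by (simp add: tableau.map_sel)
qed

lemma rep_tableau_vars:
  assumes "rep_tableau Fs T"
  shows "tableau_variables T \<subseteq> A"
proof -
  note R = assms[unfolded rep_tableau_def Let_def]
  have g: "set_qterm s \<subseteq> A" if "Some s \<in> set (gaps T)" for s
    using R vars_val_rep[of "\<lambda>x. x" "gaps T"] that by blast
  have w: "set_qterm s \<subseteq> A" if w: "w \<in> set (vals T)" and s: "Some s \<in> set w" for s w
  proof -
    have "list_all2 (\<lambda>w y. list_all2 (\<lambda>t F. val_rep t (poly F y)) w Fs) (vals T) (all_roots Fs)"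
      using R by blast
    moreover obtain i where i: "i < length (vals T)" "w = vals T ! i"
      using w by (auto simp: in_set_conv_nth)
    ultimately have "list_all2 (\<lambda>t F. val_rep t (poly F (all_roots Fs ! i))) w Fs"
      using list_all2_nthD by fastforce
    then show ?thesis using vars_val_rep[of "\<lambda>F. poly F (all_roots Fs ! i)" w Fs s] s by blast
  qed
  have "set_tableau T = {s. Some s \<in> set (gaps T) \<or> (\<exists>w\<in>set (vals T). Some s \<in> set w)}"
    by (cases T) (force simp: elem_set)
  then show ?thesis unfolding tableau_variables_def using g w by blast
qed

end

context tableau_model
begin

lemma rep_tableau_family: "rep_tableau fs (skeleton_tableau S \<sigma> (length fs))"
proof -
  define T where "T = skeleton_tableau S \<sigma> (length fs)"
  define xs where "xs = all_roots fs"
  have R: "rep (length fs) T" unfolding T_def by (rule rep_skeleton_tableau) simp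
  have s: "signs (length fs) y = map (\<lambda>F. isgn (poly F y)) fs" for y by (simp add: signs_def)
  have x: "pts (length fs) = xs" by (simp add: pts_def xs_def)
  have "length (interval_signs T) = Suc (length xs) \<and>
    (\<forall>k\<le>length xs. \<forall>y\<in>nth_interval xs k. interval_signs T ! k = map (\<lambda>F. isgn (poly F y)) fs)"
    using R signs_ok_nth[of "signs (length fs)" None xs None "interval_signs T"]
    by (simp add: rep_def x in_nth_interval_iff s)
  then show ?thesis
    using R unfolding rep_tableau_def rep_def Let_def T_def[symmetric] xs_def[symmetric] x diffs_conv_nth
    by (simp add: s)
qed

lemma rep_subtableau:
  assumes R: "rep_tableau fs T" and js: "\<And>j. j \<in> set js \<Longrightarrow> j < length fs"
  shows "rep_tableau (map ((!) fs) js) (subtableau S js T)"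
proof -
  define xs where "xs = all_roots fs"
  define Fs where "Fs = map ((!) fs) js"
  note R = R[unfolded rep_tableau_def Let_def, folded xs_def]
  have len: "length (point_signs T) = length xs" using R by simp
  have ps: "point_signs T ! k ! j = isgn (poly (fs ! j) (xs ! k))" if "k < length xs" "j < length fs" for k j
    using R that by simp
  have vl: "val_rep (vals T ! k ! j) (poly (fs ! j) (xs ! k))" if "k < length xs" "j < length fs" for k j
  proof -
    have "list_all2 (\<lambda>t F. val_rep t (poly F (xs ! k))) (vals T ! k) fs"
      using R that(1) list_all2_nthD2[of "\<lambda>w y. list_all2 (\<lambda>t F. val_rep t (poly F y)) w fs" "vals T" xs k] by simp
    then show ?thesis using list_all2_nthD2[of "\<lambda>t F. val_rep t (poly F (xs ! k))" "vals T ! k" fs j] that(2) by simp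
  qed
  have gp: "val_rep (gaps T ! k) (xs ! Suc k - xs ! k)" if "Suc k < length xs" for k
    using R that list_all2_nthD2[of val_rep "gaps T" "map (\<lambda>k. xs ! Suc k - xs ! k) [0..<length xs - 1]" k] by simp
  define ks where "ks = filter (\<lambda>k. \<exists>j\<in>set js. 1 \<le> deg_of S j \<and> point_signs T ! k ! j = 0) [0..<length (point_signs T)]"
  have ks_less: "k < length xs" if "k \<in> set ks" for k using that len by (simp add: ks_def)
  have sxs: "sorted_wrt (<) xs" unfolding xs_def by (rule sorted_all_roots)
  have sks: "sorted_wrt (<) ks" unfolding ks_def by (rule sorted_wrt_filter) simp
  define ys where "ys = map ((!) xs) ks"
  have lys: "length ys = length ks" by (simp add: ys_def)
  have sys: "sorted_wrt (<) ys"
    unfolding ys_def sorted_wrt_map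
    by (rule sorted_wrt_mono_rel[OF _ sks]) (use ks_less sorted_wrt_nth_less[OF sxs] in auto)
  have set_xs: "x \<in> set xs \<longleftrightarrow> (\<exists>F\<in>set fs. F \<noteq> 0 \<and> poly F x = 0)" for x
    by (simp add: xs_def set_all_roots)
  have set_ys: "x \<in> set ys \<longleftrightarrow> (\<exists>F\<in>set Fs. F \<noteq> 0 \<and> poly F x = 0)" for x
  proof
    assume "x \<in> set ys"
    then obtain k j where k: "k < length xs" "x = xs ! k" "j \<in> set js" "1 \<le> deg_of S j" "point_signs T ! k ! j = 0"
      using len by (auto simp: ys_def ks_def)
    then have "fs ! j \<noteq> 0" using deg_of[OF js] by auto
    moreover have "poly (fs ! j) x = 0" using k ps[OF k(1) js] by simp
    moreover have "fs ! j \<in> set Fs" using k by (simp add: Fs_def)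
    ultimately show "\<exists>F\<in>set Fs. F \<noteq> 0 \<and> poly F x = 0" by blast
  next
    assume "\<exists>F\<in>set Fs. F \<noteq> 0 \<and> poly F x = 0"
    then obtain j where j: "j \<in> set js" "fs ! j \<noteq> 0" "poly (fs ! j) x = 0" by (auto simp: Fs_def)
    then have "x \<in> set xs" using js set_xs nth_mem by blast
    then obtain k where k: "k < length xs" "x = xs ! k" by (auto simp: in_set_conv_nth)
    have "degree (fs ! j) \<noteq> 0"
    proof
      assume "degree (fs ! j) = 0"
      then obtain c where "fs ! j = [:c:]" using degree_eq_zeroE by blast
      then show False using j by simp
    qed
    then have "k \<in> set ks" using j k js len ps[OF k(1) js[OF j(1)]] by (auto simp: ks_def deg_of intro!: bexI[of _ j])
    then show "x \<in> set ys" using k by (simp add: ys_def)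
  qed
  have roots: "all_roots Fs = ys"
    by (rule all_roots_eqI[OF sys]) (use set_ys in blast)
  have T': "subtableau S js T = Tableau
        (map (\<lambda>k. map (\<lambda>j. point_signs T ! k ! j) js) ks)
        (map (\<lambda>k. map (\<lambda>j. interval_signs T ! k ! j) js) (0 # map Suc ks))
        (map (\<lambda>i. qreduce QMin (map (\<lambda>k. gaps T ! k) [ks ! i..<ks ! Suc i])) [0..<length ks - 1])
        (map (\<lambda>k. map (\<lambda>j. vals T ! k ! j) js) ks)"
    by (simp add: subtableau_def Let_def ks_def)
  have 1: "map (\<lambda>k. map (\<lambda>j. point_signs T ! k ! j) js) ks = map (\<lambda>y. map (\<lambda>F. isgn (poly F y)) Fs) ys"
    using ps ks_less js by (auto simp: ys_def Fs_def)
  have 2: "(map (\<lambda>k. map (\<lambda>j. interval_signs T ! k ! j) js) (0 # map Suc ks)) ! i = map (\<lambda>F. isgn (poly F y)) Fs"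
    if i: "i \<le> length ys" and y: "y \<in> nth_interval ys i" for i y
  proof -
    \<comment> \<open>The first of the old intervals that merge into the i-th new one. The selected
      polynomials, unless 0, have no root in the merged interval, so their signs at a point z of
      this old interval hold throughout.\<close>
    define K where "K = (0 # map Suc ks) ! i"
    have K: "K = (if i = 0 then 0 else Suc (ks ! (i - 1)))" using i lys by (auto simp: K_def nth_Cons')
    have Kle: "K \<le> length xs" using K i lys ks_less[OF nth_mem, of "i - 1"] by (cases i) auto
    obtain z where z: "z \<in> nth_interval xs K" using nth_interval_nonempty[OF sxs Kle] by blast
    have z': "z \<in> nth_interval ys i"
    proof -
      have "ys ! (i - 1) < z" if "0 < i"
        using z that i lys by (auto simp: nth_interval_def K ys_def)
      moreover have "z < ys ! i" if "i < length ys"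
      proof -
        have ki: "ks ! i < length xs" using ks_less that lys by simp
        have "K \<le> ks ! i"
          using K that lys sorted_wrt_nth_less[OF sks, of "i - 1" i] by (auto simp: Suc_le_eq)
        then have "xs ! K \<le> xs ! (ks ! i)"
          using sorted_wrt_nth_less[OF sxs, of K "ks ! i"] ki by (cases "K = ks ! i") auto
        moreover have "z < xs ! K" using z \<open>K \<le> ks ! i\<close> ki by (auto simp: nth_interval_def)
        ultimately show ?thesis using that lys by (simp add: ys_def)
      qed
      ultimately show ?thesis by (auto simp: nth_interval_def)
    qed
    have same: "isgn (poly F z) = isgn (poly F y)" if F: "F \<in> set Fs" for F
    proof (cases "F = 0")
      case False
      show ?thesis
      proof (rule isgn_poly_const)
        fix w assume w: "min z y \<le> w" "w \<le> max z y"
        have "w \<in> nth_interval ys i"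
        proof (cases "z \<le> y")
          case True
          then show ?thesis using nth_interval_convex[OF z' y, of w] w by simp
        next
          case False
          then show ?thesis using nth_interval_convex[OF y z', of w] w by simp
        qed
        then have "w \<notin> set ys" using nth_interval_not_in[OF sys _ i] by blast
        then show "poly F w \<noteq> 0" using set_ys F False by blast
      qed
    qed simp
    have "map (\<lambda>j. interval_signs T ! K ! j) js = map (\<lambda>j. isgn (poly (fs ! j) z)) js"
      using R Kle z js by auto
    also have "\<dots> = map (\<lambda>F. isgn (poly F y)) Fs"
      using same by (auto simp: Fs_def)
    finally show ?thesis using i lys unfolding K_def by (subst nth_map) simp_all
  qed
  \<comment> \<open>The old gaps between two retained points telescope; as they are positive, the
    valuation of their sum is the minimum.\<close>
  have 3: "val_rep (qreduce QMin (map (\<lambda>k. gaps T ! k) [ks ! i..<ks ! Suc i])) (ys ! Suc i - ys ! i)"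
    if i: "Suc i < length ks" for i
  proof -
    have lt: "ks ! i < ks ! Suc i" "ks ! Suc i < length xs"
      using sorted_wrt_nth_less[OF sks, of i "Suc i"] i ks_less[OF nth_mem[OF i]] by auto
    have "val_rep (qreduce QMin (map (\<lambda>k. gaps T ! k) [ks ! i..<ks ! Suc i])) (\<Sum>k\<leftarrow>[ks ! i..<ks ! Suc i]. xs ! Suc k - xs ! k)"
    proof (rule val_rep_sum)
      fix k assume "k \<in> set [ks ! i..<ks ! Suc i]"
      then have "Suc k < length xs" using lt by auto
      then show "val_rep (gaps T ! k) (xs ! Suc k - xs ! k) \<and> 0 \<le> xs ! Suc k - xs ! k"
        using gp sorted_wrt_nth_less[OF sxs, of k "Suc k"] by simp
    qed
    also have "(\<Sum>k\<leftarrow>[ks ! i..<ks ! Suc i]. xs ! Suc k - xs ! k) = xs ! (ks ! Suc i) - xs ! (ks ! i)"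
      using lt sum_Suc_diff'[of "ks ! i" "ks ! Suc i" "(!) xs"] by (simp add: interv_sum_list_conv_sum_set_nat)
    finally show ?thesis using i by (simp add: ys_def)
  qed
  have 4: "list_all2 (\<lambda>w y. list_all2 (\<lambda>t F. val_rep t (poly F y)) w Fs) (map (\<lambda>k. map (\<lambda>j. vals T ! k ! j) js) ks) ys"
    using vl ks_less js by (simp add: ys_def Fs_def list_all2_map1 list_all2_map2 list_all2_same)
  show ?thesis
    unfolding rep_tableau_def Let_def Fs_def[symmetric] roots T'
    using 1 2 3 4 lys by (simp add: list_all2_conv_all_nth[of val_rep])
qed

end

section \<open>The tree of families\<close>

subsection \<open>Stripping\<close>

definition strip_degree :: "'r::field mpoly set \<Rightarrow> 'r mpoly poly \<Rightarrow> nat" where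
  "strip_degree Z P = Max {i. i \<le> degree P \<and> (i = 0 \<or> \<not> known_zero Z (coeff P i))}"

lemma strip_degree_in: "strip_degree Z P \<le> degree P"
    "strip_degree Z P = 0 \<or> \<not> known_zero Z (coeff P (strip_degree Z P))"
proof -
  let ?M = "{i. i \<le> degree P \<and> (i = 0 \<or> \<not> known_zero Z (coeff P i))}"
  have "finite ?M" by (rule finite_subset[of _ "{..degree P}"]) auto
  moreover have "0 \<in> ?M" by simp
  ultimately have "strip_degree Z P \<in> ?M" unfolding strip_degree_def by (intro Max_in) auto
  then show "strip_degree Z P \<le> degree P"
    "strip_degree Z P = 0 \<or> \<not> known_zero Z (coeff P (strip_degree Z P))" by auto
qed

lemma known_zero_above:
  assumes "strip_degree Z P < i"
  shows "known_zero Z (coeff P i)"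
proof (cases "i \<le> degree P")
  case True
  define M where "M = {i. i \<le> degree P \<and> (i = 0 \<or> \<not> known_zero Z (coeff P i))}"
  have "finite M" unfolding M_def by (rule finite_subset[of _ "{..degree P}"]) auto
  have "i \<notin> M"
  proof
    assume "i \<in> M"
    then have "i \<le> Max M" using \<open>finite M\<close> by (rule Max_ge[rotated])
    moreover have "Max M < i" using assms by (simp add: strip_degree_def M_def)
    ultimately show False by linarith
  qed
  then show ?thesis using True by (auto simp: M_def)
next
  case False
  then show ?thesis by (simp add: known_zero_def coeff_eq_0)
qed

lemma strip_degreeI:
  assumes "m = 0 \<or> \<not> known_zero Z (coeff P m)" "\<And>i. m < i \<Longrightarrow> known_zero Z (coeff P i)"
  shows "strip_degree Z P = m"
  using assms strip_degree_in[of Z P] known_zero_above[of Z P]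
  by (metis gr_implies_not0 linorder_neqE_nat)

lemma coeff_strip: "coeff (strip Z P) i = (if i \<le> strip_degree Z P then coeff P i else 0)"
  by (simp add: strip_def strip_degree_def coeff_poly_cutoff less_Suc_eq_le)

lemma degree_strip: "degree (strip Z P) = strip_degree Z P"
proof (rule antisym)
  show "degree (strip Z P) \<le> strip_degree Z P"
    by (rule degree_le) (simp add: coeff_strip)
  show "strip_degree Z P \<le> degree (strip Z P)"
  proof (cases "strip_degree Z P = 0")
    case False
    then have "coeff P (strip_degree Z P) \<noteq> 0"
      using strip_degree_in(2)[of Z P] by (auto simp: known_zero_def)
    then show ?thesis by (intro le_degree) (simp add: coeff_strip)
  qed simp
qed

lemma degree_strip_le: "degree (strip Z P) \<le> degree P"
  by (simp add: degree_strip strip_degree_in)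

lemma lead_coeff_strip: "lead_coeff (strip Z P) = coeff P (strip_degree Z P)"
  by (simp add: degree_strip coeff_strip)

lemma lead_coeff_strip_not_known_zero:
  "1 \<le> degree (strip Z P) \<Longrightarrow> \<not> known_zero Z (lead_coeff (strip Z P))"
  using strip_degree_in(2)[of Z P] by (auto simp: degree_strip lead_coeff_strip coeff_strip)

lemma strip_0 [simp]: "strip Z 0 = 0"
  by (rule poly_eqI) (simp add: coeff_strip)

lemma scalar_multiple_refl: "scalar_multiple c c"
  unfolding scalar_multiple_def by (rule exI[of _ 1]) (simp add: single_one)

lemma degree_strip_insert:
  assumes "1 \<le> degree (strip Z P)"
  shows "degree (strip (insert (lead_coeff (strip Z P)) Z) P) < degree (strip Z P)"
proof -
  define m where "m = strip_degree Z P"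
  define Z' where "Z' = insert (coeff P m) Z"
  have "known_zero Z' (coeff P m)" using scalar_multiple_refl by (auto simp: known_zero_def Z'_def)
  moreover have "known_zero Z' (coeff P i)" if "m < i" for i
    using known_zero_above[of Z P i] that by (auto simp: known_zero_def Z'_def m_def)
  ultimately have "\<not> m \<le> strip_degree Z' P"
    using strip_degree_in(2)[of Z' P] assms by (auto simp: degree_strip m_def le_less)
  then show ?thesis by (simp add: degree_strip lead_coeff_strip coeff_strip Z'_def m_def)
qed

subsection \<open>Termination\<close>

text \<open>Separates 0 from the nonzero constants, so that the derivative of a nonzero constant
  ranks below it.\<close>

definition rank :: "'a::zero poly \<Rightarrow> nat" where
  "rank P = (if P = 0 then 0 else Suc (degree P))"

text \<open>Accounts for the branching steps, which leave the pending list alone: the outcome zero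
  lowers the degree of the stripped head, the outcome nonzero makes the value 0.\<close>

definition pending :: "'r::field node \<Rightarrow> nat" where
  "pending s = (case todo s of [] \<Rightarrow> 0 | P # _ \<Rightarrow>
     let Q = strip (zeros s) P in if known_nonzero (nonzeros s) (lead_coeff Q) then 0 else degree Q)"

text \<open>The second component is needed because, when \<open>0\<close> enters the family, its derivative \<open>0\<close> takes
  its place among the pending polynomials.\<close>

definition node_order :: "('r::field node \<times> 'r node) set" where
  "node_order = inv_image (mult less_than <*lex*> less_than <*lex*> less_than)
     (\<lambda>s. (image_mset rank (mset (todo s)), if 0 \<in> set (family s) then 0 else 1 :: nat, pending s))"

lemma wf_node_order: "wf node_order"
  unfolding node_order_def by (intro wf_inv_image wf_lex_prod wf_mult wf_less_than)

text \<open>A pseudoremainder has smaller degree than its divisor or is 0, and each divisor here has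
  at most the degree of Q.\<close>

lemma rank_new_prems:
  assumes "R \<in> set (new_prems D Q)"
  shows "rank R < rank Q"
proof -
  have *: "rank (pseudo_mod F G) \<le> degree G" if "1 \<le> degree G" for F G :: "'a mpoly poly"
  proof -
    have "G \<noteq> 0" using that by auto
    then show ?thesis using pseudo_mod(2)[of G F] by (auto simp: rank_def)
  qed
  have "1 \<le> degree Q" "rank R \<le> degree Q"
    using assms * by (auto simp: new_prems_def split: if_splits intro: order_trans)
  then show ?thesis by (auto simp: rank_def)
qed

lemma rank_pderiv: "Q \<noteq> 0 \<Longrightarrow> rank (pderiv Q) < rank Q"
proof (cases "degree Q = 0")
  case True
  moreover assume "Q \<noteq> 0"
  ultimately show ?thesis by (auto simp: rank_def elim!: degree_eq_zeroE)
next
  case False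
  have "degree (pderiv Q) \<le> degree Q - 1"
    by (rule degree_le) (auto simp: coeff_pderiv coeff_eq_0)
  then show ?thesis using False by (auto simp: rank_def)
qed

lemma rcvf2_step_decreases:
  assumes "rcvf2_step s s'"
  shows "(s', s) \<in> node_order"
  using assms
proof cases
  case (branch_zero Q Z P N Ps D)
  have "pending (Node (insert (lead_coeff Q) Z) N (P # Ps) D) \<le> degree (strip (insert (lead_coeff Q) Z) P)"
    by (simp add: pending_def Let_def)
  also have "\<dots> < degree Q" using degree_strip_insert[of Z P] branch_zero by simp
  also have "degree Q = pending s" using branch_zero by (simp add: pending_def Let_def)
  finally show ?thesis using branch_zero by (simp add: node_order_def)
next
  case (branch_nonzero Q Z P N Ps D)
  have "known_nonzero (insert (lead_coeff Q) N) (lead_coeff Q)"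
    using scalar_multiple_refl by (auto simp: known_nonzero_def)
  then show ?thesis using branch_nonzero by (simp add: node_order_def pending_def Let_def)
next
  case (old Q Z P N D Ps)
  have "(image_mset rank (mset Ps), image_mset rank (mset (P # Ps))) \<in> mult less_than"
    using one_step_implies_mult[of "{#rank P#}" "{#}" less_than "image_mset rank (mset Ps)"] by simp
  then show ?thesis using old by (simp add: node_order_def)
next
  case (new Q Z P N D Ps)
  show ?thesis
  proof (cases "Q = 0 \<and> P = 0")
    case True
    then have "new_prems D Q = []" by (auto simp: new_prems_def)
    then show ?thesis using new True by (simp add: node_order_def)
  next
    case False
    have QP: "rank Q \<le> rank P"
      using degree_strip_le[of Z P] new(3) by (auto simp: rank_def)
    \<comment> \<open>If Q = 0, then P is nonzero in this case and outranks the derivative 0 of Q;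
      otherwise everything new ranks below Q.\<close>
    have "rank R < rank P" if "R \<in> set (pderiv Q # new_prems D Q)" for R
    proof (cases "Q = 0")
      case True
      then have "new_prems D Q = []" by (auto simp: new_prems_def)
      then show ?thesis using that True False by (auto simp: rank_def)
    next
      case False
      then show ?thesis using that rank_pderiv[OF False] rank_new_prems[of R D Q] QP by auto
    qed
    then have "(image_mset rank (mset Ps) + image_mset rank (mset (pderiv Q # new_prems D Q)),
        image_mset rank (mset Ps) + {#rank P#}) \<in> mult less_than"
      by (intro one_step_implies_mult) auto
    then show ?thesis using new by (simp add: node_order_def ac_simps)
  qed
qed

lemma finite_successors: "finite {s'. rcvf2_step s s'}"
proof (cases s)
  case (Node Z N td D)
  show ?thesis
  proof (cases td)
    case Nil
    then have "{s'. rcvf2_step s s'} = {}" using Node by (auto elim: rcvf2_step.cases)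
    then show ?thesis by simp
  next
    case (Cons P Ps)
    let ?Q = "strip Z P"
    have "{s'. rcvf2_step s s'} \<subseteq> {Node (insert (lead_coeff ?Q) Z) N (P # Ps) D,
      Node Z (insert (lead_coeff ?Q) N) (P # Ps) D, Node Z N Ps D,
      Node Z N (Ps @ pderiv ?Q # new_prems D ?Q) (D @ [?Q])}"
    proof
      fix s' assume "s' \<in> {s'. rcvf2_step s s'}"
      then have "rcvf2_step (Node Z N (P # Ps) D) s'" using Node Cons by simp
      then show "s' \<in> {Node (insert (lead_coeff ?Q) Z) N (P # Ps) D,
        Node Z (insert (lead_coeff ?Q) N) (P # Ps) D, Node Z N Ps D,
        Node Z N (Ps @ pderiv ?Q # new_prems D ?Q) (D @ [?Q])}"
        by cases simp_all
    qed
    then show ?thesis by (rule finite_subset) simp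
  qed
qed

text \<open>Well-founded induction and finite branching, as in Koenig's lemma.\<close>

lemma finite_reachable: "finite {s'. rcvf2_step\<^sup>*\<^sup>* s s'}"
proof (induction s rule: wf_induct_rule[OF wf_node_order])
  case (1 s)
  have "{s'. rcvf2_step\<^sup>*\<^sup>* s s'} = insert s (\<Union>t\<in>{t. rcvf2_step s t}. {s'. rcvf2_step\<^sup>*\<^sup>* t s'})"
    by (auto elim: converse_rtranclpE intro: converse_rtranclp_into_rtranclp)
  moreover have "finite {s'. rcvf2_step\<^sup>*\<^sup>* t s'}" if "rcvf2_step s t" for t
    using 1[OF rcvf2_step_decreases[OF that]] .
  ultimately show ?case using finite_successors[of s] by simp
qed

lemma finite_rcvf2_nodes: "finite (rcvf2_nodes L)"
  unfolding rcvf2_nodes_def by (rule finite_reachable)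

lemma no_infinite_rcvf2_path: "\<not> (\<forall>i::nat. rcvf2_step (path i) (path (Suc i)))"
  using wf_node_order rcvf2_step_decreases unfolding wf_iff_no_infinite_down_chain by blast

subsection \<open>Evaluation of parametrized polynomials\<close>

definition monom_eval :: "(nat \<Rightarrow> 'r) \<Rightarrow> (nat \<Rightarrow>\<^sub>0 nat) \<Rightarrow> 'r::comm_ring_1" where
  "monom_eval p m = (\<Prod>i\<in>Poly_Mapping.keys m. p i ^ Poly_Mapping.lookup m i)"

lemma monom_eval_superset:
  assumes "finite I" "Poly_Mapping.keys m \<subseteq> I"
  shows "monom_eval p m = (\<Prod>i\<in>I. p i ^ Poly_Mapping.lookup m i)"
  unfolding monom_eval_def using assms by (intro prod.mono_neutral_left) (auto simp: in_keys_iff)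

lemma monom_eval_add: "monom_eval p (m + m') = monom_eval p m * monom_eval p m'"
proof -
  let ?I = "Poly_Mapping.keys m \<union> Poly_Mapping.keys m'"
  have "monom_eval p (m + m') = (\<Prod>i\<in>?I. p i ^ Poly_Mapping.lookup (m + m') i)"
    by (rule monom_eval_superset) (auto simp: in_keys_iff lookup_add)
  also have "\<dots> = (\<Prod>i\<in>?I. p i ^ Poly_Mapping.lookup m i) * (\<Prod>i\<in>?I. p i ^ Poly_Mapping.lookup m' i)"
    by (simp add: lookup_add power_add prod.distrib)
  also have "\<dots> = monom_eval p m * monom_eval p m'"
    by (simp add: monom_eval_superset[of ?I])
  finally show ?thesis .
qed

lemma mpoly_eval_alt: "mpoly_eval p c = (\<Sum>m\<in>Poly_Mapping.keys c. Poly_Mapping.lookup c m * monom_eval p m)"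
  by (simp add: mpoly_eval_def monom_eval_def)

lemma mpoly_eval_0 [simp]: "mpoly_eval p 0 = 0"
  by (simp add: mpoly_eval_alt)

lemma mpoly_eval_add: "mpoly_eval p (c + d) = mpoly_eval p c + mpoly_eval p d"
  unfolding mpoly_eval_alt by (rule setsum_keys_plus_distrib) (auto simp: algebra_simps)

lemma mpoly_eval_sum: "mpoly_eval p (sum f I) = (\<Sum>i\<in>I. mpoly_eval p (f i))"
  by (induction I rule: infinite_finite_induct) (auto simp: mpoly_eval_add)

lemma mpoly_eval_single: "mpoly_eval p (Poly_Mapping.single m a) = a * monom_eval p m"
  by (cases "a = 0") (auto simp: mpoly_eval_alt)

lemma mpoly_eval_scalar [simp]: "mpoly_eval p (Poly_Mapping.single 0 a) = a"
  by (simp add: mpoly_eval_single monom_eval_def)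

lemma mpoly_eval_1 [simp]: "mpoly_eval p 1 = 1"
  using mpoly_eval_scalar[of p 1] by (simp only: single_one)

lemma mpoly_sum_single: "c = (\<Sum>m\<in>Poly_Mapping.keys c. Poly_Mapping.single m (Poly_Mapping.lookup c m))"
  by (rule poly_mapping_eqI) (auto simp: lookup_sum lookup_single when_def in_keys_iff sum.delta')

lemma mpoly_eval_mult: "mpoly_eval p (c * d) = mpoly_eval p c * mpoly_eval p d"
proof -
  have "mpoly_eval p (c * d) = mpoly_eval p (\<Sum>m\<in>Poly_Mapping.keys c. \<Sum>m'\<in>Poly_Mapping.keys d.
      Poly_Mapping.single (m + m') (Poly_Mapping.lookup c m * Poly_Mapping.lookup d m'))"
    by (subst mpoly_sum_single[of c], subst mpoly_sum_single[of d]) (simp add: sum_product mult_single)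
  also have "\<dots> = mpoly_eval p c * mpoly_eval p d"
    unfolding mpoly_eval_sum mpoly_eval_single monom_eval_add mpoly_eval_alt[of p c] mpoly_eval_alt[of p d] sum_product
    by (intro sum.cong refl) (simp add: algebra_simps)
  finally show ?thesis .
qed

lemma mpoly_eval_power: "mpoly_eval p (c ^ n) = mpoly_eval p c ^ n"
  by (induction n) (auto simp: mpoly_eval_mult)

lemma mpoly_eval_of_nat: "mpoly_eval p (of_nat n) = of_nat n"
  by (induction n) (auto simp: mpoly_eval_add)

lemma coeff_specialize: "coeff (specialize p F) i = mpoly_eval p (coeff F i)"
  by (simp add: specialize_def coeff_map_poly)

lemma specialize_add: "specialize p (F + G) = specialize p F + specialize p G"
  by (rule poly_eqI) (simp add: coeff_specialize mpoly_eval_add)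

lemma specialize_mult: "specialize p (F * G) = specialize p F * specialize p G"
  by (rule poly_eqI) (simp add: coeff_specialize coeff_mult mpoly_eval_sum mpoly_eval_mult)

lemma specialize_smult: "specialize p (smult c F) = smult (mpoly_eval p c) (specialize p F)"
  by (rule poly_eqI) (simp add: coeff_specialize mpoly_eval_mult)

lemma specialize_pderiv: "specialize p (pderiv F) = pderiv (specialize p F)"
  by (rule poly_eqI) (simp add: coeff_specialize coeff_pderiv mpoly_eval_mult mpoly_eval_add mpoly_eval_of_nat)

subsection \<open>Polynomials over a subfield\<close>

context
  fixes K :: "'r::field set"
  assumes K: "is_subfield K"
begin

lemma subfield_closed: "0 \<in> K" "1 \<in> K" "x \<in> K \<Longrightarrow> y \<in> K \<Longrightarrow> x + y \<in> K" "x \<in> K \<Longrightarrow> y \<in> K \<Longrightarrow> x * y \<in> K"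
  "x \<in> K \<Longrightarrow> - x \<in> K"
  using K by (auto simp: is_subfield_def)

lemma subfield_sum: "(\<And>i. i \<in> I \<Longrightarrow> f i \<in> K) \<Longrightarrow> sum f I \<in> K"
  by (induction I rule: infinite_finite_induct) (auto intro: subfield_closed)

lemma mpoly_over_0: "mpoly_over K 0"
  by (simp add: mpoly_over_def subfield_closed)

lemma mpoly_over_1: "mpoly_over K 1"
  by (simp add: mpoly_over_def lookup_one when_def subfield_closed)

lemma mpoly_over_add: "mpoly_over K c \<Longrightarrow> mpoly_over K d \<Longrightarrow> mpoly_over K (c + d)"
  by (simp add: mpoly_over_def lookup_add subfield_closed)

lemma mpoly_over_uminus: "mpoly_over K c \<Longrightarrow> mpoly_over K (- c)"
  by (simp add: mpoly_over_def subfield_closed)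

lemma mpoly_over_sum: "(\<And>i. i \<in> I \<Longrightarrow> mpoly_over K (f i)) \<Longrightarrow> mpoly_over K (sum f I)"
  by (simp add: mpoly_over_def lookup_sum subfield_sum)

lemma mpoly_over_mult:
  assumes "mpoly_over K c" "mpoly_over K d"
  shows "mpoly_over K (c * d)"
proof -
  have "c * d = (\<Sum>m\<in>Poly_Mapping.keys c. \<Sum>m'\<in>Poly_Mapping.keys d.
      Poly_Mapping.single (m + m') (Poly_Mapping.lookup c m * Poly_Mapping.lookup d m'))"
    by (subst mpoly_sum_single[of c], subst mpoly_sum_single[of d]) (simp add: sum_product mult_single)
  moreover have "mpoly_over K (Poly_Mapping.single (m + m') (Poly_Mapping.lookup c m * Poly_Mapping.lookup d m'))" for m m'
    using assms by (auto simp: mpoly_over_def lookup_single when_def intro: subfield_closed)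
  ultimately show ?thesis by (auto intro!: mpoly_over_sum)
qed

lemma param_poly_over_diff: "param_poly_over K F \<Longrightarrow> param_poly_over K G \<Longrightarrow> param_poly_over K (F - G)"
  using mpoly_over_add[OF _ mpoly_over_uminus] by (auto simp: param_poly_over_def)

lemma param_poly_over_mult: "param_poly_over K F \<Longrightarrow> param_poly_over K G \<Longrightarrow> param_poly_over K (F * G)"
  by (auto simp: param_poly_over_def coeff_mult intro!: mpoly_over_sum mpoly_over_mult)

lemma param_poly_over_smult: "mpoly_over K c \<Longrightarrow> param_poly_over K F \<Longrightarrow> param_poly_over K (smult c F)"
  by (auto simp: param_poly_over_def intro!: mpoly_over_mult)

lemma param_poly_over_monom: "mpoly_over K c \<Longrightarrow> param_poly_over K (monom c n)"
  by (auto simp: param_poly_over_def mpoly_over_0)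

lemma param_poly_over_pderiv:
  assumes "param_poly_over K F"
  shows "param_poly_over K (pderiv F)"
proof -
  have "mpoly_over K (of_nat n)" for n
    by (induction n) (auto intro: mpoly_over_0 mpoly_over_1 mpoly_over_add)
  then have "mpoly_over K (of_nat (Suc n))" for n by blast
  then show ?thesis
    using assms unfolding param_poly_over_def coeff_pderiv by (blast intro: mpoly_over_mult)
qed

text \<open>Pseudodivision multiplies by the leading coefficient where ordinary division would
  divide by it, so ring operations alone keep the coefficients over \<open>K\<close>.\<close>

lemma param_poly_over_pseudo_divmod_main:
  "mpoly_over K lc \<Longrightarrow> param_poly_over K r \<Longrightarrow> param_poly_over K d \<Longrightarrow>
   param_poly_over K (snd (pseudo_divmod_main lc q r d dr n))"
proof (induction n arbitrary: q r dr)
  case (Suc n)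
  have "param_poly_over K (smult lc r - monom (coeff r dr) n * d)"
    using Suc.prems by (intro param_poly_over_diff param_poly_over_smult param_poly_over_mult param_poly_over_monom)
      (auto simp: param_poly_over_def)
  then show ?case using Suc by (simp add: Let_def)
qed simp

lemma param_poly_over_pseudo_mod:
  assumes "param_poly_over K F" "param_poly_over K G"
  shows "param_poly_over K (pseudo_mod F G)"
proof -
  have "mpoly_over K (coeff G (degree G))" using assms by (simp add: param_poly_over_def)
  then show ?thesis using assms param_poly_over_pseudo_divmod_main
    by (simp add: pseudo_mod_def pseudo_divmod_def Let_def)
qed

lemma param_poly_over_strip: "param_poly_over K P \<Longrightarrow> param_poly_over K (strip Z P)"
  by (auto simp: param_poly_over_def coeff_strip mpoly_over_0)

definition node_over :: "'r node \<Rightarrow> bool" where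
  "node_over s \<longleftrightarrow> (\<forall>F\<in>set (todo s) \<union> set (family s). param_poly_over K F)"

lemma node_over_step:
  assumes "rcvf2_step s s'" "node_over s"
  shows "node_over s'"
  using assms
proof cases
  case (new Q Z P N D Ps)
  then have Q: "param_poly_over K Q" using assms(2) param_poly_over_strip by (auto simp: node_over_def)
  moreover have "param_poly_over K R" if "R \<in> set (new_prems D Q)" for R
    using that Q new assms(2) by (auto simp: new_prems_def node_over_def intro!: param_poly_over_pseudo_mod split: if_splits)
  ultimately show ?thesis using new assms(2) param_poly_over_pderiv by (auto simp: node_over_def)
qed (use assms(2) in \<open>auto simp: node_over_def\<close>)

lemma constants_over:
  assumes "\<forall>F\<in>set L. param_poly_over K F" "c \<in> all_constants L"
  shows "mpoly_over K c"
proof -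
  obtain s Q where s: "s \<in> rcvf2_leaves L" "Q \<in> set (leaf_family s)" "c = coeff Q 0"
    using assms(2) by (auto simp: all_constants_def leaf_constants_def)
  have "rcvf2_step\<^sup>*\<^sup>* (rcvf2_root L) s" using s by (simp add: rcvf2_leaves_def rcvf2_nodes_def)
  then have "node_over s"
  proof induction
    case base
    then show ?case using assms(1) by (simp add: node_over_def rcvf2_root_def)
  next
    case (step y z)
    then show ?case using node_over_step by blast
  qed
  then show ?thesis using s by (auto simp: node_over_def leaf_family_def param_poly_over_def)
qed

end

lemma finite_all_constants: "finite (all_constants L)"
proof -
  have "finite (leaf_constants s)" for s :: "'a node"
  proof -
    have "leaf_constants s \<subseteq> (\<lambda>Q. coeff Q 0) ` set (leaf_family s)" by (auto simp: leaf_constants_def)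
    then show ?thesis by (rule finite_subset) simp
  qed
  moreover have "finite (rcvf2_leaves L)"
    using finite_rcvf2_nodes[of L] by (rule rev_finite_subset) (auto simp: rcvf2_leaves_def)
  ultimately show ?thesis by (simp add: all_constants_def)
qed

subsection \<open>Invariants of the tree\<close>

lemma scalar_multiple_sym: "scalar_multiple c d \<Longrightarrow> scalar_multiple d c"
proof -
  assume "scalar_multiple c d"
  then obtain a where a: "a \<noteq> 0" "c = Poly_Mapping.single 0 a * d" by (auto simp: scalar_multiple_def)
  have "Poly_Mapping.single 0 (inverse a) * c = Poly_Mapping.single (0 + 0) (inverse a * a) * d"
    unfolding a(2) mult.assoc[symmetric] mult_single ..
  then have "d = Poly_Mapping.single 0 (inverse a) * c" using a(1) by simp
  then show ?thesis unfolding scalar_multiple_def using a(1) by (intro exI[of _ "inverse a"]) auto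
qed

lemma scalar_multiple_trans:
  assumes "scalar_multiple c d" "scalar_multiple d e"
  shows "scalar_multiple c e"
proof -
  obtain a where a: "a \<noteq> 0" "c = Poly_Mapping.single 0 a * d" using assms by (auto simp: scalar_multiple_def)
  obtain b where b: "b \<noteq> 0" "d = Poly_Mapping.single 0 b * e" using assms by (auto simp: scalar_multiple_def)
  have "c = Poly_Mapping.single (0 + 0) (a * b) * e"
    unfolding a(2) b(2) mult.assoc[symmetric] mult_single ..
  then show ?thesis unfolding scalar_multiple_def using a b by (intro exI[of _ "a * b"]) simp
qed

lemma scalar_multiple_zero_iff: "scalar_multiple c d \<Longrightarrow> c = 0 \<longleftrightarrow> d = 0"
  using scalar_multiple_sym by (fastforce simp: scalar_multiple_def)

text \<open>Tests are remembered up to nonzero scalars, so what is known must be invariant under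
  them.\<close>

lemma known_zero_cong: "scalar_multiple c d \<Longrightarrow> known_zero Z d \<Longrightarrow> known_zero Z c"
  unfolding known_zero_def using scalar_multiple_trans scalar_multiple_zero_iff by blast

lemma known_nonzero_cong: "scalar_multiple c d \<Longrightarrow> known_nonzero N d \<Longrightarrow> known_nonzero N c"
  unfolding known_nonzero_def using scalar_multiple_trans by blast

lemma known_zero_insert: "known_zero (insert c Z) x \<longleftrightarrow> scalar_multiple x c \<or> known_zero Z x"
  by (auto simp: known_zero_def)

lemma known_nonzero_insert: "known_nonzero (insert c N) x \<longleftrightarrow> scalar_multiple x c \<or> known_nonzero N x"
  by (auto simp: known_nonzero_def)

lemma known_zero_mono: "Z \<subseteq> Z' \<Longrightarrow> known_zero Z x \<Longrightarrow> known_zero Z' x"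
  by (auto simp: known_zero_def)

lemma known_nonzero_mono: "N \<subseteq> N' \<Longrightarrow> known_nonzero N x \<Longrightarrow> known_nonzero N' x"
  by (auto simp: known_nonzero_def)

lemma strip_eqI:
  assumes "degree P = 0 \<or> \<not> known_zero Z (lead_coeff P)"
  shows "strip Z P = P"
proof -
  have "strip_degree Z P = degree P"
    using assms by (intro strip_degreeI) (auto simp: known_zero_def coeff_eq_0)
  then show ?thesis by (intro poly_eqI) (simp add: coeff_strip coeff_eq_0)
qed

definition consistent :: "'r::field node \<Rightarrow> bool" where
  "consistent s \<longleftrightarrow> (\<forall>c. \<not> (known_zero (zeros s) c \<and> known_nonzero (nonzeros s) c))"

definition settled :: "'r::field node \<Rightarrow> 'r mpoly poly \<Rightarrow> bool" where
  "settled s Q \<longleftrightarrow> degree Q = 0 \<or> known_nonzero (nonzeros s) (lead_coeff Q)"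

text \<open>The form of closure that survives steps: a derivative or pseudoremainder still on the
  list is not yet stripped, and how it will be stripped depends on later tests. At a leaf it becomes
  membership in the family.\<close>

definition covered :: "'r::field node \<Rightarrow> 'r mpoly poly \<Rightarrow> bool" where
  "covered s P \<longleftrightarrow> P \<in> set (todo s) \<or> strip (zeros s) P \<in> set (family s)"

definition node_inv :: "'r::field node \<Rightarrow> bool" where
  "node_inv s \<longleftrightarrow> consistent s \<and> (\<forall>Q\<in>set (family s). settled s Q) \<and> distinct (family s) \<and>
    (\<forall>Q\<in>set (family s). covered s (pderiv Q)) \<and>
    (\<forall>Q\<in>set (family s). \<forall>S\<in>set (family s). 1 \<le> degree S \<and> degree S \<le> degree Q \<longrightarrow> covered s (pseudo_mod Q S))"

text \<open>At a consistent node a leading coefficient known to be nonzero is not known to be zero,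
  so further tests do not shorten a settled polynomial.\<close>

lemma strip_stable:
  assumes "consistent s'" "zeros s \<subseteq> zeros s'" "settled s' (strip (zeros s) P)"
  shows "strip (zeros s') P = strip (zeros s) P"
proof -
  have "strip_degree (zeros s') P = strip_degree (zeros s) P"
  proof (rule strip_degreeI)
    show "strip_degree (zeros s) P = 0 \<or> \<not> known_zero (zeros s') (coeff P (strip_degree (zeros s) P))"
      using assms(1,3) by (auto simp: settled_def consistent_def degree_strip coeff_strip)
    show "known_zero (zeros s') (coeff P i)" if "strip_degree (zeros s) P < i" for i
      using known_zero_above[OF that] known_zero_mono[OF assms(2)] by blast
  qed
  then show ?thesis by (intro poly_eqI) (simp add: coeff_strip)
qed

lemma step_mono:
  assumes "rcvf2_step s s'"
  shows "zeros s \<subseteq> zeros s'" "nonzeros s \<subseteq> nonzeros s'" "set (family s) \<subseteq> set (family s')"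
  using assms by (cases; auto)+

text \<open>A test is made only on a coefficient not known to be nonzero, and stripping ensures that
  it is not known to be zero; so neither outcome conflicts with earlier ones.\<close>

lemma consistent_step:
  assumes "rcvf2_step s s'" "consistent s"
  shows "consistent s'"
  using assms(1)
proof cases
  case (branch_zero Q Z P N Ps D)
  have "\<not> known_nonzero N x" if "scalar_multiple x (lead_coeff Q)" for x
    using branch_zero(5) known_nonzero_cong[OF scalar_multiple_sym[OF that]] by blast
  then show ?thesis using assms(2) branch_zero(1,2) by (auto simp: consistent_def known_zero_insert)
next
  case (branch_nonzero Q Z P N Ps D)
  have "\<not> known_zero Z (lead_coeff Q)"
    using lead_coeff_strip_not_known_zero[of Z P] branch_nonzero by simp
  then have "\<not> known_zero Z x" if "scalar_multiple x (lead_coeff Q)" for x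
    using known_zero_cong[OF scalar_multiple_sym[OF that]] by blast
  then show ?thesis using assms(2) branch_nonzero(1,2) by (auto simp: consistent_def known_nonzero_insert)
qed (use assms(2) in \<open>auto simp: consistent_def\<close>)

lemma settled_step: "rcvf2_step s s' \<Longrightarrow> settled s Q \<Longrightarrow> settled s' Q"
  unfolding settled_def using known_nonzero_mono step_mono(2) by blast

lemma covered_step:
  assumes step: "rcvf2_step s s'" and inv: "consistent s" "\<forall>Q\<in>set (family s). settled s Q" and cov: "covered s P"
  shows "covered s' P"
proof (cases "strip (zeros s) P \<in> set (family s)")
  case True
  then have "settled s' (strip (zeros s) P)" using inv settled_step[OF step] by blast
  then have "strip (zeros s') P = strip (zeros s) P"
    using strip_stable[OF consistent_step[OF step inv(1)] step_mono(1)[OF step]] by blast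
  then show ?thesis using True step_mono(3)[OF step] by (auto simp: covered_def)
next
  case False
  then have "P \<in> set (todo s)" using cov by (simp add: covered_def)
  with step show ?thesis by cases (auto simp: covered_def)
qed

lemma node_inv_step:
  assumes step: "rcvf2_step s s'" and inv: "node_inv s"
  shows "node_inv s'"
proof -
  have inv': "consistent s" "\<forall>Q\<in>set (family s). settled s Q" using inv by (auto simp: node_inv_def)
  note cov = covered_step[OF step inv'] and con = consistent_step[OF step inv'(1)]
  show ?thesis
  proof (cases "family s' = family s")
    case True
    then show ?thesis using inv cov con settled_step[OF step] unfolding node_inv_def True by blast
  next
    case False
    with step obtain Q Z P N D Ps where s: "s = Node Z N (P # Ps) D"
      and s': "s' = Node Z N (Ps @ pderiv Q # new_prems D Q) (D @ [Q])"
      and Q: "Q = strip Z P" "degree Q = 0 \<or> known_nonzero N (lead_coeff Q)" "Q \<notin> set D"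
      by cases auto
    have D: "\<forall>G\<in>set D. settled s' G" "distinct D" "\<forall>G\<in>set D. covered s' (pderiv G)"
      "\<forall>G\<in>set D. \<forall>H\<in>set D. 1 \<le> degree H \<and> degree H \<le> degree G \<longrightarrow> covered s' (pseudo_mod G H)"
      using inv cov settled_step[OF step] unfolding node_inv_def s by simp_all
    have 1: "settled s' Q" using Q by (simp add: settled_def s')
    have 2: "covered s' (pderiv Q)" by (simp add: covered_def s')
    have 3: "covered s' (pseudo_mod Q H)" if "H \<in> set (D @ [Q])" "1 \<le> degree H" "degree H \<le> degree Q" for H
      using that by (auto simp: covered_def s' new_prems_def)
    have 4: "covered s' (pseudo_mod G Q)" if "G \<in> set D" "1 \<le> degree Q" "degree Q \<le> degree G" for G
      using that by (auto simp: covered_def s' new_prems_def)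
    have "set (family s') = insert Q (set D)" by (simp add: s')
    then show ?thesis unfolding node_inv_def
      using con D 1 2 3 4 Q(3) by (simp add: s')
  qed
qed

lemma node_inv_root: "node_inv (rcvf2_root L)"
proof -
  have "c \<noteq> 0" if "known_nonzero {} (c :: 'a mpoly)" for c
    using that scalar_multiple_zero_iff[of c 1] by (auto simp: known_nonzero_def)
  then show ?thesis by (auto simp: node_inv_def rcvf2_root_def consistent_def known_zero_def)
qed

lemma node_inv_reachable: "rcvf2_step\<^sup>*\<^sup>* (rcvf2_root L) s \<Longrightarrow> node_inv s"
  by (induction rule: rtranclp_induct) (auto intro: node_inv_root node_inv_step)

lemma covered_reachable:
  "rcvf2_step\<^sup>*\<^sup>* s s' \<Longrightarrow> node_inv s \<Longrightarrow> covered s P \<Longrightarrow> node_inv s' \<and> covered s' P"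
proof (induction rule: rtranclp_induct)
  case (step y z)
  then have "node_inv y" "covered y P" by auto
  then show ?case using node_inv_step[OF step.hyps(2)] covered_step[OF step.hyps(2)]
    by (simp add: node_inv_def)
qed simp

lemma mono_reachable:
  "rcvf2_step\<^sup>*\<^sup>* s s' \<Longrightarrow> zeros s \<subseteq> zeros s' \<and> nonzeros s \<subseteq> nonzeros s'"
  by (induction rule: rtranclp_induct) (auto dest: step_mono)

lemma covered_leaf: "covered s P \<Longrightarrow> todo s = [] \<Longrightarrow> strip (zeros s) P \<in> set (family s)"
  by (simp add: covered_def)

subsection \<open>The leaf of a parameter\<close>

lemma node_holds_reachable: "rcvf2_step\<^sup>*\<^sup>* s s' \<Longrightarrow> node_holds p s' \<Longrightarrow> node_holds p s"
  using mono_reachable[of s s'] by (auto simp: node_holds_def)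

text \<open>Steps are forced except for the outcome of a test, and no parameter satisfies both
  outcomes.\<close>

lemma step_unique:
  assumes "rcvf2_step s s1" "rcvf2_step s s2" "node_holds p s1" "node_holds p s2"
  shows "s1 = s2"
  using assms(1)
proof cases
  case 1: (branch_zero Q Z P N Ps D)
  show ?thesis using assms(2) unfolding 1(1)
    by cases (use 1 assms(3,4) in \<open>auto simp: node_holds_def\<close>)
next
  case 1: (branch_nonzero Q Z P N Ps D)
  show ?thesis using assms(2) unfolding 1(1)
    by cases (use 1 assms(3,4) in \<open>auto simp: node_holds_def\<close>)
next
  case 1: (old Q Z P N D Ps)
  show ?thesis using assms(2) unfolding 1(1)
    by cases (use 1 assms(3,4) in \<open>auto simp: node_holds_def\<close>)
next
  case 1: (new Q Z P N D Ps)
  show ?thesis using assms(2) unfolding 1(1)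
    by cases (use 1 assms(3,4) in \<open>auto simp: node_holds_def\<close>)
qed

lemma step_exists:
  assumes "todo s \<noteq> []" "node_holds p s"
  shows "\<exists>s'. rcvf2_step s s' \<and> node_holds p s'"
proof -
  obtain Z N P Ps D where s: "s = Node Z N (P # Ps) D"
    using assms(1) by (cases s) (auto simp: neq_Nil_conv)
  define Q where "Q = strip Z P"
  show ?thesis
  proof (cases "degree Q = 0 \<or> known_nonzero N (lead_coeff Q)")
    case True
    show ?thesis
    proof (cases "Q \<in> set D")
      case True': True
      then show ?thesis using rcvf2_step.old[OF Q_def True True'] assms(2) unfolding s
        by (intro exI conjI) (auto simp: node_holds_def)
    next
      case False
      then show ?thesis using rcvf2_step.new[OF Q_def True False] assms(2) unfolding s
        by (intro exI conjI) (auto simp: node_holds_def)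
    qed
  next
    case False
    then have d: "1 \<le> degree Q" "\<not> known_nonzero N (lead_coeff Q)" by auto
    show ?thesis
    proof (cases "mpoly_eval p (lead_coeff Q) = 0")
      case True
      then show ?thesis using rcvf2_step.branch_zero[OF Q_def d] assms(2) unfolding s
        by (intro exI conjI) (auto simp: node_holds_def)
    next
      case False
      then show ?thesis using rcvf2_step.branch_nonzero[OF Q_def d] assms(2) unfolding s
        by (intro exI conjI) (auto simp: node_holds_def)
    qed
  qed
qed

lemma leaf_no_step: "todo s = [] \<Longrightarrow> \<not> rcvf2_step s s'"
  by (auto elim: rcvf2_step.cases)

lemma leaf_exists: "node_holds p s \<Longrightarrow> \<exists>t. rcvf2_step\<^sup>*\<^sup>* s t \<and> todo t = [] \<and> node_holds p t"
proof (induction s rule: wf_induct_rule[OF wf_node_order])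
  case (1 s)
  show ?case
  proof (cases "todo s = []")
    case False
    then obtain s' where s': "rcvf2_step s s'" "node_holds p s'" using step_exists 1(2) by blast
    then obtain t where "rcvf2_step\<^sup>*\<^sup>* s' t" "todo t = []" "node_holds p t"
      using 1(1)[OF rcvf2_step_decreases[OF s'(1)] s'(2)] by blast
    then show ?thesis using s'(1) converse_rtranclp_into_rtranclp by metis
  qed (use 1(2) in blast)
qed

lemma leaf_unique:
  "rcvf2_step\<^sup>*\<^sup>* s t \<Longrightarrow> rcvf2_step\<^sup>*\<^sup>* s t' \<Longrightarrow> todo t = [] \<Longrightarrow> todo t' = [] \<Longrightarrow>
   node_holds p t \<Longrightarrow> node_holds p t' \<Longrightarrow> t = t'"
proof (induction arbitrary: t' rule: converse_rtranclp_induct)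
  case base
  then show ?case using leaf_no_step by (metis converse_rtranclpE)
next
  case (step s u)
  from step.prems(1) show ?case
  proof (cases rule: converse_rtranclpE)
    case base
    then show ?thesis using step.prems(3) step.hyps(1) leaf_no_step by blast
  next
    case (step u')
    have "node_holds p u" "node_holds p u'"
      using node_holds_reachable step.hyps(2) step(2) step.prems(4,5) by blast+
    then have "u = u'" using step_unique step.hyps(1) step(1) by blast
    then show ?thesis using step.IH step(2) step.prems by blast
  qed
qed

lemma unique_leaf: "\<exists>!s. s \<in> rcvf2_leaves L \<and> node_holds p s"
proof -
  have "node_holds p (rcvf2_root L)" by (simp add: node_holds_def rcvf2_root_def)
  then obtain t where t: "rcvf2_step\<^sup>*\<^sup>* (rcvf2_root L) t" "todo t = []" "node_holds p t"
    using leaf_exists by blast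
  show ?thesis
  proof (rule ex1I[of _ t])
    show "t \<in> rcvf2_leaves L \<and> node_holds p t" using t by (simp add: rcvf2_leaves_def rcvf2_nodes_def)
    fix s assume "s \<in> rcvf2_leaves L \<and> node_holds p s"
    then have "rcvf2_step\<^sup>*\<^sup>* (rcvf2_root L) s" "todo s = []" "node_holds p s"
      by (auto simp: rcvf2_leaves_def rcvf2_nodes_def)
    then show "s = t" using leaf_unique t by blast
  qed
qed

subsection \<open>The signs of the constants determine the leaf\<close>

text \<open>Derivatives enter the family only in stripped form. Those of Q have leading coefficients
  that are scalar multiples of one known to be nonzero, so stripping leaves them unchanged, and all
  of them down to degree 0 belong to the family at the leaf.\<close>

lemma constant_of_tested:
  fixes s t :: "'r::field_char_0 node"
  assumes inv: "node_inv s" and s: "rcvf2_step\<^sup>*\<^sup>* s t" "todo t = []"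
    and P: "covered s P" and Q: "Q = strip (zeros s) P" "1 \<le> degree Q" "known_nonzero (nonzeros s) (lead_coeff Q)"
  shows "\<exists>c\<in>leaf_constants t. scalar_multiple c (lead_coeff Q)"
proof -
  have t: "node_inv t" "covered t P" using covered_reachable[OF s(1) inv P] by auto
  then have con: "consistent t" by (simp add: node_inv_def)
  have nz: "known_nonzero (nonzeros t) (lead_coeff Q)"
    using Q(3) known_nonzero_mono mono_reachable[OF s(1)] by blast
  have "strip (zeros t) P = Q"
    unfolding Q(1) using mono_reachable[OF s(1)] nz Q(1) by (intro strip_stable con) (auto simp: settled_def)
  then have Qt: "Q \<in> set (family t)" using covered_leaf[OF t(2) s(2)] by simp
  have "\<exists>R\<in>set (family t). degree R = degree Q - i \<and> scalar_multiple (lead_coeff R) (lead_coeff Q)"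
    if "i \<le> degree Q" for i
    using that
  proof (induction i)
    case 0
    then show ?case using Qt scalar_multiple_refl by (intro bexI[of _ Q]) auto
  next
    case (Suc i)
    then obtain R where R: "R \<in> set (family t)" "degree R = degree Q - i" "scalar_multiple (lead_coeff R) (lead_coeff Q)"
      by auto
    have dR: "degree R > 0" using R(2) Suc.prems by simp
    have "lead_coeff (pderiv R) = of_nat (degree R) * lead_coeff R"
      using dR by (simp add: degree_pderiv coeff_pderiv)
    then have "scalar_multiple (lead_coeff (pderiv R)) (lead_coeff R)"
      unfolding scalar_multiple_def using dR by (intro exI[of _ "of_nat (degree R)"]) simp
    then have sc: "scalar_multiple (lead_coeff (pderiv R)) (lead_coeff Q)" using R(3) scalar_multiple_trans by blast
    then have "known_nonzero (nonzeros t) (lead_coeff (pderiv R))" using nz known_nonzero_cong by blast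
    then have "strip (zeros t) (pderiv R) = pderiv R"
      using con by (intro strip_eqI) (auto simp: consistent_def)
    moreover have "covered t (pderiv R)" using t(1) R(1) by (auto simp: node_inv_def)
    ultimately have "pderiv R \<in> set (family t)" using covered_leaf[OF _ s(2)] by metis
    then show ?case using sc R(2) by (intro bexI[of _ "pderiv R"]) (auto simp: degree_pderiv)
  qed
  from this[of "degree Q"] obtain R where R: "R \<in> set (family t)" "degree R = 0" "scalar_multiple (lead_coeff R) (lead_coeff Q)"
    by auto
  then have "coeff R 0 \<in> leaf_constants t" by (auto simp: leaf_constants_def leaf_family_def)
  then show ?thesis using R by (intro bexI[of _ "coeff R 0"]) auto
qed

lemma scalar_multiple_eval:
  "scalar_multiple c d \<Longrightarrow> mpoly_eval p c = 0 \<longleftrightarrow> mpoly_eval p d = (0 :: 'r::field)"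
  by (auto simp: scalar_multiple_def mpoly_eval_mult)

lemma constant_signs_eq_zero:
  assumes "constant_signs L p = constant_signs L p'" "c \<in> all_constants L"
  shows "mpoly_eval p c = 0 \<longleftrightarrow> mpoly_eval p' c = (0 :: 'r::linordered_field)"
proof -
  have "isgn (mpoly_eval p c) = isgn (mpoly_eval p' c)"
    using fun_cong[OF assms(1), of c] assms(2) by (simp add: constant_signs_def)
  then show ?thesis by (auto simp: isgn_def split: if_splits)
qed

text \<open>Along the path to s the parameter p' must make the same choices as p. At each test the
  coefficient is, up to a scalar, a constant of some leaf, so its vanishing at p and at p' is
  equivalent.\<close>

lemma leaf_determined:
  fixes L :: "'r::linordered_field mpoly poly list"
  assumes eq: "constant_signs L p = constant_signs L p'"
    and s: "s \<in> rcvf2_leaves L" "node_holds p s"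
  shows "node_holds p' s"
proof -
  \<comment> \<open>Any leaf t below the outcome nonzero will do, whichever outcome holds at p: a
    scalar multiple of the coefficient is among the constants of t.\<close>
  have tested: "mpoly_eval p (lead_coeff Q) = 0 \<longleftrightarrow> mpoly_eval p' (lead_coeff Q) = 0"
    if h: "rcvf2_step\<^sup>*\<^sup>* (rcvf2_root L) u" "u = Node Z N (P # Ps) D" "Q = strip Z P" "1 \<le> degree Q"
      "\<not> known_nonzero N (lead_coeff Q)"
      "rcvf2_step\<^sup>*\<^sup>* (Node Z (insert (lead_coeff Q) N) (P # Ps) D) t" "todo t = []" for u Z N P Ps D Q t
  proof -
    let ?w = "Node Z (insert (lead_coeff Q) N) (P # Ps) D"
    have step: "rcvf2_step u ?w" unfolding h(2) by (rule rcvf2_step.branch_nonzero[OF h(3,4,5)])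
    then have inv: "node_inv ?w" using node_inv_step node_inv_reachable[OF h(1)] by blast
    have "covered ?w P" by (simp add: covered_def)
    moreover have "known_nonzero (nonzeros ?w) (lead_coeff Q)"
      using scalar_multiple_refl by (auto simp: known_nonzero_insert)
    ultimately obtain c where c: "c \<in> leaf_constants t" "scalar_multiple c (lead_coeff Q)"
      using constant_of_tested[OF inv h(6,7), of P Q] h(3,4) by auto
    have "rcvf2_step\<^sup>*\<^sup>* (rcvf2_root L) t" using h(1,6) step by auto
    then have "c \<in> all_constants L"
      using c(1) h(7) by (auto simp: all_constants_def rcvf2_leaves_def rcvf2_nodes_def)
    then show ?thesis using constant_signs_eq_zero[OF eq] scalar_multiple_eval[OF c(2)] by metis
  qed
  have st: "rcvf2_step\<^sup>*\<^sup>* (rcvf2_root L) s" "todo s = []"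
    using s by (auto simp: rcvf2_leaves_def rcvf2_nodes_def)
  have "rcvf2_step\<^sup>*\<^sup>* u s \<longrightarrow> node_holds p' u" if "rcvf2_step\<^sup>*\<^sup>* (rcvf2_root L) u" for u
    using that
  proof (induction rule: rtranclp_induct)
    case base
    then show ?case by (simp add: node_holds_def rcvf2_root_def)
  next
    case (step u w)
    show ?case
    proof
      assume ws: "rcvf2_step\<^sup>*\<^sup>* w s"
      have u: "node_holds p' u" using step.IH ws step.hyps(2) by (meson converse_rtranclp_into_rtranclp)
      have w: "node_holds p w" using node_holds_reachable[OF ws s(2)] .
      from step.hyps(2) show "node_holds p' w"
      proof cases
        case 1: (branch_zero Q Z P N Ps D)
        show ?thesis
        proof (rule ccontr)
          assume "\<not> ?thesis"
          then have nz: "mpoly_eval p' (lead_coeff Q) \<noteq> 0" using u 1 by (auto simp: node_holds_def)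
          then have "node_holds p' (Node Z (insert (lead_coeff Q) N) (P # Ps) D)"
            using u 1 by (auto simp: node_holds_def)
          \<comment> \<open>If p' left the path of p here, it would reach a leaf of its own below
            the outcome nonzero, which serves as t.\<close>
          then obtain t where "rcvf2_step\<^sup>*\<^sup>* (Node Z (insert (lead_coeff Q) N) (P # Ps) D) t" "todo t = []"
            using leaf_exists by blast
          then have "mpoly_eval p (lead_coeff Q) = 0 \<longleftrightarrow> mpoly_eval p' (lead_coeff Q) = 0"
            by (intro tested[OF step.hyps(1) 1(1,3,4,5)])
          then show False using nz w 1 by (auto simp: node_holds_def)
        qed
      next
        case 1: (branch_nonzero Q Z P N Ps D)
        have "mpoly_eval p (lead_coeff Q) = 0 \<longleftrightarrow> mpoly_eval p' (lead_coeff Q) = 0"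
          using ws st(2) unfolding 1(2) by (intro tested[OF step.hyps(1) 1(1,3,4,5)])
        then show ?thesis using u w 1 by (auto simp: node_holds_def)
      qed (use u in \<open>auto simp: node_holds_def\<close>)
    qed
  qed
  then show ?thesis using st(1) by blast
qed

section \<open>The computation at a leaf\<close>

lemma position_in:
  assumes "x \<in> set xs"
  shows "position xs x < length xs" "xs ! position xs x = x"
  using assms by (induction xs) (auto simp: position_def)

lemma degree_specialize_le: "degree (specialize p Q) \<le> degree Q"
  by (rule degree_le) (simp add: coeff_specialize coeff_eq_0)

locale leaf =
  fixes L :: "'r::real_closed_field mpoly poly list" and s :: "'r node" and p :: "nat \<Rightarrow> 'r"
  assumes leaf: "s \<in> rcvf2_leaves L" and holds: "node_holds p s"
begin

abbreviation (input) "Ps \<equiv> leaf_family s"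

lemma leaf_todo: "todo s = []"
  using leaf by (simp add: rcvf2_leaves_def)

lemma leaf_reachable: "rcvf2_step\<^sup>*\<^sup>* (rcvf2_root L) s"
  using leaf by (simp add: rcvf2_leaves_def rcvf2_nodes_def)

lemma leaf_inv: "node_inv s"
  using node_inv_reachable[OF leaf_reachable] .

lemma set_leaf_family: "set Ps = set (family s)"
  by (simp add: leaf_family_def)

lemma covered_in_leaf_family: "covered s P \<Longrightarrow> strip (zeros s) P \<in> set Ps"
  using covered_leaf leaf_todo set_leaf_family by blast

lemma known_zero_eval: "known_zero (zeros s) c \<Longrightarrow> mpoly_eval p c = 0"
  using holds scalar_multiple_eval by (auto simp: known_zero_def node_holds_def)

lemma known_nonzero_eval: "known_nonzero (nonzeros s) c \<Longrightarrow> mpoly_eval p c \<noteq> 0"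
proof -
  assume "known_nonzero (nonzeros s) c"
  then obtain z where "z \<in> insert 1 (nonzeros s)" and c: "scalar_multiple c z"
    by (auto simp: known_nonzero_def)
  then have "mpoly_eval p z \<noteq> 0" using holds by (auto simp: node_holds_def)
  then show ?thesis using scalar_multiple_eval[OF c] by simp
qed

lemma specialize_strip: "specialize p (strip (zeros s) P) = specialize p P"
  by (rule poly_eqI) (simp add: coeff_specialize coeff_strip known_zero_eval known_zero_above)

text \<open>Members of positive degree are settled, so their leading coefficients do not vanish at
  p.\<close>

lemma degree_specialize:
  assumes "Q \<in> set Ps"
  shows "degree (specialize p Q) = degree Q"
proof (cases "degree Q = 0")
  case True
  then show ?thesis using degree_specialize_le[of p Q] by simp
next
  case False
  then have "known_nonzero (nonzeros s) (lead_coeff Q)"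
    using leaf_inv assms set_leaf_family by (auto simp: node_inv_def settled_def)
  then have "coeff (specialize p Q) (degree Q) \<noteq> 0"
    using known_nonzero_eval by (simp add: coeff_specialize)
  then have "degree Q \<le> degree (specialize p Q)" by (rule le_degree)
  then show ?thesis using degree_specialize_le[of p Q] by simp
qed

lemma degree_sorted: "i \<le> j \<Longrightarrow> j < length Ps \<Longrightarrow> degree (Ps ! i) \<le> degree (Ps ! j)"
  using sorted_nth_mono[of "map degree Ps" i j] by (simp add: leaf_family_def)

text \<open>In a list sorted by degree, strictly smaller degree means an earlier position; stripping
  can only lower the degree and does not affect the specialization at p.\<close>

lemma position_less:
  assumes "covered s P" "degree P < degree (Ps ! j)" "j < length Ps"
  defines "i \<equiv> position Ps (strip (zeros s) P)"
  shows "i < j" "specialize p (Ps ! i) = specialize p P"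
proof -
  note i = position_in[OF covered_in_leaf_family[OF assms(1)], folded i_def]
  have "degree (Ps ! i) < degree (Ps ! j)"
    unfolding i(2) using degree_strip_le[of "zeros s" P] assms(2) by simp
  then show "i < j" using degree_sorted[of j i] i(1) by (meson leD leI)
  show "specialize p (Ps ! i) = specialize p P" unfolding i(2) by (rule specialize_strip)
qed

lemma leaf_constants_all: "leaf_constants s \<subseteq> all_constants L"
  using leaf by (auto simp: all_constants_def)

text \<open>The admissible variables are the constants of nonzero sign, because
  \<open>the (v 0)\<close> is no valuation; at these the environment returns the valuation of the
  specialized constant.\<close>

lemma tableau_model_leaf:
  assumes "convex_valuation v V P"
  shows "tableau_model v V P (\<lambda>c. the (v (mpoly_eval p c))) {c \<in> leaf_constants s. constant_signs L p c \<noteq> 0}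
    (leaf_skeleton s) (constant_signs L p) (map (specialize p) Ps)"
proof -
  interpret convex_valuation v V P by fact
  show ?thesis
  proof (unfold_locales, goal_cases)
    case (1 j)
    then show ?case by (simp add: leaf_skeleton_def Let_def degree_specialize)
  next
    case (2 j)
    then have j: "j < length Ps" by simp
    have Q: "Ps ! j \<in> set Ps" using j by simp
    have d: "1 \<le> degree (Ps ! j)" using 2 j degree_specialize[OF Q] by simp
    have cov: "covered s (pderiv (Ps ! j))"
      using leaf_inv Q set_leaf_family by (simp add: node_inv_def)
    have "degree (pderiv (Ps ! j)) < degree (Ps ! j)" using d by (simp add: degree_pderiv)
    note p = position_less[OF cov this j]
    show ?case using p j by (simp add: leaf_skeleton_def Let_def specialize_pderiv)
  next
    case (3 j l)
    then have j: "j < length Ps" and l: "l < length Ps" by simp_all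
    define F where "F = Ps ! j"
    define G where "G = Ps ! l"
    have FG: "F \<in> set Ps" "G \<in> set Ps" using j l by (auto simp: F_def G_def)
    have d: "1 \<le> degree G" "degree G \<le> degree F"
      using 3 j l degree_specialize FG by (auto simp: F_def G_def)
    define R where "R = pseudo_mod F G"
    have cov: "covered s R"
      using leaf_inv FG set_leaf_family d by (simp add: node_inv_def R_def)
    have G0: "G \<noteq> 0" using d by auto
    obtain q where q: "pseudo_divmod F G = (q, R)" unfolding R_def pseudo_mod_def by (metis prod.collapse)
    note pd = pseudo_divmod[OF G0 q]
    have "degree R < degree F" using pd(2) d by auto
    note pos = position_less[OF cov this[unfolded F_def] j]
    have "specialize p (smult (coeff G (degree G) ^ (Suc (degree F) - degree G)) F) = specialize p (G * q + R)"
      using pd(1) by simp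
    then have "smult (coeff (specialize p G) (degree G) ^ (Suc (degree F) - degree G)) (specialize p F) =
        specialize p G * specialize p q + specialize p R"
      by (simp add: specialize_smult specialize_add specialize_mult mpoly_eval_power coeff_specialize)
    then show ?case
      using pos j l degree_specialize[OF FG(1)] degree_specialize[OF FG(2)]
      by (auto simp: leaf_skeleton_def Let_def F_def[symmetric] G_def[symmetric] R_def[symmetric])
  next
    case (4 j)
    then have j: "j < length Ps" by simp
    define c where "c = coeff (Ps ! j) 0"
    have Q: "Ps ! j \<in> set Ps" using j by simp
    have "degree (Ps ! j) = 0" using 4 j degree_specialize[OF Q] by simp
    then have c: "c \<in> leaf_constants s" using Q by (auto simp: leaf_constants_def c_def)
    then have "constant_signs L p c = isgn (mpoly_eval p c)"
      using leaf_constants_all by (auto simp: constant_signs_def)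
    then show ?case using c j
      by (auto simp: leaf_skeleton_def Let_def coeff_specialize c_def[symmetric] val_def)
  next
    case (5 i j)
    then show ?case using degree_sorted[of i j] by (simp add: degree_specialize)
  qed
qed

lemma leaf_tableaux:
  assumes "convex_valuation v V P"
  defines "\<sigma> \<equiv> constant_signs L p"
  shows "complete_tableau_of_vscs v (map (specialize p) L) (eval_tableau v p (rcvf2_tableau L s \<sigma>))"
    "complete_tableau_of_vscs v (map (specialize p) Ps) (eval_tableau v p (rcvf2_family_tableau s \<sigma>))"
    "tableau_variables (rcvf2_tableau L s \<sigma>) \<union> tableau_variables (rcvf2_family_tableau s \<sigma>)
      \<subseteq> {c \<in> leaf_constants s. \<sigma> c \<noteq> 0}"
proof -
  define fs where "fs = map (specialize p) Ps"
  define js where "js = map (\<lambda>F. position Ps (strip (zeros s) F)) L"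
  interpret tableau_model v V P "\<lambda>c. the (v (mpoly_eval p c))" "{c \<in> leaf_constants s. \<sigma> c \<noteq> 0}"
    "leaf_skeleton s" \<sigma> fs
    unfolding \<sigma>_def fs_def by (rule tableau_model_leaf[OF assms(1)])
  have T: "rep_tableau fs (rcvf2_family_tableau s \<sigma>)"
    using rep_tableau_family by (simp add: rcvf2_family_tableau_def fs_def)
  have pos: "position Ps (strip (zeros s) F) < length fs \<and> fs ! position Ps (strip (zeros s) F) = specialize p F"
    if "F \<in> set L" for F
  proof -
    \<comment> \<open>At the root the members of \<open>L\<close> are pending; this persists as
      \<open>covered\<close> down to the leaf, where their stripped forms belong to the
      family.\<close>
    have "covered (rcvf2_root L) F" using that by (simp add: covered_def rcvf2_root_def)
    then have "covered s F" using covered_reachable[OF leaf_reachable node_inv_root] by blast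
    note p = position_in[OF covered_in_leaf_family[OF this]]
    then show ?thesis by (simp add: fs_def specialize_strip)
  qed
  have js: "map ((!) fs) js = map (specialize p) L" using pos by (simp add: js_def)
  have TL: "rep_tableau (map (specialize p) L) (rcvf2_tableau L s \<sigma>)"
    using rep_subtableau[OF T, of js] pos unfolding js
    by (auto simp: rcvf2_tableau_def js_def)
  show "complete_tableau_of_vscs v (map (specialize p) L) (eval_tableau v p (rcvf2_tableau L s \<sigma>))"
    unfolding eval_tableau_def by (rule rep_tableau_complete[OF TL])
  show "complete_tableau_of_vscs v (map (specialize p) Ps) (eval_tableau v p (rcvf2_family_tableau s \<sigma>))"
    unfolding eval_tableau_def using rep_tableau_complete[OF T] by (simp add: fs_def)
  show "tableau_variables (rcvf2_tableau L s \<sigma>) \<union> tableau_variables (rcvf2_family_tableau s \<sigma>)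
      \<subseteq> {c \<in> leaf_constants s. \<sigma> c \<noteq> 0}"
    using rep_tableau_vars[OF T] rep_tableau_vars[OF TL] by simp
qed

end

text \<open>The computed tableau depends on p only through the leaf and the signs of the constants,
  and there are finitely many of both. The restriction in \<open>constant_signs\<close> makes the
  signs an element of a finite space \<open>PiE\<close>.\<close>

lemma finite_computed_tableaux:
  "finite {rcvf2_tableau L s (constant_signs L p) | s p. s \<in> rcvf2_leaves L \<and> node_holds p s}"
proof (rule finite_subset)
  show "{rcvf2_tableau L s (constant_signs L p) | s p. s \<in> rcvf2_leaves L \<and> node_holds p s} \<subseteq>
    (\<lambda>(s, \<sigma>). rcvf2_tableau L s \<sigma>) ` (rcvf2_nodes L \<times> PiE (all_constants L) (\<lambda>_. {- 1, 0, 1}))"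
  proof clarify
    fix s p assume "s \<in> rcvf2_leaves L" "node_holds p s"
    then have "s \<in> rcvf2_nodes L" by (simp add: rcvf2_leaves_def)
    moreover have "constant_signs L p \<in> PiE (all_constants L) (\<lambda>_. {- 1, 0, 1})"
      by (auto simp: constant_signs_def isgn_def)
    ultimately show "rcvf2_tableau L s (constant_signs L p) \<in>
      (\<lambda>(s, \<sigma>). rcvf2_tableau L s \<sigma>) ` (rcvf2_nodes L \<times> PiE (all_constants L) (\<lambda>_. {- 1, 0, 1}))"
      by (intro image_eqI[of _ _ "(s, constant_signs L p)"]) auto
  qed
  show "finite ((\<lambda>(s, \<sigma>). rcvf2_tableau L s \<sigma>) ` (rcvf2_nodes L \<times> PiE (all_constants L) (\<lambda>_. {- 1, 0, 1 :: int})))"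
    by (intro finite_imageI finite_cartesian_product finite_rcvf2_nodes finite_PiE finite_all_constants) auto
qed

theorem theorem3p1p1:
  fixes K V P V\<^sub>R P\<^sub>R :: "'r::real_closed_field set"
    and v :: "'r \<Rightarrow> 'g::linordered_ab_group_add option"
    and L :: "'r mpoly poly list"
  assumes "ordered_valued_field UNIV V\<^sub>R P\<^sub>R"
    and "ordered_valued_field K V P"
    and "V = V\<^sub>R \<inter> K" and "P = P\<^sub>R \<inter> K"
    and "valuation_of_ring v V\<^sub>R"
    and "\<forall>F\<in>set L. param_poly_over K F"
  shows "(finite (rcvf2_nodes L) \<and>
          \<not> (\<exists>path. path 0 = rcvf2_root L \<and> (\<forall>i::nat. rcvf2_step (path i) (path (Suc i))))) \<and>
         (finite (all_constants L) \<and> (\<forall>c\<in>all_constants L. mpoly_over K c)) \<and>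
         (\<forall>p. \<exists>!s. s \<in> rcvf2_leaves L \<and> node_holds p s) \<and>
         finite {rcvf2_tableau L s (constant_signs L p) | s p. s \<in> rcvf2_leaves L \<and> node_holds p s} \<and>
         (\<forall>p p'. constant_signs L p = constant_signs L p' \<longrightarrow>
            (\<forall>s\<in>rcvf2_leaves L. node_holds p s \<longleftrightarrow> node_holds p' s)) \<and>
         (\<forall>s p \<sigma> T\<^sub>L T. s \<in> rcvf2_leaves L \<and> node_holds p s \<and> \<sigma> = constant_signs L p \<and>
            T\<^sub>L = rcvf2_tableau L s \<sigma> \<and> T = rcvf2_family_tableau s \<sigma> \<longrightarrow>
            complete_tableau_of_vscs v (map (specialize p) L) (eval_tableau v p T\<^sub>L) \<and>
            complete_tableau_of_vscs v (map (specialize p) (leaf_family s)) (eval_tableau v p T) \<and>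
            tableau_variables T\<^sub>L \<union> tableau_variables T \<subseteq> {c \<in> leaf_constants s. \<sigma> c \<noteq> 0})"
proof (intro conjI)
  show "finite (rcvf2_nodes L)" by (rule finite_rcvf2_nodes)
  show "\<not> (\<exists>path. path 0 = rcvf2_root L \<and> (\<forall>i::nat. rcvf2_step (path i) (path (Suc i))))"
    using no_infinite_rcvf2_path by blast
  show "finite (all_constants L)" by (rule finite_all_constants)
  show "\<forall>c\<in>all_constants L. mpoly_over K c"
    using constants_over[OF _ assms(6)] assms(2) by (simp add: ordered_valued_field_def)
  show "\<forall>p. \<exists>!s. s \<in> rcvf2_leaves L \<and> node_holds p s" using unique_leaf by blast
  show "finite {rcvf2_tableau L s (constant_signs L p) | s p. s \<in> rcvf2_leaves L \<and> node_holds p s}"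
    by (rule finite_computed_tableaux)
  show "\<forall>p p'. constant_signs L p = constant_signs L p' \<longrightarrow>
            (\<forall>s\<in>rcvf2_leaves L. node_holds p s \<longleftrightarrow> node_holds p' s)"
    using leaf_determined by metis
  have cv: "convex_valuation v V\<^sub>R P\<^sub>R" using assms(1,5) by unfold_locales
  show "\<forall>s p \<sigma> T\<^sub>L T. s \<in> rcvf2_leaves L \<and> node_holds p s \<and> \<sigma> = constant_signs L p \<and>
            T\<^sub>L = rcvf2_tableau L s \<sigma> \<and> T = rcvf2_family_tableau s \<sigma> \<longrightarrow>
            complete_tableau_of_vscs v (map (specialize p) L) (eval_tableau v p T\<^sub>L) \<and>
            complete_tableau_of_vscs v (map (specialize p) (leaf_family s)) (eval_tableau v p T) \<and>
            tableau_variables T\<^sub>L \<union> tableau_variables T \<subseteq> {c \<in> leaf_constants s. \<sigma> c \<noteq> 0}"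
    using leaf.leaf_tableaux[OF leaf.intro cv] by blast
qed

end
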